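(* Let $\beta>1$ and let $\varPhi_\beta$ be the homogenized metric of the chessboard structure with values $1$ and $\beta$ (defined in the context). For $(x,y)\in\mathbb{R}^2$ put $M=\max\{|x|,|y|\}$, $m=\min\{|x|,|y|\}$. Then for every $(x,y)\in\mathbb{R}^2$: (i) if $\beta\geq\beta^c_0$, then $\varPhi_\beta(x,y)=M+(\sqrt{2}-1)m$; (ii) if $\sqrt{3/2}\leq\beta\leq\beta^c_0$, then \[ \varPhi_\beta(x,y)=\begin{cases} M+(\Lambda_3-3)m, & \text{if } 3m\leq M,\\[2pt] \dfrac{\Lambda_3-\sqrt{2}}{2}\,M+\dfrac{3\sqrt{2}-\Lambda_3}{2}\,m, & \text{if } 3m\geq M.\end{cases} \]
   Context: Chessboard structure: for $\beta>1$ let $a_\beta:\mathbb{R}^2\to\{1,\beta\}$ be $2$-periodic in each variable with, on $[0,2)\times[0,2)$, $a_\beta=\beta$ on $((0,1)\times(1,2))\cup((1,2)\times(0,1))$ and $a_\beta=1$ otherwise (so $a_\beta=1$ on all lines $x\in\mathbb{Z}$, $y\in\mathbb{Z}$). For $\varepsilon>0$ let $d^\varepsilon_\beta(0,\xi)=\inf\{\int_0^1 a_\beta(u(t)/\varepsilon)|u'(t)|\,dt:\ u\in AC([0,1];\mathbb{R}^2),\ u(0)=0,\ u(1)=\xi\}$, and $\varPhi_\beta(\xi)=\lim_{\varepsilon\to0^+}d^\varepsilon_\beta(0,\xi)$ (the limit exists). Normalized length: for $t\ge 0$ let $q(t)=\lfloor t+1\rfloor/2$ if $\lfloor t\rfloor$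 is odd and $q(t)=t-\lfloor t\rfloor/2$ if $\lfloor t\rfloor$ is even, $p(t)=t+1-q(t)$; let $\hat\sigma(t,\beta)\in(0,1)$ be the unique solution $\sigma$ of $\frac{p(t)\sigma}{\sqrt{1-\sigma^2}}+\frac{q(t)\sigma}{\sqrt{\beta^2-\sigma^2}}=1$, and $l(t,\beta)=\frac{p(t)}{\sqrt{1-\hat\sigma^2}}+\frac{\beta^2q(t)}{\sqrt{\beta^2-\hat\sigma^2}}-t-\sqrt2$ with $\hat\sigma=\hat\sigma(t,\beta)$. The number $\beta^c_0$ is the unique $\beta\in(1,\sqrt2)$ with $l(2,\beta)=0$ (existence and uniqueness are established in the paper). $\Lambda_3=\Lambda_3(\beta)=\frac{2}{\sqrt{1-\sigma_3^2}}+\frac{\beta^2}{\sqrt{\beta^2-\sigma_3^2}}$, where $\sigma_3\in(0,1)$ is the unique solution of $\frac{2\sigma}{\sqrt{1-\sigma^2}}+\frac{\sigma}{\sqrt{\beta^2-\sigma^2}}=1$ (this is the optical length of the geodesic joining $(0,0)$ to $(3,1)$ inside the strip $0\le y\le1$). *)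

theory Defs
  imports "HOL-Analysis.Analysis"
begin

definition chess :: "real \<Rightarrow> real \<times> real \<Rightarrow> real" where
  "chess \<beta> z = (let s = fst z - 2 * of_int \<lfloor>fst z / 2\<rfloor>;
                     t = snd z - 2 * of_int \<lfloor>snd z / 2\<rfloor>
                 in if (0 < s \<and> s < 1 \<and> 1 < t \<and> t < 2) \<or> (1 < s \<and> s < 2 \<and> 0 < t \<and> t < 1)
                    then \<beta> else 1)"

definition abs_cont01 :: "(real \<Rightarrow> real \<times> real) \<Rightarrow> bool" where
  "abs_cont01 u \<longleftrightarrow>
     (\<forall>e>0. \<exists>d>0. \<forall>(n::nat) (a::nat \<Rightarrow> real) (b::nat \<Rightarrow> real).
        (\<forall>i<n. 0 \<le> a i \<and> a i \<le> b i \<and> b i \<le> 1) \<and>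
        (\<forall>i<n. \<forall>j<n. i \<noteq> j \<longrightarrow> b i \<le> a j \<or> b j \<le> a i) \<and>
        (\<Sum>i<n. b i - a i) < d
        \<longrightarrow> (\<Sum>i<n. norm (u (b i) - u (a i))) < e)"

definition wlength :: "real \<Rightarrow> real \<Rightarrow> (real \<Rightarrow> real \<times> real) \<Rightarrow> ennreal" where
  "wlength \<epsilon> \<beta> u = (\<integral>\<^sup>+ t. ennreal (chess \<beta> ((1 / \<epsilon>) *\<^sub>R u t) * norm (vector_derivative u (at t)))
                        * indicator {0..1} t \<partial>lebesgue)"

definition dist_eps :: "real \<Rightarrow> real \<Rightarrow> real \<times> real \<Rightarrow> real" where
  "dist_eps \<epsilon> \<beta> \<xi> = enn2real (INF u \<in> {u. abs_cont01 u \<and> u 0 = 0 \<and> u 1 = \<xi>}. wlength \<epsilon> \<beta> u)"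

definition Phi :: "real \<Rightarrow> real \<times> real \<Rightarrow> real" where
  "Phi \<beta> \<xi> = Lim (at_right 0) (\<lambda>\<epsilon>. dist_eps \<epsilon> \<beta> \<xi>)"

definition qf :: "real \<Rightarrow> real" where
  "qf t = (if odd \<lfloor>t\<rfloor> then of_int \<lfloor>t + 1\<rfloor> / 2 else t - of_int \<lfloor>t\<rfloor> / 2)"

definition pf :: "real \<Rightarrow> real" where
  "pf t = t + 1 - qf t"

definition sigma_hat :: "real \<Rightarrow> real \<Rightarrow> real" where
  "sigma_hat t \<beta> = (THE \<sigma>. 0 < \<sigma> \<and> \<sigma> < 1 \<and>
      pf t * \<sigma> / sqrt (1 - \<sigma>\<^sup>2) + qf t * \<sigma> / sqrt (\<beta>\<^sup>2 - \<sigma>\<^sup>2) = 1)"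

definition lnorm :: "real \<Rightarrow> real \<Rightarrow> real" where
  "lnorm t \<beta> = (let \<sigma> = sigma_hat t \<beta> in
      pf t / sqrt (1 - \<sigma>\<^sup>2) + \<beta>\<^sup>2 * qf t / sqrt (\<beta>\<^sup>2 - \<sigma>\<^sup>2) - t - sqrt 2)"

definition beta_c0 :: real where
  "beta_c0 = (THE \<beta>. 1 < \<beta> \<and> \<beta> < sqrt 2 \<and> lnorm 2 \<beta> = 0)"

definition sigma3 :: "real \<Rightarrow> real" where
  "sigma3 \<beta> = (THE \<sigma>. 0 < \<sigma> \<and> \<sigma> < 1 \<and>
      2 * \<sigma> / sqrt (1 - \<sigma>\<^sup>2) + \<sigma> / sqrt (\<beta>\<^sup>2 - \<sigma>\<^sup>2) = 1)"

definition Lambda3 :: "real \<Rightarrow> real" where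
  "Lambda3 \<beta> = 2 / sqrt (1 - (sigma3 \<beta>)\<^sup>2) + \<beta>\<^sup>2 / sqrt (\<beta>\<^sup>2 - (sigma3 \<beta>)\<^sup>2)"

end

theory Submission
  imports Defs
begin

text \<open>
  Upper bounds for \<open>Phi\<close> come from explicit paths built of three moves between lattice points \<open>(i, j)\<close>
  with \<open>i + j\<close> even: grid lines (cost 1 per unit), diagonals of cells of weight 1, and the refracted
  geodesic from \<open>(i, j)\<close> to \<open>(i + 3, j + 1)\<close> of cost \<open>Lambda3\<close>.

  Lower bounds come from calibrations: a function \<open>W\<close> that is locally \<open>chess \<beta>\<close>-Lipschitz and satisfies
  \<open>W (x, y) \<ge> p x + q y - C\<close> gives \<open>Phi \<beta> (x, y) \<ge> p x + q y\<close>. Both faces of the unit ball are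
  attained by slopes \<open>(p, q)\<close> with \<open>3 p + q = Lambda3 \<beta>\<close>, and \<open>W\<close> is given on each cell by minima and
  maxima of distances and affine functions; \<open>\<beta>\<^sup>2 \<ge> 3/2\<close> is needed for a gradient \<open>(1, 1/sqrt 2)\<close>
  inside the cells of weight \<open>\<beta>\<close>. Above \<open>beta_c0\<close> the calibration for \<open>beta_c0\<close> still works.
\<close>

section \<open>Functions of bounded variation\<close>

text \<open>The admissible curves are only absolutely continuous, and \<open>wlength\<close> sees
  nothing of them but \<open>vector_derivative\<close>. The lower bound therefore needs that such a
  curve is differentiable almost everywhere and that an increment of \<open>W\<close> along it is
  controlled by local slopes. The former comes from bounded variation and Vitali's covering theorem.
  For the latter the chain rule fails, because \<open>W\<close> has kinks on which a curve may spend
  positive time; increments are estimated instead of derivatives.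

  The slopes are dictated by the moves. Unit cost along (1, 0), (1, 1) and (3, 1) reads p = 1, p + q
  = sqrt 2 and 3 p + q = \<open>Lambda3 \<beta>\<close>; a face of the unit ball lies between two
  neighbouring moves and solves their two equations. All three hold at once exactly when
  \<open>Lambda3 \<beta>\<close> is 2 + sqrt 2, the cost of one diagonal and two horizontal units;
  that is the threshold \<open>beta_c0\<close>. The functions \<open>W\<close> agree with p i + q j
  at every lattice point (i, j), so that only the behaviour between lattice points has to be
  designed.\<close>

definition nonoverlapping :: "(real \<times> real) set \<Rightarrow> real \<Rightarrow> real \<Rightarrow> bool" where
  "nonoverlapping F c d \<longleftrightarrow> finite F \<and> (\<forall>(a, b)\<in>F. c \<le> a \<and> a < b \<and> b \<le> d) \<and>
     (\<forall>(a, b)\<in>F. \<forall>(a', b')\<in>F. (a, b) \<noteq> (a', b') \<longrightarrow> b \<le> a' \<or> b' \<le> a)"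

definition variation_sum :: "(real \<Rightarrow> real) \<Rightarrow> (real \<times> real) set \<Rightarrow> real" where
  "variation_sum f F = (\<Sum>(a, b)\<in>F. \<bar>f b - f a\<bar>)"

definition variation :: "(real \<Rightarrow> real) \<Rightarrow> real \<Rightarrow> real \<Rightarrow> real" where
  "variation f c d = Sup (variation_sum f ` {F. nonoverlapping F c d})"

definition bv_on :: "(real \<Rightarrow> real) \<Rightarrow> real \<Rightarrow> real \<Rightarrow> bool" where
  "bv_on f c d \<longleftrightarrow> bdd_above (variation_sum f ` {F. nonoverlapping F c d})"

text \<open>Variant of \<open>abs_cont01\<close> for finite sets of intervals and arbitrary normed
  values: the form in which gauge partitions deliver their intervals.\<close>

definition ac01 :: "(real \<Rightarrow> 'a::real_normed_vector) \<Rightarrow> bool" where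
  "ac01 u \<longleftrightarrow> (\<forall>e>0. \<exists>d>0. \<forall>F. nonoverlapping F 0 1 \<and> (\<Sum>(a, b)\<in>F. b - a) < d
     \<longrightarrow> (\<Sum>(a, b)\<in>F. norm (u b - u a)) < e)"

section \<open>Finite families of nonoverlapping intervals\<close>

lemma nonoverlappingD:
  assumes "nonoverlapping F c d" "(a, b) \<in> F"
  shows "c \<le> a" "a < b" "b \<le> d"
  using assms unfolding nonoverlapping_def by auto

lemma nonoverlapping_disjoint:
  assumes "nonoverlapping F c d" "(a, b) \<in> F" "(a', b') \<in> F" "(a, b) \<noteq> (a', b')"
  shows "b \<le> a' \<or> b' \<le> a"
proof -
  from assms(1) have "\<forall>(a, b)\<in>F. \<forall>(a', b')\<in>F. (a, b) \<noteq> (a', b') \<longrightarrow> b \<le> a' \<or> b' \<le> a"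
    unfolding nonoverlapping_def by simp
  from bspec[OF bspec[OF this assms(2), simplified] assms(3)] assms(4) show ?thesis by simp
qed

lemma nonoverlappingI:
  assumes "finite F" "\<And>a b. (a, b) \<in> F \<Longrightarrow> c \<le> a \<and> a < b \<and> b \<le> d"
    "\<And>a b a' b'. (a, b) \<in> F \<Longrightarrow> (a', b') \<in> F \<Longrightarrow> (a, b) \<noteq> (a', b') \<Longrightarrow> b \<le> a' \<or> b' \<le> a"
  shows "nonoverlapping F c d"
  unfolding nonoverlapping_def using assms by blast

lemma nonoverlapping_finite: "nonoverlapping F c d \<Longrightarrow> finite F"
  by (simp add: nonoverlapping_def)

lemma nonoverlapping_mono:
  assumes "nonoverlapping F c d" "G \<subseteq> F" "\<And>a b. (a, b) \<in> G \<Longrightarrow> c' \<le> a \<and> b \<le> d'"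
  shows "nonoverlapping G c' d'"
proof (rule nonoverlappingI)
  show "finite G" using assms finite_subset nonoverlapping_finite by blast
  show "c' \<le> a \<and> a < b \<and> b \<le> d'" if "(a, b) \<in> G" for a b
    using assms that nonoverlappingD(2)[OF assms(1)] by blast
  show "b \<le> a' \<or> b' \<le> a" if "(a, b) \<in> G" "(a', b') \<in> G" "(a, b) \<noteq> (a', b')" for a b a' b'
    using that assms(2) nonoverlapping_disjoint[OF assms(1)] by blast
qed

lemma nonoverlapping_widen:
  assumes "nonoverlapping F c d" "c' \<le> c" "d \<le> d'"
  shows "nonoverlapping F c' d'"
proof (rule nonoverlapping_mono[OF assms(1) subset_refl])
  fix a b assume "(a, b) \<in> F"
  from nonoverlappingD[OF assms(1) this] show "c' \<le> a \<and> b \<le> d'" using assms(2,3) by simp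
qed

lemma nonoverlapping_Un:
  assumes "nonoverlapping F c e" "nonoverlapping G e d" "c \<le> e" "e \<le> d"
  shows "nonoverlapping (F \<union> G) c d" "F \<inter> G = {}"
proof -
  have *: "b \<le> a'" if "(a, b) \<in> F" "(a', b') \<in> G" for a b a' b'
    using nonoverlappingD(3)[OF assms(1) that(1)] nonoverlappingD(1)[OF assms(2) that(2)] by simp
  show "nonoverlapping (F \<union> G) c d"
  proof (rule nonoverlappingI)
    show "finite (F \<union> G)" using assms nonoverlapping_finite by blast
    show "c \<le> a \<and> a < b \<and> b \<le> d" if "(a, b) \<in> F \<union> G" for a b
      using that nonoverlappingD[OF assms(1), of a b] nonoverlappingD[OF assms(2), of a b] assms(3,4)
      by auto
    show "b \<le> a' \<or> b' \<le> a" if "(a, b) \<in> F \<union> G" "(a', b') \<in> F \<union> G" "(a, b) \<noteq> (a', b')"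
      for a b a' b'
      using that * nonoverlapping_disjoint[OF assms(1)] nonoverlapping_disjoint[OF assms(2)] by blast
  qed
  show "F \<inter> G = {}"
    using * nonoverlappingD(2)[OF assms(1)] by fastforce
qed

lemma nonoverlapping_remove_last:
  assumes F: "nonoverlapping F c d" and "F \<noteq> {}"
  obtains a b where "(a, b) \<in> F" "nonoverlapping (F - {(a, b)}) c a"
proof -
  have fin: "finite F" using F by (simp add: nonoverlapping_def)
  then have "Max (fst ` F) \<in> fst ` F" using \<open>F \<noteq> {}\<close> by (intro Max_in) auto
  then obtain a b where ab: "(a, b) \<in> F" and a: "a = Max (fst ` F)" by force
  have "y \<le> a" if xy: "(x, y) \<in> F" "(x, y) \<noteq> (a, b)" for x y
  proof -
    have "x \<le> a" unfolding a using fin xy by (intro Max_ge) force+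
    moreover have "a < b" "y \<le> a \<or> b \<le> x" using nonoverlappingD(2)[OF F ab] nonoverlapping_disjoint[OF F xy(1) ab xy(2)] by auto
    ultimately show ?thesis by linarith
  qed
  then have "nonoverlapping (F - {(a, b)}) c a"
    using nonoverlappingD(1)[OF F] by (intro nonoverlapping_mono[OF F]) auto
  with ab show ?thesis using that by blast
qed

text \<open>Peeling off the rightmost interval leaves a family to its left, which gives an
  induction; gaps are paid for by nonnegativity. Used with \<open>v\<close> the length, the
  variation, and the excess of the variation over the increment.\<close>

lemma nonoverlapping_sum_le_superadditive:
  fixes v :: "real \<Rightarrow> real \<Rightarrow> real"
  assumes v: "\<And>x y z. c \<le> x \<Longrightarrow> x \<le> y \<Longrightarrow> y \<le> z \<Longrightarrow> z \<le> d \<Longrightarrow> v x y + v y z \<le> v x z"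
    and nonneg: "\<And>x y. c \<le> x \<Longrightarrow> x \<le> y \<Longrightarrow> y \<le> d \<Longrightarrow> 0 \<le> v x y"
    and F: "nonoverlapping F c d" and cd: "c \<le> d"
  shows "(\<Sum>(a, b)\<in>F. v a b) \<le> v c d"
  using F cd v nonneg
proof (induction "card F" arbitrary: F d)
  case 0
  then have "F = {}" by (auto simp: nonoverlapping_def)
  then show ?case using 0 by auto
next
  case (Suc n)
  then have "F \<noteq> {}" by auto
  with nonoverlapping_remove_last Suc.prems(1) obtain a b where
    ab: "(a, b) \<in> F" "nonoverlapping (F - {(a, b)}) c a" by metis
  have le: "c \<le> a" "a \<le> b" "b \<le> d" and fin: "finite F"
    using ab Suc.prems(1) by (auto simp: nonoverlapping_def)
  have "(\<Sum>(a, b)\<in>F - {(a, b)}. v a b) \<le> v c a"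
    using Suc.hyps(2) ab fin le by (intro Suc.hyps(1) Suc.prems) auto
  then have "(\<Sum>(a, b)\<in>F. v a b) \<le> v c a + v a b"
    using ab fin by (subst sum.remove[OF _ ab(1)]) auto
  also have "\<dots> \<le> v c b + v b d"
    using Suc.prems(3)[of c a b] Suc.prems(4)[of b d] le by auto
  also have "\<dots> \<le> v c d" using Suc.prems(3)[of c b d] le by auto
  finally show ?case .
qed

lemma nonoverlapping_sum_length_le:
  assumes "nonoverlapping F c d" "c \<le> d"
  shows "(\<Sum>(a, b)\<in>F. b - a) \<le> d - c"
  by (rule nonoverlapping_sum_le_superadditive[OF _ _ assms, of "\<lambda>a b. b - a"]) auto

text \<open>Adding the gaps can only increase a variation sum, so a family that nearly attains the
  total variation may be taken to cover the interval.\<close>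

lemma nonoverlapping_fill:
  assumes "nonoverlapping F c d" "c < d"
  obtains F' where "nonoverlapping F' c d" "F \<subseteq> F'" "{c..d} \<subseteq> (\<Union>(a, b)\<in>F'. {a..b})"
proof -
  \<comment> \<open>The induction covers only the open interval: this admits c = d, which occurs
    when the last interval starts at c. Taking closures recovers the closed interval.\<close>
  have "\<exists>F'. nonoverlapping F' c d \<and> F \<subseteq> F' \<and> {c<..<d} \<subseteq> (\<Union>(a, b)\<in>F'. {a..b})"
    if "nonoverlapping F c d" "c \<le> d" for F c d
    using that
  proof (induction "card F" arbitrary: F d)
    case 0
    then have "F = {}" by (auto simp: nonoverlapping_def)
    then show ?case using 0
      by (intro exI[of _ "if c < d then {(c, d)} else {}"]) (auto simp: nonoverlapping_def)
  next
    case (Suc n)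
    then have "F \<noteq> {}" by auto
    with nonoverlapping_remove_last Suc.prems(1) obtain a b where
      ab: "(a, b) \<in> F" "nonoverlapping (F - {(a, b)}) c a" by metis
    have le: "c \<le> a" "a < b" "b \<le> d" and fin: "finite F"
      using ab Suc.prems(1) by (auto simp: nonoverlapping_def)
    have "n = card (F - {(a, b)})" using Suc.hyps(2) ab fin by auto
    from Suc.hyps(1)[OF this ab(2) le(1)] obtain G where
      G: "nonoverlapping G c a" "F - {(a, b)} \<subseteq> G" "{c<..<a} \<subseteq> (\<Union>(a, b)\<in>G. {a..b})"
      by blast
    have 1: "nonoverlapping (G \<union> {(a, b)}) c b"
      using le by (intro nonoverlapping_Un[OF G(1)]) (auto simp: nonoverlapping_def)
    have 2: "nonoverlapping (G \<union> {(a, b)} \<union> (if b < d then {(b, d)} else {})) c d"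
      using le by (intro nonoverlapping_Un[OF 1]) (auto simp: nonoverlapping_def)
    have 3: "{c<..<d} \<subseteq> {c<..<a} \<union> {a..b} \<union> (if b < d then {b..d} else {})"
      using le by auto
    show ?case
      by (intro exI[of _ "G \<union> {(a, b)} \<union> (if b < d then {(b, d)} else {})"] conjI 2
          order.trans[OF 3]) (use G in auto)
  qed
  from this[OF assms(1)] assms(2) obtain F' where
    F': "nonoverlapping F' c d" "F \<subseteq> F'" "{c<..<d} \<subseteq> (\<Union>(a, b)\<in>F'. {a..b})" by auto
  have "closed (\<Union>(a, b)\<in>F'. {a..b})"
    using F'(1) by (intro closed_UN) (auto simp: nonoverlapping_def)
  then have "closure {c<..<d} \<subseteq> (\<Union>(a, b)\<in>F'. {a..b})"
    using F'(3) by (rule closure_minimal[rotated])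
  then show ?thesis using that F' assms(2) by simp
qed

lemma nonoverlapping_empty [simp]: "nonoverlapping {} c d"
  by (auto simp: nonoverlapping_def)

lemma nonoverlapping_single [simp]: "nonoverlapping {(a, b)} c d \<longleftrightarrow> c \<le> a \<and> a < b \<and> b \<le> d"
  by (auto simp: nonoverlapping_def)

section \<open>Total variation and its superadditivity\<close>

lemma bv_on_mono:
  assumes "bv_on f c d" "c \<le> c'" "d' \<le> d"
  shows "bv_on f c' d'"
proof -
  have "{F. nonoverlapping F c' d'} \<subseteq> {F. nonoverlapping F c d}"
    using assms(2,3) nonoverlapping_widen by blast
  then show ?thesis using assms(1) unfolding bv_on_def by (meson bdd_above_mono image_mono)
qed

lemma variation_sum_le_variation:
  assumes "bv_on f c d" "nonoverlapping F c d"
  shows "variation_sum f F \<le> variation f c d"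
  unfolding variation_def using assms by (intro cSup_upper) (auto simp: bv_on_def)

lemma variation_nonneg: "bv_on f c d \<Longrightarrow> 0 \<le> variation f c d"
  using variation_sum_le_variation[of f c d "{}"] by (simp add: variation_sum_def)

lemma abs_diff_le_variation: "bv_on f c d \<Longrightarrow> c \<le> d \<Longrightarrow> \<bar>f d - f c\<bar> \<le> variation f c d"
  using variation_sum_le_variation[of f c d "{(c, d)}"] variation_nonneg[of f c d]
  by (cases "c = d") (auto simp: variation_sum_def)

lemma variation_superadditive:
  assumes f: "bv_on f c d" and le: "c \<le> e" "e \<le> d"
  shows "variation f c e + variation f e d \<le> variation f c d"
proof -
  have "variation f c e \<le> variation f c d - variation f e d"
    unfolding variation_def[of f c e]
  proof (rule cSup_least)
    fix y assume "y \<in> variation_sum f ` {F. nonoverlapping F c e}"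
    then obtain F where F: "nonoverlapping F c e" and y: "y = variation_sum f F" by auto
    have "variation f e d \<le> variation f c d - y"
      unfolding variation_def[of f e d]
    proof (rule cSup_least)
      fix z assume "z \<in> variation_sum f ` {F. nonoverlapping F e d}"
      then obtain G where G: "nonoverlapping G e d" and z: "z = variation_sum f G" by auto
      have "variation_sum f (F \<union> G) = y + z"
        unfolding y z variation_sum_def using F G nonoverlapping_Un(2)[OF F G le]
        by (intro sum.union_disjoint) (auto simp: nonoverlapping_def)
      then show "z \<le> variation f c d - y"
        using variation_sum_le_variation[OF f nonoverlapping_Un(1)[OF F G le]] by simp
    qed (use nonoverlapping_empty in blast)
    then show "y \<le> variation f c d - variation f e d" by simp
  qed (use nonoverlapping_empty in blast)
  then show ?thesis by simp
qed

text \<open>Variation minus increment is twice the negative variation, hence nonnegative and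
  superadditive.\<close>

lemma nonoverlapping_sum_le_variation_defect:
  assumes f: "bv_on f c d" and "c \<le> d" and F: "nonoverlapping F c d"
  shows "(\<Sum>(a, b)\<in>F. variation f a b - (f b - f a)) \<le> variation f c d - (f d - f c)"
proof (rule nonoverlapping_sum_le_superadditive[OF _ _ F \<open>c \<le> d\<close>])
  fix x y z assume "c \<le> x" "x \<le> y" "y \<le> z" "z \<le> d"
  then have "variation f x y + variation f y z \<le> variation f x z"
    by (intro variation_superadditive bv_on_mono[OF f]) auto
  then show "variation f x y - (f y - f x) + (variation f y z - (f z - f y))
    \<le> variation f x z - (f z - f x)" by simp
next
  fix x y assume "c \<le> x" "x \<le> y" "y \<le> d"
  then show "0 \<le> variation f x y - (f y - f x)"
    using abs_diff_le_variation[of f x y] bv_on_mono[OF f, of x y] by auto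
qed

section \<open>Vitali coverings and differentiability almost everywhere\<close>

lemma Vitali_outer_measure_bound:
  fixes P :: "real \<Rightarrow> real \<Rightarrow> bool"
  assumes E: "\<And>x \<delta>. x \<in> E \<Longrightarrow> 0 < \<delta> \<Longrightarrow>
      \<exists>s t. c \<le> s \<and> s < t \<and> t \<le> d \<and> t - s < \<delta> \<and> s \<le> x \<and> x \<le> t \<and> P s t"
    and bound: "\<And>F. nonoverlapping F c d \<Longrightarrow> (\<And>a b. (a, b) \<in> F \<Longrightarrow> P a b) \<Longrightarrow>
      (\<Sum>(a, b)\<in>F. b - a) \<le> m"
  obtains T where "E \<subseteq> T" "T \<in> lmeasurable" "measure lebesgue T \<le> m"
proof -
  define K where "K = {(s, t). c \<le> s \<and> s < t \<and> t \<le> d \<and> P s t}"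
  \<comment> \<open>The covering theorem speaks of balls; each interval is encoded by its midpoint
    and half its length.\<close>
  define ctr where "ctr = (\<lambda>(s, t). (s + t) / 2 :: real)"
  define rad where "rad = (\<lambda>(s, t). (t - s) / 2 :: real)"
  have cb: "cball (ctr (s, t)) (rad (s, t)) = {s..t}" for s t
    unfolding ctr_def rad_def cball_eq_atLeastAtMost by (auto simp: field_simps)
  have cover: "\<exists>i. i \<in> K \<and> x \<in> cball (ctr i) (rad i) \<and> rad i < \<delta>" if x: "x \<in> E" "0 < \<delta>" for x \<delta>
  proof -
    obtain s t where "c \<le> s \<and> s < t \<and> t \<le> d \<and> t - s < \<delta> \<and> s \<le> x \<and> x \<le> t \<and> P s t"
      using E[OF x] by blast
    then show ?thesis
      by (intro exI[of _ "(s, t)"]) (auto simp: K_def cb, auto simp: rad_def)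
  qed
  have pos: "0 < rad i" if "i \<in> K" for i using that by (auto simp: K_def rad_def)
  obtain C where C: "countable C" "C \<subseteq> K"
     "pairwise (\<lambda>i j. disjnt (cball (ctr i) (rad i)) (cball (ctr j) (rad j))) C"
     "negligible (E - (\<Union>i \<in> C. cball (ctr i) (rad i)))"
    by (rule Vitali_covering_theorem_cballs[where K=K and r=rad and S=E and a=ctr, OF pos cover])
  \<comment> \<open>The hypothesis concerns finite families only. Its bound passes to the countable
    union, and what that union misses of \<open>E\<close> is negligible.\<close>
  have bd: "measure lebesgue (\<Union>i\<in>F. cball (ctr i) (rad i)) \<le> m" if F: "F \<subseteq> C" "finite F" for F
  proof -
    have "nonoverlapping F c d"
      unfolding nonoverlapping_def
    proof (intro conjI)
      show "finite F" by fact
      show "\<forall>(a, b)\<in>F. c \<le> a \<and> a < b \<and> b \<le> d" using F C(2) by (auto simp: K_def)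
      have "b \<le> a' \<or> b' \<le> a" if "(a, b) \<in> F" "(a', b') \<in> F" "(a, b) \<noteq> (a', b')" for a b a' b'
      proof -
        have "disjnt {a..b} {a'..b'}"
          using C(3) F(1) that unfolding pairwise_def by (metis cb subsetD)
        moreover have "a < b" "a' < b'" using that F C(2) by (auto simp: K_def)
        ultimately have "max a a' \<notin> {a..b} \<inter> {a'..b'}" by (auto simp: disjnt_def)
        then show ?thesis using \<open>a < b\<close> \<open>a' < b'\<close> by auto
      qed
      then show "\<forall>(a, b)\<in>F. \<forall>(a', b')\<in>F. (a, b) \<noteq> (a', b') \<longrightarrow> b \<le> a' \<or> b' \<le> a" by blast
    qed
    moreover have "P a b" if "(a, b) \<in> F" for a b using that F C(2) by (auto simp: K_def)
    ultimately have m: "(\<Sum>(a, b)\<in>F. b - a) \<le> m" by (intro bound)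
    have "measure lebesgue (\<Union>i\<in>F. cball (ctr i) (rad i))
        \<le> (\<Sum>i\<in>F. measure lebesgue (cball (ctr i) (rad i)))"
      by (intro measure_UNION_le \<open>finite F\<close>) auto
    also have "\<dots> = (\<Sum>(a, b)\<in>F. b - a)"
      using F C(2) by (intro sum.cong refl) (auto simp: cb K_def)
    finally show ?thesis using m by simp
  qed
  define T where "T = (\<Union>i \<in> C. cball (ctr i) (rad i)) \<union> (E - (\<Union>i \<in> C. cball (ctr i) (rad i)))"
  have U: "(\<Union>i \<in> C. cball (ctr i) (rad i)) \<in> lmeasurable"
    "measure lebesgue (\<Union>i \<in> C. cball (ctr i) (rad i)) \<le> m"
    by (rule fmeasurable_UN_bound[OF C(1) _ bd] measure_UN_bound[OF C(1) _ bd]; simp)+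
  have "E \<subseteq> T" by (auto simp: T_def)
  moreover have "T \<in> lmeasurable" unfolding T_def
    by (rule fmeasurable.Un[OF U(1) negligible_imp_measurable[OF C(4)]])
  moreover have "measure lebesgue T \<le> m"
    unfolding T_def using U C(4) by (subst measure_Un_null_set) (auto simp: negligible_iff_null_sets fmeasurableD)
  ultimately show ?thesis using that by blast
qed

lemma bv_on_combine:
  assumes "bv_on f a b" "bv_on f b c" "a \<le> b" "b \<le> c"
  shows "bv_on f a c"
  unfolding bv_on_def
proof (rule bdd_aboveI2)
  fix F assume "F \<in> {F. nonoverlapping F a c}"
  then have F: "nonoverlapping F a c" by simp
  define F1 where "F1 = {p\<in>F. snd p \<le> b}"
  define F2 where "F2 = {p\<in>F. b \<le> fst p}"
  define F3 where "F3 = {p\<in>F. fst p < b \<and> b < snd p}"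
  have fin: "finite F" using F by (rule nonoverlapping_finite)
  have F_eq: "F = F1 \<union> F2 \<union> F3" by (auto simp: F1_def F2_def F3_def)
  have F1: "nonoverlapping F1 a b" and F2: "nonoverlapping F2 b c"
    using nonoverlappingD[OF F] by (auto intro!: nonoverlapping_mono[OF F] simp: F1_def F2_def)
  \<comment> \<open>At most one interval straddles b. Cutting it there leaves two one-interval
    families.\<close>
  have "\<exists>p. F3 \<subseteq> {p}"
  proof -
    have "p = q" if "p \<in> F3" "q \<in> F3" for p q
      using nonoverlapping_disjoint[OF F, of "fst p" "snd p" "fst q" "snd q"] that
      by (cases p; cases q) (auto simp: F3_def)
    then show ?thesis by blast
  qed
  then obtain x y where xy: "F3 \<subseteq> {(x, y)}" by (metis surj_pair)
  have F3: "variation_sum f F3 \<le> variation f a b + variation f b c"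
  proof (cases "F3 = {}")
    case True
    then show ?thesis using variation_nonneg[OF assms(1)] variation_nonneg[OF assms(2)]
      by (simp add: variation_sum_def)
  next
    case False
    with xy have eq: "F3 = {(x, y)}" by auto
    then have "(x, y) \<in> F3" by simp
    then have *: "a \<le> x" "x < b" "b < y" "y \<le> c"
      using nonoverlappingD[OF F] by (auto simp: F3_def)
    have "\<bar>f b - f x\<bar> \<le> variation f a b"
      using variation_sum_le_variation[OF assms(1), of "{(x, b)}"] * by (simp add: variation_sum_def)
    moreover have "\<bar>f y - f b\<bar> \<le> variation f b c"
      using variation_sum_le_variation[OF assms(2), of "{(b, y)}"] * by (simp add: variation_sum_def)
    ultimately show ?thesis by (simp add: eq variation_sum_def)
  qed
  have "variation_sum f F \<le> variation_sum f F1 + variation_sum f F2 + variation_sum f F3"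
  proof -
    have "variation_sum f (A \<union> B) \<le> variation_sum f A + variation_sum f B"
      if "finite A" "finite B" for A B
      using that sum.union_inter[of A B "\<lambda>(a, b). \<bar>f b - f a\<bar>"]
        sum_nonneg[of "A \<inter> B" "\<lambda>(a, b). \<bar>f b - f a\<bar>"]
      by (auto simp: variation_sum_def split: prod.splits)
    from this[of "F1 \<union> F2" F3] this[of F1 F2] show ?thesis
      using fin by (auto simp: F_eq)
  qed
  then show "variation_sum f F \<le> 2 * variation f a b + 2 * variation f b c"
    using F3 variation_sum_le_variation[OF assms(1) F1] variation_sum_le_variation[OF assms(2) F2]
    by simp
qed

text \<open>On an interval shorter than the \<delta> that belongs to e = 1 every variation sum is at
  most 1; Bolzano's principle glues such intervals.\<close>

lemma ac01_bv_on:
  assumes "ac01 (f :: real \<Rightarrow> real)"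
  shows "bv_on f 0 1"
proof -
  obtain \<delta> where \<delta>: "\<delta> > 0" "\<And>F. nonoverlapping F 0 1 \<Longrightarrow> (\<Sum>(a, b)\<in>F. b - a) < \<delta> \<Longrightarrow>
      (\<Sum>(a, b)\<in>F. norm (f b - f a)) < 1"
    using assms unfolding ac01_def by (metis zero_less_one)
  have "0 \<le> a \<and> b \<le> 1 \<longrightarrow> bv_on f a b" if "0 \<le> a" "a \<le> b" "b \<le> 1" for a b
    using that(2)
  proof (induction a b rule: Bolzano)
    case (trans a b c)
    show ?case
    proof
      assume "0 \<le> a \<and> c \<le> 1"
      then show "bv_on f a c" using trans by (intro bv_on_combine[of f a b c]) auto
    qed
  next
    case (local x)
    have "bv_on f a b" if *: "a \<le> x" "x \<le> b" "b - a < \<delta>" "0 \<le> a" "b \<le> 1" for a b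
      unfolding bv_on_def
    proof (rule bdd_aboveI2)
      fix F assume "F \<in> {F. nonoverlapping F a b}"
      then have F: "nonoverlapping F a b" by simp
      have "(\<Sum>(a, b)\<in>F. b - a) < \<delta>"
        using nonoverlapping_sum_length_le[OF F] * by simp
      moreover have "nonoverlapping F 0 1"
        using * by (intro nonoverlapping_widen[OF F]) auto
      ultimately show "variation_sum f F \<le> 1"
        using \<delta>(2)[of F] by (simp add: variation_sum_def)
    qed
    with \<delta>(1) show ?case by blast
  qed
  from this[of 0 1] show ?thesis by simp
qed

lemma bv_on_diff_linear:
  assumes "bv_on f c d" "c \<le> d"
  shows "bv_on (\<lambda>t. f t - m * t) c d"
  unfolding bv_on_def
proof (rule bdd_aboveI2)
  fix F assume "F \<in> {F. nonoverlapping F c d}"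
  then have F: "nonoverlapping F c d" by simp
  have "variation_sum (\<lambda>t. f t - m * t) F \<le> (\<Sum>(a, b)\<in>F. \<bar>f b - f a\<bar> + \<bar>m\<bar> * (b - a))"
    unfolding variation_sum_def
  proof (intro sum_mono, clarify)
    fix a b assume "(a, b) \<in> F"
    then have "a < b" using nonoverlappingD[OF F] by auto
    then have "\<bar>m * (b - a)\<bar> = \<bar>m\<bar> * (b - a)" by (simp add: abs_mult)
    moreover have "f b - m * b - (f a - m * a) = f b - f a - m * (b - a)" by (simp add: algebra_simps)
    ultimately show "\<bar>f b - m * b - (f a - m * a)\<bar> \<le> \<bar>f b - f a\<bar> + \<bar>m\<bar> * (b - a)" by linarith
  qed
  also have "\<dots> = variation_sum f F + \<bar>m\<bar> * (\<Sum>(a, b)\<in>F. b - a)"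
    by (simp add: variation_sum_def sum.distrib sum_distrib_left case_prod_unfold)
  also have "\<dots> \<le> variation f c d + \<bar>m\<bar> * (d - c)"
    using variation_sum_le_variation[OF assms(1) F] nonoverlapping_sum_length_le[OF F assms(2)]
    by (intro add_mono mult_left_mono) auto
  finally show "variation_sum (\<lambda>t. f t - m * t) F \<le> variation f c d + \<bar>m\<bar> * (d - c)" .
qed

text \<open>Turns limit behaviour of difference quotients into arbitrarily short intervals
  containing x, as a Vitali covering requires. Since h may have either sign, x may be either
  end.\<close>

lemma frequently_quotient_interval:
  fixes f :: "real \<Rightarrow> real"
  assumes P: "\<exists>\<^sub>F h in at 0. P ((f (x + h) - f x) / h)" and x: "c < x" "x < d" and "0 < \<delta>"
  shows "\<exists>s t. c \<le> s \<and> s < t \<and> t \<le> d \<and> t - s < \<delta> \<and> s \<le> x \<and> x \<le> t \<and> P ((f t - f s) / (t - s))"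
proof -
  have "0 < min \<delta> (min (x - c) (d - x))" using x \<open>0 < \<delta>\<close> by auto
  then obtain h where h: "h \<noteq> 0" "\<bar>h\<bar> < min \<delta> (min (x - c) (d - x))" "P ((f (x + h) - f x) / h)"
    using P unfolding frequently_at dist_real_def by (metis UNIV_I diff_zero)
  show ?thesis
  proof (cases "h > 0")
    case True
    then show ?thesis using h x by (intro exI[of _ x] exI[of _ "x + h"]) auto
  next
    case False
    have "(f x - f (x + h)) / (x - (x + h)) = (f (x + h) - f x) / h"
      using h(1) by (simp add: field_simps)
    then show ?thesis using h x False
      by (intro exI[of _ "x + h"] exI[of _ x]) auto
  qed
qed

text \<open>On an interval of slope below -\<alpha> the variation exceeds the increment by at least
  2 \<alpha> times the length, because a descent counts positively in one and negatively in the
  other. The total excess over a family is at most that of [c, d].\<close>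

lemma descending_outer_measure_bound:
  assumes f: "bv_on f c d" and "c \<le> d" and "\<alpha> > 0"
    and E: "\<And>x. x \<in> E \<Longrightarrow> c < x \<and> x < d \<and> (\<exists>\<^sub>F h in at 0. (f (x + h) - f x) / h < - \<alpha>)"
  obtains T where "E \<subseteq> T" "T \<in> lmeasurable"
    "measure lebesgue T \<le> (variation f c d - (f d - f c)) / (2 * \<alpha>)"
proof (rule Vitali_outer_measure_bound[where P="\<lambda>s t. (f t - f s) / (t - s) < - \<alpha>"])
  show "\<exists>s t. c \<le> s \<and> s < t \<and> t \<le> d \<and> t - s < \<delta> \<and> s \<le> x \<and> x \<le> t \<and> (f t - f s) / (t - s) < - \<alpha>"
    if "x \<in> E" "0 < \<delta>" for x \<delta>
    using E[OF that(1)] that(2) by (intro frequently_quotient_interval) auto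
next
  fix F assume F: "nonoverlapping F c d" and desc: "\<And>a b. (a, b) \<in> F \<Longrightarrow> (f b - f a) / (b - a) < - \<alpha>"
  have "2 * \<alpha> * (\<Sum>(a, b)\<in>F. b - a) = (\<Sum>(a, b)\<in>F. 2 * \<alpha> * (b - a))"
    by (simp add: sum_distrib_left case_prod_unfold)
  also have "\<dots> \<le> (\<Sum>(a, b)\<in>F. variation f a b - (f b - f a))"
  proof (intro sum_mono, clarify)
    fix a b assume ab: "(a, b) \<in> F"
    note ab' = nonoverlappingD[OF F ab]
    have "f b - f a \<le> - \<alpha> * (b - a)"
      using desc[OF ab] ab' by (simp add: divide_less_eq)
    moreover have "\<bar>f b - f a\<bar> \<le> variation f a b"
      using ab' by (intro abs_diff_le_variation bv_on_mono[OF f]) auto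
    ultimately show "2 * \<alpha> * (b - a) \<le> variation f a b - (f b - f a)" by linarith
  qed
  also have "\<dots> \<le> variation f c d - (f d - f c)"
    by (rule nonoverlapping_sum_le_variation_defect[OF f \<open>c \<le> d\<close> F])
  finally show "(\<Sum>(a, b)\<in>F. b - a) \<le> (variation f c d - (f d - f c)) / (2 * \<alpha>)"
    using \<open>\<alpha> > 0\<close> by (simp add: field_simps)
qed

lemma variation_uminus: "variation (\<lambda>t. - f t) c d = variation f c d"
proof -
  have "variation_sum (\<lambda>t. - f t) = variation_sum f"
    by (auto simp: variation_sum_def fun_eq_iff intro!: sum.cong)
  then show ?thesis by (simp add: variation_def)
qed

lemma bv_on_uminus: "bv_on f c d \<Longrightarrow> bv_on (\<lambda>t. - f t) c d"
proof -
  have "variation_sum (\<lambda>t. - f t) = variation_sum f"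
    by (auto simp: variation_sum_def fun_eq_iff intro!: sum.cong)
  then show "bv_on f c d \<Longrightarrow> bv_on (\<lambda>t. - f t) c d" by (simp add: bv_on_def)
qed

text \<open>
  After subtracting the line of slope \<open>(a + b) / 2\<close>, a point of the set has arbitrarily short intervals of
  slope below \<open>- \<alpha>\<close> and of slope above \<open>\<alpha>\<close>. In a partition that nearly realises the total variation, an
  interval with increment \<open>\<ge> 0\<close> cannot contain many descending subintervals, and one with increment
  \<open>\<le> 0\<close> cannot contain many ascending ones. A single use of Vitali's theorem therefore suffices, and no
  measurability of the set is needed.
\<close>

lemma negligible_oscillating_quotients:
  assumes f: "bv_on f 0 1" and "a < b"
  shows "negligible {x. 0 < x \<and> x < 1 \<and> (\<exists>\<^sub>F h in at 0. (f (x + h) - f x) / h < a) \<and>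
    (\<exists>\<^sub>F h in at 0. b < (f (x + h) - f x) / h)}" (is "negligible ?E")
  unfolding negligible_outer_le
proof (intro allI impI)
  fix e :: real assume "e > 0"
  define m where "m = (a + b) / 2"
  define \<alpha> where "\<alpha> = (b - a) / 2"
  define g where "g = (\<lambda>t. f t - m * t)"
  have \<alpha>: "\<alpha> > 0" "m - \<alpha> = a" "m + \<alpha> = b"
    using \<open>a < b\<close> by (auto simp: \<alpha>_def m_def field_simps)
  have g: "bv_on g 0 1" unfolding g_def using f by (intro bv_on_diff_linear) auto
  \<comment> \<open>The slack 2 \<alpha> e is divided by 2 \<alpha> in the measure estimate and
    leaves exactly e.\<close>
  have "variation g 0 1 - 2 * \<alpha> * e < Sup (variation_sum g ` {F. nonoverlapping F 0 1})"
    using \<open>e > 0\<close> \<alpha> by (simp add: variation_def)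
  then obtain F0 where F0: "nonoverlapping F0 0 1" "variation g 0 1 - 2 * \<alpha> * e < variation_sum g F0"
    using less_cSupD[of "variation_sum g ` {F. nonoverlapping F 0 1}"] nonoverlapping_empty by blast
  obtain F where F: "nonoverlapping F 0 1" "F0 \<subseteq> F" "{0..1} \<subseteq> (\<Union>(a, b)\<in>F. {a..b})"
    using nonoverlapping_fill[OF F0(1)] by auto
  have fin: "finite F" using F(1) by (rule nonoverlapping_finite)
  have "variation_sum g F0 \<le> variation_sum g F"
    unfolding variation_sum_def using fin F(2) by (intro sum_mono2) auto
  with F0 have big: "variation g 0 1 - 2 * \<alpha> * e < variation_sum g F" by simp
  have quot: "(g (x + h) - g x) / h = (f (x + h) - f x) / h - m" if "h \<noteq> 0" for x h
    using that by (simp add: g_def field_simps)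
  have low: "\<exists>\<^sub>F h in at 0. (g (x + h) - g x) / h < - \<alpha>" if "x \<in> ?E" for x
  proof -
    from that have "\<exists>\<^sub>F h in at 0. (f (x + h) - f x) / h < a" by simp
    then show ?thesis
      by (rule frequently_rev_mp) (use quot \<alpha> in \<open>auto simp: eventually_at intro!: exI[of _ 1]\<close>)
  qed
  have upp: "\<exists>\<^sub>F h in at 0. (- g (x + h) - - g x) / h < - \<alpha>" if "x \<in> ?E" for x
  proof -
    from that have "\<exists>\<^sub>F h in at 0. b < (f (x + h) - f x) / h" by simp
    moreover have "(- g (x + h) - - g x) / h = m - (f (x + h) - f x) / h" if "h \<noteq> 0" for h
      using that by (simp add: g_def field_simps)
    ultimately show ?thesis
      by (elim frequently_rev_mp) (use \<alpha> in \<open>auto simp: eventually_at intro!: exI[of _ 1]\<close>)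
  qed
  have "\<forall>p\<in>F. \<exists>T. ?E \<inter> {fst p<..<snd p} \<subseteq> T \<and> T \<in> lmeasurable \<and>
      measure lebesgue T \<le> (variation g (fst p) (snd p) - \<bar>g (snd p) - g (fst p)\<bar>) / (2 * \<alpha>)"
  proof
    fix p assume pF: "p \<in> F"
    obtain c d where p: "p = (c, d)" by (cases p)
    with pF have cd: "0 \<le> c" "c < d" "d \<le> 1" using nonoverlappingD[OF F(1)] by auto
    have gcd: "bv_on g c d" using cd by (intro bv_on_mono[OF g])
    obtain T1 where T1: "?E \<inter> {c<..<d} \<subseteq> T1" "T1 \<in> lmeasurable"
      "measure lebesgue T1 \<le> (variation g c d - (g d - g c)) / (2 * \<alpha>)"
      using cd \<alpha> low by (elim descending_outer_measure_bound[OF gcd, of \<alpha> "?E \<inter> {c<..<d}", rotated -1]) auto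
    obtain T2 where T2: "?E \<inter> {c<..<d} \<subseteq> T2" "T2 \<in> lmeasurable"
      "measure lebesgue T2 \<le> (variation (\<lambda>t. - g t) c d - (- g d - - g c)) / (2 * \<alpha>)"
      using cd \<alpha> upp
      by (elim descending_outer_measure_bound[OF bv_on_uminus[OF gcd], of \<alpha> "?E \<inter> {c<..<d}", rotated -1]) auto
    show "\<exists>T. ?E \<inter> {fst p<..<snd p} \<subseteq> T \<and> T \<in> lmeasurable \<and>
      measure lebesgue T \<le> (variation g (fst p) (snd p) - \<bar>g (snd p) - g (fst p)\<bar>) / (2 * \<alpha>)"
    proof (cases "g c \<le> g d")
      case True
      then show ?thesis using T1 p by (intro exI[of _ T1]) auto
    next
      case False
      then show ?thesis using T2 p by (intro exI[of _ T2]) (auto simp: variation_uminus)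
    qed
  qed
  from bchoice[OF this] obtain T where T0: "\<forall>p\<in>F. ?E \<inter> {fst p<..<snd p} \<subseteq> T p \<and> T p \<in> lmeasurable \<and>
      measure lebesgue (T p) \<le> (variation g (fst p) (snd p) - \<bar>g (snd p) - g (fst p)\<bar>) / (2 * \<alpha>)" ..
  have T: "?E \<inter> {fst p<..<snd p} \<subseteq> T p" "T p \<in> lmeasurable"
    "measure lebesgue (T p) \<le> (variation g (fst p) (snd p) - \<bar>g (snd p) - g (fst p)\<bar>) / (2 * \<alpha>)"
    if "p \<in> F" for p
    using bspec[OF T0 that] by simp_all
  \<comment> \<open>The sets \<open>T p\<close> cover only the interiors of the partition intervals;
    the finitely many end points are added.\<close>
  define U where "U = (\<Union>p\<in>F. T p) \<union> (fst ` F \<union> snd ` F)"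
  have null: "fst ` F \<union> snd ` F \<in> null_sets lebesgue"
    using fin by (intro negligible_iff_null_sets[THEN iffD1] negligible_finite) auto
  have UT: "(\<Union>p\<in>F. T p) \<in> lmeasurable" using fin T(2) by (intro fmeasurable.finite_UN)
  have "measure lebesgue (\<Union>p\<in>F. T p) \<le> (\<Sum>p\<in>F. measure lebesgue (T p))"
    using T(2) fin by (intro measure_UNION_le) (auto simp: fmeasurableD)
  also have "\<dots> \<le> (\<Sum>p\<in>F. (variation g (fst p) (snd p) - \<bar>g (snd p) - g (fst p)\<bar>) / (2 * \<alpha>))"
    by (intro sum_mono T(3))
  also have "\<dots> = ((\<Sum>(c, d)\<in>F. variation g c d) - variation_sum g F) / (2 * \<alpha>)"
    by (simp add: variation_sum_def case_prod_unfold sum_subtractf flip: sum_divide_distrib)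
  also have "\<dots> \<le> (variation g 0 1 - variation_sum g F) / (2 * \<alpha>)"
  proof (intro divide_right_mono diff_right_mono)
    show "(\<Sum>(c, d)\<in>F. variation g c d) \<le> variation g 0 1"
      using variation_superadditive variation_nonneg bv_on_mono[OF g]
      by (intro nonoverlapping_sum_le_superadditive[OF _ _ F(1)]) auto
  qed (use \<alpha> in auto)
  also have "\<dots> \<le> e" using big \<alpha> by (simp add: field_simps)
  finally have "measure lebesgue U \<le> e"
    unfolding U_def using UT null by (subst measure_Un_null_set) (auto simp: fmeasurableD)
  moreover have "U \<in> lmeasurable"
    unfolding U_def using UT null
    by (intro fmeasurable.Un[OF UT] negligible_imp_measurable) (simp add: negligible_iff_null_sets)
  moreover have "?E \<subseteq> U"
  proof
    fix x assume x: "x \<in> ?E"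
    then have "x \<in> {0..1}" by simp
    with F(3) have "x \<in> (\<Union>(a, b)\<in>F. {a..b})" by (rule subsetD)
    then obtain c d where cd: "(c, d) \<in> F" "c \<le> x" "x \<le> d" by auto
    show "x \<in> U"
    proof (cases "x = c \<or> x = d")
      case True
      then show ?thesis using cd(1) by (force simp: U_def)
    next
      case False
      then have "x \<in> T (c, d)" using T(1)[OF cd(1)] x cd by auto
      then show ?thesis using cd(1) by (auto simp: U_def)
    qed
  qed
  ultimately show "\<exists>T. ?E \<subseteq> T \<and> T \<in> lmeasurable \<and> measure lebesgue T \<le> e" by blast
qed

lemma negligible_unbounded_quotients:
  assumes f: "bv_on f 0 1"
  shows "negligible {x. 0 < x \<and> x < 1 \<and> (\<forall>K. \<exists>\<^sub>F h in at 0. K < \<bar>(f (x + h) - f x) / h\<bar>)}"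
    (is "negligible ?E")
  unfolding negligible_outer_le
proof (intro allI impI)
  fix e :: real assume "e > 0"
  \<comment> \<open>The summand 1 keeps \<open>K\<close> positive when the variation is 0.\<close>
  define K where "K = (variation f 0 1 + 1) / e"
  have V: "variation f 0 1 \<ge> 0" by (rule variation_nonneg[OF f])
  have K: "K > 0" using \<open>e > 0\<close> V by (simp add: K_def add_nonneg_pos)
  obtain T where T: "?E \<subseteq> T" "T \<in> lmeasurable" "measure lebesgue T \<le> variation f 0 1 / K"
  proof (rule Vitali_outer_measure_bound[where P="\<lambda>s t. K < \<bar>(f t - f s) / (t - s)\<bar>" and E = ?E
        and c = 0 and d = 1])
    show "\<exists>s t. 0 \<le> s \<and> s < t \<and> t \<le> 1 \<and> t - s < \<delta> \<and> s \<le> x \<and> x \<le> t \<and> K < \<bar>(f t - f s) / (t - s)\<bar>"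
      if "x \<in> ?E" "0 < \<delta>" for x \<delta>
      using that by (intro frequently_quotient_interval[where P="\<lambda>q. K < \<bar>q\<bar>"]) auto
  next
    fix F assume F: "nonoverlapping F 0 1"
      and steep: "\<And>a b. (a, b) \<in> F \<Longrightarrow> K < \<bar>(f b - f a) / (b - a)\<bar>"
    have "K * (\<Sum>(a, b)\<in>F. b - a) = (\<Sum>(a, b)\<in>F. K * (b - a))"
      by (simp add: sum_distrib_left case_prod_unfold)
    also have "\<dots> \<le> variation_sum f F"
      unfolding variation_sum_def
    proof (intro sum_mono, clarify)
      fix a b assume ab: "(a, b) \<in> F"
      show "K * (b - a) \<le> \<bar>f b - f a\<bar>"
        using steep[OF ab] nonoverlappingD(2)[OF F ab] by (simp add: abs_divide less_divide_eq)
    qed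
    also have "\<dots> \<le> variation f 0 1" by (rule variation_sum_le_variation[OF f F])
    finally show "(\<Sum>(a, b)\<in>F. b - a) \<le> variation f 0 1 / K"
      using K by (simp add: field_simps)
  qed blast
  have "variation f 0 1 / K \<le> e"
    using \<open>e > 0\<close> V by (simp add: K_def divide_le_eq)
  then have "measure lebesgue T \<le> e" using T(3) by simp
  with T(1,2) show "\<exists>T. ?E \<subseteq> T \<and> T \<in> lmeasurable \<and> measure lebesgue T \<le> e" by blast
qed

text \<open>Bounded quotients converge unless two rationals a < b separate their lower from their
  upper limit. The exceptional points thus lie in a countable union of the null sets treated
  above.\<close>

lemma bv_on_differentiable_ae:
  assumes f: "bv_on f 0 1"
  shows "negligible {x. 0 < x \<and> x < 1 \<and> \<not> f differentiable (at x)}"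
proof -
  define Q where "Q = (\<lambda>x h. (f (x + h) - f x) / h)"
  define E where "E a b = {x. 0 < x \<and> x < 1 \<and> (\<exists>\<^sub>F h in at 0. Q x h < a) \<and> (\<exists>\<^sub>F h in at 0. b < Q x h)}" for a b
  define E' where "E' = {x. 0 < x \<and> x < 1 \<and> (\<forall>K. \<exists>\<^sub>F h in at 0. K < \<bar>Q x h\<bar>)}"
  have diff: "f differentiable (at x)" if x: "0 < x" "x < 1" and no: "x \<notin> E'" "\<And>a b :: rat. a < b \<Longrightarrow> x \<notin> E (of_rat a) (of_rat b)" for x
  proof -
    from x no(1) obtain K where "\<not> (\<exists>\<^sub>F h in at 0. K < \<bar>Q x h\<bar>)" by (auto simp: E'_def)
    then have K: "\<forall>\<^sub>F h in at 0. \<bar>Q x h\<bar> \<le> K" by (simp add: not_frequently not_less)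
    define S where "S = {a. \<forall>\<^sub>F h in at 0. a \<le> Q x h}"
    \<comment> \<open>\<open>S\<close> collects the eventual lower bounds of the quotient, so
      \<open>L\<close> is its lower limit.\<close>
    define L where "L = Sup S"
    have ne: "S \<noteq> {}" using K by (auto simp: S_def intro!: exI[of _ "- K"] elim: eventually_mono)
    have bdd: "bdd_above S"
    proof (rule bdd_aboveI)
      fix a assume "a \<in> S"
      then have "\<forall>\<^sub>F h in at (0::real). a \<le> K"
        using K unfolding S_def mem_Collect_eq by eventually_elim linarith
      then show "a \<le> K" by (simp add: eventually_const)
    qed
    have "(Q x \<longlongrightarrow> L) (at 0)"
    proof (rule order_tendstoI)
      fix a assume "a < L"
      then obtain a' where "a' \<in> S" "a < a'" using less_cSupD[OF ne] by (auto simp: L_def)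
      then show "\<forall>\<^sub>F h in at 0. a < Q x h" by (auto simp: S_def elim: eventually_mono)
    next
      fix b assume "L < b"
      obtain r1 where r1: "L < of_rat r1" "of_rat r1 < b" using of_rat_dense[OF \<open>L < b\<close>] by blast
      obtain r2 where r2: "of_rat r1 < real_of_rat r2" "of_rat r2 < b" using of_rat_dense[OF r1(2)] by blast
      have "\<exists>\<^sub>F h in at 0. Q x h < of_rat r1"
      proof (rule ccontr)
        assume "\<not> (\<exists>\<^sub>F h in at 0. Q x h < of_rat r1)"
        then have "of_rat r1 \<in> S" by (simp add: S_def not_frequently not_less)
        then have "of_rat r1 \<le> L" unfolding L_def using bdd by (rule cSup_upper)
        with r1 show False by simp
      qed
      then have "\<not> (\<exists>\<^sub>F h in at 0. of_rat r2 < Q x h)"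
        using no(2)[of r1 r2] r2(1) x by (auto simp: E_def of_rat_less)
      then show "\<forall>\<^sub>F h in at 0. Q x h < b"
        using r2(2) by (auto simp: not_frequently not_less elim: eventually_mono)
    qed
    then have "(f has_field_derivative L) (at x)" by (simp add: DERIV_def Q_def)
    then show ?thesis using real_differentiable_def by blast
  qed
  have "{x. 0 < x \<and> x < 1 \<and> \<not> f differentiable (at x)} \<subseteq>
      E' \<union> (\<Union>p\<in>{p. fst p < snd p}. E (of_rat (fst p)) (of_rat (snd p)))" (is "?D \<subseteq> ?R")
  proof (intro subsetI, elim CollectE conjE)
    fix x assume x: "0 < x" "x < 1" "\<not> f differentiable (at x)"
    show "x \<in> ?R"
    proof (rule ccontr)
      assume no: "x \<notin> ?R"
      have "x \<notin> E (of_rat a) (of_rat b)" if "a < b" for a b :: rat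
      proof
        assume "x \<in> E (of_rat a) (of_rat b)"
        then have "x \<in> ?R" using that by (intro UnI2 UN_I[of "(a, b)"]) simp_all
        with no show False by (rule notE)
      qed
      moreover have "x \<notin> E'" using no by simp
      ultimately have "f differentiable (at x)" using x by (intro diff)
      with x show False by simp
    qed
  qed
  moreover have "negligible E'"
    unfolding E'_def Q_def by (rule negligible_unbounded_quotients[OF f])
  moreover have "negligible (\<Union>p\<in>{p::rat\<times>rat. fst p < snd p}. E (of_rat (fst p)) (of_rat (snd p)))"
    unfolding negligible_iff_null_sets
  proof (rule null_sets_UN')
    show "countable {p::rat\<times>rat. fst p < snd p}" by simp
    show "E (of_rat (fst p)) (of_rat (snd p)) \<in> null_sets lebesgue" if "p \<in> {p. fst p < snd p}" for p
      using negligible_oscillating_quotients[OF f, of "of_rat (fst p)" "of_rat (snd p)"] that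
      unfolding E_def Q_def negligible_iff_null_sets by (simp add: of_rat_less)
  qed
  ultimately show ?thesis by (meson negligible_Un negligible_subset)
qed

section \<open>Absolutely continuous curves\<close>

text \<open>
  The bound is only required off a null set \<open>N\<close>; a gauge fine enough for the Henstock-Kurzweil integral of
  \<open>g\<close> puts the intervals tagged in \<open>N\<close> into a small open set, where absolute continuity takes over.
\<close>

lemma ac01_increment_le_nn_integral:
  fixes f g :: "real \<Rightarrow> real"
  assumes f: "ac01 f" and N: "negligible N"
    and g: "g \<in> borel_measurable lebesgue" "\<And>x. 0 \<le> g x"
    and loc: "\<And>x e. x \<in> {0..1} - N \<Longrightarrow> 0 < e \<Longrightarrow>
      \<exists>\<delta>>0. \<forall>t\<in>{0..1}. \<bar>t - x\<bar> < \<delta> \<longrightarrow> \<bar>f t - f x\<bar> \<le> (g x + e) * \<bar>t - x\<bar>"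
  shows "ennreal \<bar>f 1 - f 0\<bar> \<le> (\<integral>\<^sup>+ x. ennreal (g x) * indicator {0..1} x \<partial>lebesgue)"
proof (cases "(\<integral>\<^sup>+ x. ennreal (g x) * indicator {0..1} x \<partial>lebesgue) = top")
  case False
  then obtain r where r: "0 \<le> r" "(\<integral>\<^sup>+ x. ennreal (g x) * indicator {0..1} x \<partial>lebesgue) = ennreal r"
    by (cases "(\<integral>\<^sup>+ x. ennreal (g x) * indicator {0..1} x \<partial>lebesgue)") auto
  have eq: "ennreal (g x) * indicator {0..1} x = ennreal (if x \<in> {0..1} then g x else 0)" for x
    by (simp add: indicator_def)
  have meas: "(\<lambda>x. if x \<in> {0..1} then g x else 0) \<in> borel_measurable lebesgue"
    by (intro measurable_If_set g(1)) auto
  have "((\<lambda>x. if x \<in> {0..1} then g x else 0) has_integral r) UNIV"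
    using r g(2) meas unfolding eq
    by (subst has_integral_iff_nn_integral_lebesgue) auto
  then have int: "(g has_integral r) {0..1}" by (simp only: has_integral_restrict_UNIV)
  \<comment> \<open>The three errors: the Riemann sum of g, the slack e in the local slope summed
    over total length 1, and the intervals tagged in \<open>N\<close>.\<close>
  have "\<bar>f 1 - f 0\<bar> \<le> r + 3 * e" if "e > 0" for e
  proof -
    from int[unfolded has_integral_real, rule_format, OF \<open>e > 0\<close>] obtain \<gamma>1 where
      \<gamma>1': "gauge \<gamma>1 \<and> (\<forall>D. D tagged_division_of {0..1} \<and> \<gamma>1 fine D \<longrightarrow>
        norm ((\<Sum>(x, K)\<in>D. measure lborel K *\<^sub>R g x) - r) < e)" ..
    then have \<gamma>1: "gauge \<gamma>1" "\<And>D. D tagged_division_of {0..1} \<Longrightarrow> \<gamma>1 fine D \<Longrightarrow>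
        norm ((\<Sum>(x, K)\<in>D. measure lborel K *\<^sub>R g x) - r) < e" by simp_all
    obtain d where d: "d > 0" "\<And>F. nonoverlapping F 0 1 \<Longrightarrow> (\<Sum>(a, b)\<in>F. b - a) < d
       \<Longrightarrow> (\<Sum>(a, b)\<in>F. norm (f b - f a)) < e"
      using f \<open>e > 0\<close> unfolding ac01_def by blast
    have Ns: "N \<in> null_sets lebesgue" using N by (simp add: negligible_iff_null_sets)
    then have "N \<in> sets lebesgue" by (rule null_setsD2)
    from sets_lebesgue_outer_open[OF this d(1)] obtain U where
      U: "open U" "N \<subseteq> U" "U - N \<in> lmeasurable" "emeasure lebesgue (U - N) < ennreal d" by metis
    have Ueq: "U = (U - N) \<union> N" using U(2) by blast
    have UL: "U \<in> lmeasurable"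
      using fmeasurable.Un[OF U(3) negligible_imp_measurable[OF N]] Ueq by simp
    have "measure lebesgue U = measure lebesgue (U - N)"
      using U(3) Ns by (subst Ueq, subst measure_Un_null_set) (auto simp: fmeasurableD)
    then have Ud: "measure lebesgue U < d"
      using U(3,4) d(1) by (simp add: emeasure_eq_measure2 ennreal_less_iff)
    have "\<forall>x\<in>{0..1} - N. \<exists>\<delta>>0. \<forall>t\<in>{0..1}. \<bar>t - x\<bar> < \<delta> \<longrightarrow> \<bar>f t - f x\<bar> \<le> (g x + e) * \<bar>t - x\<bar>"
      using loc \<open>e > 0\<close> by blast
    from bchoice[OF this] obtain \<delta> where \<delta>: "\<forall>x\<in>{0..1} - N. 0 < \<delta> x \<and>
        (\<forall>t\<in>{0..1}. \<bar>t - x\<bar> < \<delta> x \<longrightarrow> \<bar>f t - f x\<bar> \<le> (g x + e) * \<bar>t - x\<bar>)" ..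
    \<comment> \<open>Intervals tagged in \<open>N\<close> are forced into \<open>U\<close>, those
      tagged at other points of [0, 1] into the range of the local slope bound.\<close>
    define \<gamma>2 where "\<gamma>2 x = (if x \<in> N then U else if x \<in> {0..1} then ball x (\<delta> x) else ball x 1)" for x
    have "gauge \<gamma>2"
      unfolding gauge_def \<gamma>2_def using \<delta> U(1,2) by auto
    with \<gamma>1(1) have "gauge (\<lambda>x. \<gamma>1 x \<inter> \<gamma>2 x)" by (rule gauge_Int)
    then obtain p where p: "p tagged_division_of {0..1}" "(\<lambda>x. \<gamma>1 x \<inter> \<gamma>2 x) fine p"
      using fine_division_exists_real by blast
    have fine: "\<gamma>1 fine p" "\<gamma>2 fine p" using p(2) by (auto simp: fine_Int)
    have fin: "finite p" using p(1) by auto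
    have K: "K = {Inf K..Sup K} \<and> Inf K \<le> x \<and> x \<le> Sup K \<and> 0 \<le> Inf K \<and> Sup K \<le> 1 \<and> K \<subseteq> \<gamma>2 x \<and>
        measure lborel K = Sup K - Inf K" if "(x, K) \<in> p" for x K
    proof -
      from tagged_division_ofD(4)[OF p(1) that] obtain a b where ab: "K = {a..b}" by auto
      have x: "x \<in> K" "K \<subseteq> {0..1}" using tagged_division_ofD(2,3)[OF p(1) that] by auto
      with ab have "a \<le> b" by auto
      with ab x fine(2) that show ?thesis by (auto simp: fine_def)
    qed
    \<comment> \<open>Degenerate intervals are kept out because \<open>nonoverlapping\<close>
      demands a < b; their increments vanish, so they count among the good ones.\<close>
    define q where "q = {(x, K)\<in>p. x \<in> N \<and> Inf K < Sup K}"
    define F where "F = (\<lambda>(x, K). (Inf K, Sup K)) ` q"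
    have sep: "Sup K \<le> Inf K' \<or> Sup K' \<le> Inf K"
      if "(x, K) \<in> q" "(x', K') \<in> q" "(x, K) \<noteq> (x', K')" for x K x' K'
    proof -
      have *: "(x, K) \<in> p" "(x', K') \<in> p" "Inf K < Sup K" "Inf K' < Sup K'" using that by (auto simp: q_def)
      have "interior K \<inter> interior K' = {}"
        using tagged_division_ofD(5)[OF p(1)] * that(3) by blast
      then have "interior {Inf K..Sup K} \<inter> interior {Inf K'..Sup K'} = {}"
        using K[OF *(1)] K[OF *(2)] by metis
      then have "{Inf K<..<Sup K} \<inter> {Inf K'<..<Sup K'} = {}" by simp
      then have "{max (Inf K) (Inf K')<..<min (Sup K) (Sup K')} = {}" by auto
      then show ?thesis using * by (auto simp: not_less)
    qed
    have inj: "inj_on (\<lambda>(x, K). (Inf K, Sup K)) q"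
    proof (rule inj_onI, clarify)
      fix x K x' K' assume A: "(x, K) \<in> q" "(x', K') \<in> q" "Inf K = Inf K'" "Sup K = Sup K'"
      then have "Inf K < Sup K" by (simp add: q_def)
      with A sep[OF A(1,2)] show "x = x' \<and> K = K'" by auto
    qed
    have novF: "nonoverlapping F 0 1"
    proof (rule nonoverlappingI)
      show "finite F" unfolding F_def q_def using fin by (auto intro: finite_subset)
      show "0 \<le> a \<and> a < b \<and> b \<le> 1" if "(a, b) \<in> F" for a b
        using that K by (auto simp: F_def q_def)
      fix a b a' b' assume A: "(a, b) \<in> F" "(a', b') \<in> F" "(a, b) \<noteq> (a', b')"
      from A(1) obtain x K where 1: "(x, K) \<in> q" "a = Inf K" "b = Sup K" by (auto simp: F_def)
      from A(2) obtain x' K' where 2: "(x', K') \<in> q" "a' = Inf K'" "b' = Sup K'" by (auto simp: F_def)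
      show "b \<le> a' \<or> b' \<le> a" using sep[OF 1(1) 2(1)] 1 2 A(3) by auto
    qed
    have "(\<Sum>(a, b)\<in>F. b - a) = (\<Sum>i\<in>F. measure lebesgue {fst i<..<snd i})"
      using nonoverlappingD(2)[OF novF] by (intro sum.cong refl) force
    also have "\<dots> = measure lebesgue (\<Union>i\<in>F. {fst i<..<snd i})"
    proof (rule measure_UNION'[symmetric])
      show "finite F" using novF by (rule nonoverlapping_finite)
      show "pairwise (\<lambda>i j. disjnt {fst i<..<snd i} {fst j<..<snd j}) F"
      proof (rule pairwiseI)
        fix i j assume "i \<in> F" "j \<in> F" "i \<noteq> j"
        then have "snd i \<le> fst j \<or> snd j \<le> fst i"
          using nonoverlapping_disjoint[OF novF, of "fst i" "snd i" "fst j" "snd j"]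
          by (simp add: prod_eq_iff)
        then show "disjnt {fst i<..<snd i} {fst j<..<snd j}" by (auto simp: disjnt_def)
      qed
    qed auto
    also have "\<dots> \<le> measure lebesgue U"
    proof (rule measure_mono_fmeasurable[OF _ _ UL])
      show "(\<Union>i\<in>F. {fst i<..<snd i}) \<subseteq> U"
      proof (intro UN_least)
        fix i assume "i \<in> F"
        then obtain x L where xL: "(x, L) \<in> q" "i = (Inf L, Sup L)" by (auto simp: F_def)
        then have "L \<subseteq> U" "L = {Inf L..Sup L}" using K[of x L] by (auto simp: q_def \<gamma>2_def)
        then show "{fst i<..<snd i} \<subseteq> U" using xL(2)
          by (metis fst_conv snd_conv greaterThanLessThan_subseteq_atLeastAtMost_iff order.trans order_refl)
      qed
      show "(\<Union>i\<in>F. {fst i<..<snd i}) \<in> sets lebesgue"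
        using nonoverlapping_finite[OF novF] by (intro sets.finite_UN) auto
    qed
    finally have "(\<Sum>(a, b)\<in>F. b - a) < d" using Ud by simp
    from d(2)[OF novF this] have "(\<Sum>(a, b)\<in>F. \<bar>f b - f a\<bar>) < e" by simp
    also have "(\<Sum>(a, b)\<in>F. \<bar>f b - f a\<bar>) = (\<Sum>(x, K)\<in>q. \<bar>f (Sup K) - f (Inf K)\<bar>)"
      unfolding F_def by (subst sum.reindex[OF inj]) (auto simp: case_prod_unfold)
    finally have bad: "(\<Sum>(x, K)\<in>q. \<bar>f (Sup K) - f (Inf K)\<bar>) < e" .
    have good: "\<bar>f (Sup K) - f (Inf K)\<bar> \<le> measure lborel K * g x + e * measure lborel K"
      if xK: "(x, K) \<in> p - q" for x K
    proof (cases "x \<in> N")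
      case True
      then have "\<not> Inf K < Sup K" using xK by (auto simp: q_def)
      with K[of x K] xK have "Sup K = Inf K" "measure lborel K = 0" by auto
      then show ?thesis by simp
    next
      case False
      have k: "K = {Inf K..Sup K}" "Inf K \<le> x" "x \<le> Sup K" "0 \<le> Inf K" "Sup K \<le> 1" "K \<subseteq> \<gamma>2 x"
        "measure lborel K = Sup K - Inf K" using K[of x K] xK by auto
      then have "Sup K \<in> K" "Inf K \<in> K" by (metis atLeastAtMost_iff order.trans order_refl)+
      with k False have "\<bar>Sup K - x\<bar> < \<delta> x" "\<bar>Inf K - x\<bar> < \<delta> x"
        by (auto simp: \<gamma>2_def dist_real_def dest!: subsetD[OF k(6)])
      moreover have loc': "\<bar>f t - f x\<bar> \<le> (g x + e) * \<bar>t - x\<bar>" if "t \<in> {0..1}" "\<bar>t - x\<bar> < \<delta> x" for t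
        using bspec[OF \<delta>, of x] False k that by simp
      ultimately have "\<bar>f (Sup K) - f x\<bar> \<le> (g x + e) * \<bar>Sup K - x\<bar>" "\<bar>f (Inf K) - f x\<bar> \<le> (g x + e) * \<bar>Inf K - x\<bar>"
        using k by (auto intro!: loc' simp del: abs_of_nonneg abs_of_nonpos)
      moreover have "(g x + e) * \<bar>Sup K - x\<bar> + (g x + e) * \<bar>Inf K - x\<bar> = (g x + e) * measure lborel K"
        using k(2,3) unfolding k(7) by (simp add: algebra_simps)
      ultimately have "\<bar>f (Sup K) - f (Inf K)\<bar> \<le> (g x + e) * measure lborel K" by linarith
      then show ?thesis by (simp add: algebra_simps)
    qed
    have pos: "0 \<le> measure lborel K * g x + e * measure lborel K" for x K
      using g(2)[of x] \<open>e > 0\<close> by simp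
    have qp: "q \<subseteq> p" by (auto simp: q_def)
    have "\<bar>f 1 - f 0\<bar> = \<bar>\<Sum>(x, K)\<in>p. f (Sup K) - f (Inf K)\<bar>"
      using additive_tagged_division_1[OF _ p(1), of f] by simp
    also have "\<dots> \<le> (\<Sum>(x, K)\<in>p. \<bar>f (Sup K) - f (Inf K)\<bar>)"
      by (rule order.trans[OF sum_abs]) (simp add: case_prod_unfold)
    also have "\<dots> = (\<Sum>(x, K)\<in>p - q. \<bar>f (Sup K) - f (Inf K)\<bar>) + (\<Sum>(x, K)\<in>q. \<bar>f (Sup K) - f (Inf K)\<bar>)"
      by (rule sum.subset_diff[OF qp fin])
    also have "\<dots> \<le> (\<Sum>(x, K)\<in>p. measure lborel K * g x + e * measure lborel K) + e"
    proof (rule add_mono)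
      have "(\<Sum>(x, K)\<in>p - q. \<bar>f (Sup K) - f (Inf K)\<bar>) \<le> (\<Sum>(x, K)\<in>p - q. measure lborel K * g x + e * measure lborel K)"
        using good by (intro sum_mono) (auto split: prod.splits)
      also have "\<dots> \<le> (\<Sum>(x, K)\<in>p. measure lborel K * g x + e * measure lborel K)"
        using fin pos by (intro sum_mono2) (auto split: prod.splits)
      finally show "(\<Sum>(x, K)\<in>p - q. \<bar>f (Sup K) - f (Inf K)\<bar>)
          \<le> (\<Sum>(x, K)\<in>p. measure lborel K * g x + e * measure lborel K)" .
    qed (use bad in simp)
    also have "(\<Sum>(x, K)\<in>p. measure lborel K * g x + e * measure lborel K) =
        (\<Sum>(x, K)\<in>p. measure lborel K *\<^sub>R g x) + e * (\<Sum>(x, K)\<in>p. measure lborel K)"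
      by (simp add: sum.distrib sum_distrib_left case_prod_unfold)
    also have "(\<Sum>(x, K)\<in>p. measure lborel K) = 1"
      using additive_content_tagged_division[of p 0 "1::real"] p(1) by simp
    also have "(\<Sum>(x, K)\<in>p. measure lborel K *\<^sub>R g x) \<le> r + e"
      using \<gamma>1(2)[OF p(1) fine(1)] by (simp add: abs_le_iff)
    finally show ?thesis by simp
  qed
  from this[of "_ / 3"] have "\<bar>f 1 - f 0\<bar> \<le> r + e" if "e > 0" for e using that by simp
  then have "\<bar>f 1 - f 0\<bar> \<le> r" using field_le_epsilon by blast
  then show ?thesis using r by (simp add: ennreal_leI)
qed simp

lemma abs_cont01_imp_ac01:
  assumes "abs_cont01 u"
  shows "ac01 u"
  unfolding ac01_def
proof (intro allI impI)
  fix e :: real assume "e > 0"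
  from assms[unfolded abs_cont01_def, THEN spec, THEN mp, OF this] obtain d where
    d: "d > 0" "\<forall>(n::nat) (a::nat \<Rightarrow> real) (b::nat \<Rightarrow> real).
        (\<forall>i<n. 0 \<le> a i \<and> a i \<le> b i \<and> b i \<le> 1) \<and>
        (\<forall>i<n. \<forall>j<n. i \<noteq> j \<longrightarrow> b i \<le> a j \<or> b j \<le> a i) \<and>
        (\<Sum>i<n. b i - a i) < d
        \<longrightarrow> (\<Sum>i<n. norm (u (b i) - u (a i))) < e"
    by (elim exE conjE)
  have "(\<Sum>(a, b)\<in>F. norm (u b - u a)) < e"
    if F: "nonoverlapping F 0 1" and "(\<Sum>(a, b)\<in>F. b - a) < d" for F
  proof -
    obtain h where h: "bij_betw h {..<card F} F"
      using ex_bij_betw_nat_finite[OF nonoverlapping_finite[OF F]] by (auto simp: atLeast0LessThan)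
    define a b where "a = fst \<circ> h" and "b = snd \<circ> h"
    have ab: "(a i, b i) \<in> F" if "i < card F" for i
      using that h by (auto simp: a_def b_def bij_betw_def)
    have sum: "(\<Sum>i<card F. \<phi> (a i) (b i)) = (\<Sum>(a, b)\<in>F. \<phi> a b)" for \<phi> :: "real \<Rightarrow> real \<Rightarrow> real"
      using sum.reindex_bij_betw[OF h, of "\<lambda>(a, b). \<phi> a b"] by (simp add: a_def b_def case_prod_unfold)
    have "(\<Sum>i<card F. norm (u (b i) - u (a i))) < e"
    proof (rule d(2)[THEN spec, THEN spec, THEN spec, THEN mp], intro conjI)
      show "\<forall>i<card F. 0 \<le> a i \<and> a i \<le> b i \<and> b i \<le> 1"
        using nonoverlappingD[OF F ab] by (meson less_imp_le)
      show "\<forall>i<card F. \<forall>j<card F. i \<noteq> j \<longrightarrow> b i \<le> a j \<or> b j \<le> a i"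
      proof (intro allI impI)
        fix i j assume ij: "i < card F" "j < card F" "i \<noteq> j"
        then have "h i \<noteq> h j" using h by (metis bij_betw_def inj_onD lessThan_iff)
        then have "(a i, b i) \<noteq> (a j, b j)" by (simp add: a_def b_def prod_eq_iff)
        then show "b i \<le> a j \<or> b j \<le> a i"
          using nonoverlapping_disjoint[OF F ab ab] ij by blast
      qed
      show "(\<Sum>i<card F. b i - a i) < d" using that(2) sum[of "\<lambda>a b. b - a"] by simp
    qed
    then show ?thesis using sum[of "\<lambda>a b. norm (u b - u a)"] by simp
  qed
  with d(1) show "\<exists>d>0. \<forall>F. nonoverlapping F 0 1 \<and> (\<Sum>(a, b)\<in>F. b - a) < d
     \<longrightarrow> (\<Sum>(a, b)\<in>F. norm (u b - u a)) < e" by blast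
qed

lemma ac01_lipschitz_compose:
  assumes u: "ac01 u" and W: "\<And>z w. norm (W z - W w) \<le> C * norm (z - w)"
  shows "ac01 (\<lambda>t. W (u t))"
  unfolding ac01_def
proof (intro allI impI)
  fix e :: real assume "e > 0"
  define D where "D = \<bar>C\<bar> + 1"
  have D: "D > 0" "\<And>z w. norm (W z - W w) \<le> D * norm (z - w)"
  proof -
    show "D > 0" by (simp add: D_def)
    show "norm (W z - W w) \<le> D * norm (z - w)" for z w
      by (rule order.trans[OF W]) (auto simp: D_def intro!: mult_right_mono)
  qed
  with u \<open>e > 0\<close> obtain d where d: "d > 0" "\<And>F. nonoverlapping F 0 1 \<and> (\<Sum>(a, b)\<in>F. b - a) < d
     \<Longrightarrow> (\<Sum>(a, b)\<in>F. norm (u b - u a)) < e / D"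
    unfolding ac01_def by (meson divide_pos_pos)
  have "(\<Sum>(a, b)\<in>F. norm (W (u b) - W (u a))) < e" if "nonoverlapping F 0 1 \<and> (\<Sum>(a, b)\<in>F. b - a) < d" for F
  proof -
    have "(\<Sum>(a, b)\<in>F. norm (W (u b) - W (u a))) \<le> (\<Sum>(a, b)\<in>F. D * norm (u b - u a))"
      using D by (intro sum_mono) auto
    also have "\<dots> = D * (\<Sum>(a, b)\<in>F. norm (u b - u a))"
      by (simp add: sum_distrib_left case_prod_unfold)
    also have "\<dots> < e" using d(2)[OF that] D(1) by (simp add: field_simps)
    finally show ?thesis .
  qed
  with d(1) show "\<exists>d>0. \<forall>F. nonoverlapping F 0 1 \<and> (\<Sum>(a, b)\<in>F. b - a) < d
     \<longrightarrow> (\<Sum>(a, b)\<in>F. norm (W (u b) - W (u a))) < e" by blast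
qed

lemma ac01_continuous_on:
  fixes u :: "real \<Rightarrow> 'a::real_normed_vector"
  assumes "ac01 u"
  shows "continuous_on {0..1} u"
  unfolding continuous_on_iff
proof (intro ballI allI impI)
  fix x e :: real assume x: "x \<in> {0..1}" and "e > 0"
  with assms obtain d where d: "d > 0" "\<And>F. nonoverlapping F 0 1 \<and> (\<Sum>(a, b)\<in>F. b - a) < d
     \<Longrightarrow> (\<Sum>(a, b)\<in>F. norm (u b - u a)) < e"
    unfolding ac01_def by meson
  have "dist (u y) (u x) < e" if "y \<in> {0..1}" "dist y x < d" for y
  proof (cases "x = y")
    case False
    then show ?thesis
      using d(2)[of "{(min x y, max x y)}"] x that
      by (cases "x < y") (auto simp: dist_norm min_def max_def norm_minus_commute)
  qed (use \<open>e > 0\<close> in auto)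
  with d(1) show "\<exists>d>0. \<forall>x'\<in>{0..1}. dist x' x < d \<longrightarrow> dist (u x') (u x) < e" by blast
qed

lemma ac01_prod_differentiable_ae:
  fixes u :: "real \<Rightarrow> real \<times> real"
  assumes "ac01 u"
  shows "negligible {x. 0 < x \<and> x < 1 \<and> \<not> u differentiable (at x)}"
proof -
  have "ac01 (\<lambda>t. fst (u t))"
    by (rule ac01_lipschitz_compose[OF assms, of fst 1])
       (metis fst_diff mult_1 norm_fst_le prod.collapse)
  moreover have "ac01 (\<lambda>t. snd (u t))"
    by (rule ac01_lipschitz_compose[OF assms, of snd 1])
       (metis snd_diff mult_1 norm_snd_le prod.collapse)
  ultimately have neg: "negligible ({x. 0 < x \<and> x < 1 \<and> \<not> (\<lambda>t. fst (u t)) differentiable (at x)} \<union>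
      {x. 0 < x \<and> x < 1 \<and> \<not> (\<lambda>t. snd (u t)) differentiable (at x)})"
    by (intro negligible_Un bv_on_differentiable_ae ac01_bv_on)
  have "u differentiable (at x)"
    if "(\<lambda>t. fst (u t)) differentiable (at x)" "(\<lambda>t. snd (u t)) differentiable (at x)" for x
  proof -
    from that obtain f' g' where "((\<lambda>t. fst (u t)) has_derivative f') (at x)"
      "((\<lambda>t. snd (u t)) has_derivative g') (at x)" by (auto simp: differentiable_def)
    from has_derivative_Pair[OF this] show ?thesis by (auto simp: differentiable_def)
  qed
  then show ?thesis by (intro negligible_subset[OF neg]) blast
qed

section \<open>Calibrations\<close>

text \<open>
  On a grid line the weight is 1 although a cell of weight \<open>\<beta>\<close> is adjacent, so there the slope may be as
  large as \<open>\<beta>\<close> in the transversal direction only.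
\<close>

definition calibrated_step :: "real \<Rightarrow> (real \<times> real \<Rightarrow> real) \<Rightarrow> real \<Rightarrow> real \<Rightarrow> real \<Rightarrow> real \<Rightarrow> bool" where
  "calibrated_step \<beta> W x y x' y' \<longleftrightarrow>
     (x \<notin> \<int> \<and> y \<notin> \<int> \<longrightarrow> \<bar>W (x', y') - W (x, y)\<bar> \<le> chess \<beta> (x, y) * norm (x' - x, y' - y)) \<and>
     (x \<in> \<int> \<longrightarrow> \<bar>W (x', y') - W (x, y)\<bar> \<le> \<beta> * \<bar>x' - x\<bar> + \<bar>y' - y\<bar>) \<and>
     (y \<in> \<int> \<longrightarrow> \<bar>W (x', y') - W (x, y)\<bar> \<le> \<bar>x' - x\<bar> + \<beta> * \<bar>y' - y\<bar>)"

definition calibration :: "real \<Rightarrow> (real \<times> real \<Rightarrow> real) \<Rightarrow> bool" where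
  "calibration \<beta> W \<longleftrightarrow> (\<forall>x y. \<exists>r>0. \<forall>x' y'. \<bar>x' - x\<bar> < r \<and> \<bar>y' - y\<bar> < r \<longrightarrow> calibrated_step \<beta> W x y x' y')"

lemma calibrationE:
  assumes "calibration \<beta> W"
  obtains r where "r > 0"
    "\<forall>x' y'. \<bar>x' - x\<bar> < r \<and> \<bar>y' - y\<bar> < r \<longrightarrow> calibrated_step \<beta> W x y x' y'"
  using assms unfolding calibration_def by meson

lemma chess_cases: "chess \<beta> z = \<beta> \<or> chess \<beta> z = 1"
  by (simp add: chess_def Let_def)

lemma chess_le: "1 \<le> \<beta> \<Longrightarrow> chess \<beta> z \<le> \<beta>"
  using chess_cases[of \<beta> z] by auto

lemma chess_ge_1: "1 \<le> \<beta> \<Longrightarrow> 1 \<le> chess \<beta> z"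
  using chess_cases[of \<beta> z] by auto

lemma Ints_not_between:
  assumes "(s::real) \<in> \<int>" "of_int k < s" "s < of_int k + 1"
  shows False
  using assms by (elim Ints_cases) (metis not_less of_int_1 of_int_add of_int_less_iff zless_imp_add1_zle)

lemma chess_eq_1_on_lines:
  assumes "x \<in> \<int> \<or> y \<in> \<int>"
  shows "chess \<beta> (x, y) = 1"
proof -
  have "\<not> (0 < s \<and> s < 1)" "\<not> (1 < s \<and> s < 2)" if "s \<in> \<int>" for s :: real
    using Ints_not_between[OF that, of 0] Ints_not_between[OF that, of 1] by auto
  moreover have "x - 2 * of_int \<lfloor>x / 2\<rfloor> \<in> \<int> \<or> y - 2 * of_int \<lfloor>y / 2\<rfloor> \<in> \<int>"
    using assms by (elim disjE) auto
  ultimately show ?thesis by (auto simp: chess_def Let_def)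
qed

text \<open>The local estimates add up along a segment by Bolzano's principle; the l1 distance is
  natural since the bounds on grid lines already have this form. It makes \<open>W\<close> along an
  absolutely continuous curve absolutely continuous.\<close>

lemma calibration_lipschitz_l1:
  assumes W: "calibration \<beta> W" and \<beta>: "1 \<le> \<beta>"
  shows "\<bar>W (x', y') - W (x, y)\<bar> \<le> \<beta> * (\<bar>x' - x\<bar> + \<bar>y' - y\<bar>)"
proof -
  have near_lip: "\<exists>r>0. \<forall>x' y'. \<bar>x' - x\<bar> < r \<and> \<bar>y' - y\<bar> < r \<longrightarrow>
      \<bar>W (x', y') - W (x, y)\<bar> \<le> \<beta> * (\<bar>x' - x\<bar> + \<bar>y' - y\<bar>)" for x y
  proof -
    obtain r where r: "r > 0"
      and *: "\<forall>x' y'. \<bar>x' - x\<bar> < r \<and> \<bar>y' - y\<bar> < r \<longrightarrow> calibrated_step \<beta> W x y x' y'"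
      by (rule calibrationE[OF W])
    have "\<bar>W (x', y') - W (x, y)\<bar> \<le> \<beta> * (\<bar>x' - x\<bar> + \<bar>y' - y\<bar>)"
      if "\<bar>x' - x\<bar> < r \<and> \<bar>y' - y\<bar> < r" for x' y'
    proof -
      note ** = *[THEN spec, THEN spec, THEN mp, OF that, unfolded calibrated_step_def]
      have "chess \<beta> (x, y) * norm (x' - x, y' - y) \<le> \<beta> * (\<bar>x' - x\<bar> + \<bar>y' - y\<bar>)"
        using chess_le[OF \<beta>] norm_Pair_le[of "x' - x" "y' - y"] \<beta> by (intro mult_mono) auto
      moreover have "\<bar>x' - x\<bar> \<le> \<beta> * \<bar>x' - x\<bar>" "\<bar>y' - y\<bar> \<le> \<beta> * \<bar>y' - y\<bar>"
        using \<beta> by (auto simp: mult_le_cancel_right1)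
      ultimately show ?thesis using ** by (cases "x \<in> \<int>"; cases "y \<in> \<int>") (auto simp: algebra_simps)
    qed
    with r show ?thesis by blast
  qed
  define \<gamma> where "\<gamma> = (\<lambda>t. W (x + t * (x' - x), y + t * (y' - y)))"
  define C where "C = \<beta> * (\<bar>x' - x\<bar> + \<bar>y' - y\<bar>)"
  have "\<bar>\<gamma> b - \<gamma> a\<bar> \<le> C * (b - a)" if "a \<le> b" for a b
    using that
  proof (induction a b rule: Bolzano)
    case (trans a b c)
    then show ?case by (simp add: algebra_simps)
  next
    case (local t)
    obtain r where r: "r > 0" "\<And>x1 y1. \<bar>x1 - (x + t * (x' - x))\<bar> < r \<and> \<bar>y1 - (y + t * (y' - y))\<bar> < r \<Longrightarrow>
      \<bar>W (x1, y1) - W (x + t * (x' - x), y + t * (y' - y))\<bar>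
      \<le> \<beta> * (\<bar>x1 - (x + t * (x' - x))\<bar> + \<bar>y1 - (y + t * (y' - y))\<bar>)"
      using near_lip[of "x + t * (x' - x)" "y + t * (y' - y)"] by metis
    define d where "d = r / (\<bar>x' - x\<bar> + \<bar>y' - y\<bar> + 1)"
    have d: "d > 0" using r(1) by (simp add: d_def add_nonneg_pos)
    have near: "\<bar>\<gamma> s - \<gamma> t\<bar> \<le> C * \<bar>s - t\<bar>" if "\<bar>s - t\<bar> < d" for s
    proof -
      have *: "x + s * (x' - x) - (x + t * (x' - x)) = (s - t) * (x' - x)"
        "y + s * (y' - y) - (y + t * (y' - y)) = (s - t) * (y' - y)" by (simp_all add: algebra_simps)
      have "\<bar>s - t\<bar> * (\<bar>x' - x\<bar> + \<bar>y' - y\<bar> + 1) < r"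
        using that r(1) by (simp add: d_def less_divide_eq)
      then have "\<bar>s - t\<bar> * \<bar>x' - x\<bar> + \<bar>s - t\<bar> * \<bar>y' - y\<bar> + \<bar>s - t\<bar> < r" by (simp add: algebra_simps)
      moreover have "0 \<le> \<bar>s - t\<bar> * \<bar>x' - x\<bar>" "0 \<le> \<bar>s - t\<bar> * \<bar>y' - y\<bar>" by simp_all
      ultimately have "\<bar>s - t\<bar> * \<bar>x' - x\<bar> < r" "\<bar>s - t\<bar> * \<bar>y' - y\<bar> < r" by linarith+
      then show ?thesis using r(2)[of "x + s * (x' - x)" "y + s * (y' - y)"]
        unfolding \<gamma>_def C_def * abs_mult by (simp add: algebra_simps)
    qed
    have "\<bar>\<gamma> b - \<gamma> a\<bar> \<le> C * (b - a)" if "a \<le> t \<and> t \<le> b \<and> b - a < d" for a b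
      using near[of a] near[of b] that by (simp add: algebra_simps)
    with d show ?case by blast
  qed
  from this[of 0 1] show ?thesis by (simp add: \<gamma>_def C_def)
qed

lemma norm_Pair_ge: "\<bar>a\<bar> \<le> norm (a :: real, b :: real)" "\<bar>b\<bar> \<le> norm (a, b)"
  using norm_fst_le[of a b] norm_snd_le[of b a] by simp_all

text \<open>When the velocity on a grid line is tangential, the transversal displacement is o(s -
  t); its factor \<beta> then disappears in the error e.\<close>

lemma calibration_along_curve:
  assumes W: "calibration \<beta> W" and \<beta>: "1 \<le> \<beta>"
    and v: "(v has_vector_derivative P) (at t)"
    and P: "fst (v t) \<in> \<int> \<Longrightarrow> fst P = 0" "snd (v t) \<in> \<int> \<Longrightarrow> snd P = 0"
    and e: "e > 0"
  shows "\<exists>\<delta>>0. \<forall>s. \<bar>s - t\<bar> < \<delta> \<longrightarrow> \<bar>W (v s) - W (v t)\<bar> \<le> (chess \<beta> (v t) * norm P + e) * \<bar>s - t\<bar>"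
proof -
  obtain x y where xy: "v t = (x, y)" by (cases "v t")
  obtain p q where pq: "P = (p, q)" by (cases P)
  \<comment> \<open>On a grid line the first-order error enters twice, once with factor \<beta> and
    once with factor 1.\<close>
  define e2 where "e2 = e / (2 * \<beta>)"
  have e2: "e2 > 0" "2 * (\<beta> * e2) = e" using e \<beta> by (auto simp: e2_def)
  obtain r where r: "r > 0"
    and *: "\<forall>x' y'. \<bar>x' - x\<bar> < r \<and> \<bar>y' - y\<bar> < r \<longrightarrow> calibrated_step \<beta> W x y x' y'"
    by (rule calibrationE[OF W])
  have "\<forall>e>0. \<exists>d>0. \<forall>s. norm (s - t) < d \<longrightarrow> norm (v s - v t - (s - t) *\<^sub>R P) \<le> e * norm (s - t)"
    using v unfolding has_vector_derivative_def has_derivative_within_alt by simp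
  with e2(1) obtain d where d: "d > 0"
    "\<And>s. norm (s - t) < d \<Longrightarrow> norm (v s - v t - (s - t) *\<^sub>R P) \<le> e2 * norm (s - t)" by blast
  define \<delta> where "\<delta> = min d (r / (norm P + e2))"
  have \<delta>: "\<delta> > 0" using d(1) r e2 by (simp add: \<delta>_def add_nonneg_pos)
  have "\<bar>W (v s) - W (v t)\<bar> \<le> (chess \<beta> (v t) * norm P + e) * \<bar>s - t\<bar>" if s: "\<bar>s - t\<bar> < \<delta>" for s
  proof -
    obtain x' y' where xy': "v s = (x', y')" by (cases "v s")
    define h where "h = \<bar>s - t\<bar>"
    have h: "0 \<le> h" by (simp add: h_def)
    have n: "norm (x' - x - (s - t) * p, y' - y - (s - t) * q) \<le> e2 * h"
      using d(2)[of s] s by (simp add: \<delta>_def xy xy' pq h_def)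
    have nx: "\<bar>x' - x - (s - t) * p\<bar> \<le> e2 * h" and ny: "\<bar>y' - y - (s - t) * q\<bar> \<le> e2 * h"
      using order.trans[OF norm_Pair_ge(1) n] order.trans[OF norm_Pair_ge(2) n] by auto
    have "(x' - x, y' - y) = (x' - x - (s - t) * p, y' - y - (s - t) * q) + (s - t) *\<^sub>R P"
      by (simp add: pq)
    then have N: "norm (x' - x, y' - y) \<le> e2 * h + h * norm P"
      using norm_triangle_ineq[of "(x' - x - (s - t) * p, y' - y - (s - t) * q)" "(s - t) *\<^sub>R P"] n
      by (simp add: h_def)
    also have "\<dots> < r"
    proof -
      have "h < r / (norm P + e2)" using s by (simp add: h_def \<delta>_def)
      moreover have "0 < norm P + e2" using e2(1) by (simp add: add_nonneg_pos)
      ultimately have "h * (norm P + e2) < r" by (simp only: pos_less_divide_eq)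
      then show ?thesis by (simp add: algebra_simps)
    qed
    finally have "norm (x' - x, y' - y) < r" .
    then have "\<bar>x' - x\<bar> < r \<and> \<bar>y' - y\<bar> < r"
      using norm_Pair_ge[where a="x' - x" and b="y' - y"] by auto
    note ** = *[THEN spec, THEN spec, THEN mp, OF this, unfolded calibrated_step_def]
    have e2\<beta>: "e2 * h \<le> \<beta> * (e2 * h)" "\<beta> * (e2 * h) \<le> e * h"
    proof -
      show "e2 * h \<le> \<beta> * (e2 * h)" using mult_right_mono[OF \<beta>, of "e2 * h"] e2(1) h by simp
      have "e * h = 2 * (\<beta> * (e2 * h))" unfolding e2(2)[symmetric] by simp
      moreover have "0 \<le> \<beta> * (e2 * h)" using \<beta> e2(1) h by simp
      ultimately show "\<beta> * (e2 * h) \<le> e * h" by linarith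
    qed
    have e_eq: "2 * (\<beta> * (e2 * h)) = e * h" unfolding e2(2)[symmetric] by simp
    have "\<bar>W (x', y') - W (x, y)\<bar> \<le> (chess \<beta> (x, y) * norm P) * h + e * h"
    proof (cases "x \<in> \<int> \<or> y \<in> \<int>")
      case False
      then have "\<bar>W (x', y') - W (x, y)\<bar> \<le> chess \<beta> (x, y) * norm (x' - x, y' - y)" using ** by simp
      also have "\<dots> \<le> chess \<beta> (x, y) * (e2 * h + h * norm P)"
        using N chess_ge_1[OF \<beta>, of "(x, y)"] by (intro mult_left_mono) auto
      also have "\<dots> = chess \<beta> (x, y) * (e2 * h) + (chess \<beta> (x, y) * norm P) * h" by (simp add: algebra_simps)
      also have "chess \<beta> (x, y) * (e2 * h) \<le> \<beta> * (e2 * h)"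
        using chess_le[OF \<beta>] e2(1) h by (intro mult_right_mono) auto
      finally show ?thesis using e2\<beta> by linarith
    next
      case True
      then have c: "chess \<beta> (x, y) = 1" by (rule chess_eq_1_on_lines)
      show ?thesis
      proof (cases "x \<in> \<int>")
        case True
        then have p: "p = 0" using P(1) xy pq by simp
        have "\<bar>W (x', y') - W (x, y)\<bar> \<le> \<beta> * \<bar>x' - x\<bar> + \<bar>y' - y\<bar>" using ** True by simp
        also have "\<dots> \<le> \<beta> * (e2 * h) + (e2 * h + h * \<bar>q\<bar>)"
        proof (intro add_mono mult_left_mono)
          show "\<bar>x' - x\<bar> \<le> e2 * h" using nx p by simp
          have "\<bar>(s - t) * q\<bar> = h * \<bar>q\<bar>" by (simp add: h_def abs_mult)
          then show "\<bar>y' - y\<bar> \<le> e2 * h + h * \<bar>q\<bar>" using ny by linarith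
        qed (use \<beta> in simp)
        also have "h * \<bar>q\<bar> = norm P * h" using p pq by (simp add: norm_Pair)
        finally show ?thesis unfolding c using e2\<beta> e_eq by linarith
      next
        case False
        with True have y: "y \<in> \<int>" by simp
        then have q: "q = 0" using P(2) xy pq by simp
        have "\<bar>W (x', y') - W (x, y)\<bar> \<le> \<bar>x' - x\<bar> + \<beta> * \<bar>y' - y\<bar>" using ** y by simp
        also have "\<dots> \<le> (e2 * h + h * \<bar>p\<bar>) + \<beta> * (e2 * h)"
        proof (intro add_mono mult_left_mono)
          show "\<bar>y' - y\<bar> \<le> e2 * h" using ny q by simp
          have "\<bar>(s - t) * p\<bar> = h * \<bar>p\<bar>" by (simp add: h_def abs_mult)
          then show "\<bar>x' - x\<bar> \<le> e2 * h + h * \<bar>p\<bar>" using nx by linarith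
        qed (use \<beta> in simp)
        also have "h * \<bar>p\<bar> = norm P * h" using q pq by (simp add: norm_Pair)
        finally show ?thesis unfolding c using e2\<beta> e_eq by linarith
      qed
    qed
    then show ?thesis by (simp add: xy xy' h_def algebra_simps)
  qed
  with \<delta> show ?thesis by blast
qed

text \<open>A nonzero derivative isolates t in its level set. An interval with rational end points
  witnesses this, and distinct points of one level set get distinct intervals.\<close>

lemma countable_transversal_crossings:
  fixes h :: "real \<Rightarrow> real"
  shows "countable {t. h t \<in> \<int> \<and> (\<exists>D. D \<noteq> 0 \<and> (h has_real_derivative D) (at t))}"
proof -
  define S where "S k = {t. h t = of_int k \<and> (\<exists>D. D \<noteq> 0 \<and> (h has_real_derivative D) (at t))}" for k :: int
  have "countable (S k)" for k
  proof -
    have "\<exists>p::rat\<times>rat. of_rat (fst p) < t \<and> t < of_rat (snd p) \<and>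
        (\<forall>s\<in>S k. of_rat (fst p) < s \<and> s < of_rat (snd p) \<longrightarrow> s = t)" if "t \<in> S k" for t
    proof -
      from that obtain D where D: "D \<noteq> 0" "(h has_real_derivative D) (at t)" "h t = of_int k" by (auto simp: S_def)
      from D(2) have "((\<lambda>s. (h s - h t) / (s - t)) \<longlongrightarrow> D) (at t)" by (simp add: has_field_derivative_iff)
      then have "\<forall>\<^sub>F s in at t. (h s - h t) / (s - t) \<noteq> 0" using D(1) by (rule tendsto_imp_eventually_ne)
      then obtain d where d: "d > 0" "\<And>s. s \<noteq> t \<Longrightarrow> \<bar>s - t\<bar> < d \<Longrightarrow> h s \<noteq> h t"
        unfolding eventually_at dist_real_def by (metis UNIV_I diff_self div_0)
      obtain a :: rat where a: "t - d < of_rat a" "of_rat a < t" using of_rat_dense[of "t - d" t] d(1) by auto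
      obtain b :: rat where b: "t < of_rat b" "of_rat b < t + d" using of_rat_dense[of t "t + d"] d(1) by auto
      show ?thesis
      proof (intro exI[of _ "(a, b)"] conjI ballI impI)
        fix s assume "s \<in> S k" and "of_rat (fst (a, b)) < s \<and> s < of_rat (snd (a, b))"
        then have "h s = h t" "\<bar>s - t\<bar> < d" using a b D(3) by (auto simp: S_def abs_less_iff)
        then show "s = t" using d(2)[of s] by blast
      qed (use a b in auto)
    qed
    then have "\<forall>t\<in>S k. \<exists>p::rat\<times>rat. of_rat (fst p) < t \<and> t < of_rat (snd p) \<and>
        (\<forall>s\<in>S k. of_rat (fst p) < s \<and> s < of_rat (snd p) \<longrightarrow> s = t)" by simp
    from bchoice[OF this] obtain F :: "real \<Rightarrow> rat \<times> rat" where
      F: "\<forall>t\<in>S k. of_rat (fst (F t)) < t \<and> t < of_rat (snd (F t)) \<and>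
        (\<forall>s\<in>S k. of_rat (fst (F t)) < s \<and> s < of_rat (snd (F t)) \<longrightarrow> s = t)" ..
    have "inj_on F (S k)"
    proof (rule inj_onI)
      fix s t assume A: "s \<in> S k" "t \<in> S k" "F s = F t"
      from bspec[OF F A(1)] have "of_rat (fst (F t)) < s" "s < of_rat (snd (F t))" using A(3) by auto
      with bspec[OF F A(2)] A(1) show "s = t" by blast
    qed
    moreover have "countable (F ` S k)" by simp
    ultimately show ?thesis by (rule countable_image_inj_on[rotated])
  qed
  then have "countable (\<Union>k. S k)" by (intro countable_UN) auto
  moreover have "{t. h t \<in> \<int> \<and> (\<exists>D. D \<noteq> 0 \<and> (h has_real_derivative D) (at t))} \<subseteq> (\<Union>k. S k)"
    by (auto simp: S_def elim!: Ints_cases)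
  ultimately show ?thesis by (rule countable_subset[rotated])
qed

lemma borel_measurable_chess [measurable]: "chess \<beta> \<in> borel_measurable borel"
proof -
  have [measurable]: "fst \<in> borel_measurable (borel :: (real \<times> real) measure)"
    "snd \<in> borel_measurable (borel :: (real \<times> real) measure)"
    by (intro borel_measurable_continuous_onI continuous_intros)+
  show ?thesis unfolding chess_def Let_def by measurable
qed

text \<open>
  A curve crosses grid lines transversally only countably often; at almost every other time spent on a grid
  line its velocity is tangential, where \<open>W\<close> has slope at most 1.
\<close>

lemma wlength_ge_calibration:
  assumes W: "calibration \<beta> W" and \<beta>: "1 \<le> \<beta>" and \<epsilon>: "0 < \<epsilon>" and u: "abs_cont01 u"
  shows "ennreal (\<epsilon> * (W ((1 / \<epsilon>) *\<^sub>R u 1) - W ((1 / \<epsilon>) *\<^sub>R u 0))) \<le> wlength \<epsilon> \<beta> u"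
proof -
  define v where "v t = (1 / \<epsilon>) *\<^sub>R u t" for t
  define f where "f t = W (v t)" for t
  \<comment> \<open>Clamping the parameter yields a curve that is continuous on the whole line and
    unchanged on [0, 1].\<close>
  define w where "w t = u (max 0 (min 1 t))" for t
  \<comment> \<open>A Borel version of the velocity: \<open>lim\<close> of difference quotients is
    measurable everywhere and equals \<open>vector_derivative\<close> at the points of [0, 1]
    outside \<open>N\<close>.\<close>
  define G where "G t = lim (\<lambda>n. real (Suc n) *\<^sub>R (w (t + 1 / real (Suc n)) - w t))" for t
  define g where "g t = chess \<beta> ((1 / \<epsilon>) *\<^sub>R w t) * norm (G t) / \<epsilon>" for t
  \<comment> \<open>Off \<open>N\<close> the curve has a velocity in (0, 1), and this velocity is
    tangential whenever the scaled curve is on a grid line.\<close>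
  define N where "N = {t. 0 < t \<and> t < 1 \<and> \<not> u differentiable (at t)} \<union> {0, 1} \<union>
    {t. fst (v t) \<in> \<int> \<and> (\<exists>D. D \<noteq> 0 \<and> ((\<lambda>t. fst (v t)) has_real_derivative D) (at t))} \<union>
    {t. snd (v t) \<in> \<int> \<and> (\<exists>D. D \<noteq> 0 \<and> ((\<lambda>t. snd (v t)) has_real_derivative D) (at t))}"
  have uac: "ac01 u" using u by (rule abs_cont01_imp_ac01)
  have fac: "ac01 f"
    unfolding f_def v_def
  proof (rule ac01_lipschitz_compose[OF uac])
    fix z z' :: "real \<times> real"
    have "\<bar>W ((1 / \<epsilon>) *\<^sub>R z) - W ((1 / \<epsilon>) *\<^sub>R z')\<bar>
        \<le> \<beta> * (\<bar>fst z / \<epsilon> - fst z' / \<epsilon>\<bar> + \<bar>snd z / \<epsilon> - snd z' / \<epsilon>\<bar>)"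
      using calibration_lipschitz_l1[OF W \<beta>, of "fst z / \<epsilon>" "snd z / \<epsilon>" "fst z' / \<epsilon>" "snd z' / \<epsilon>"]
      by (cases z; cases z') auto
    also have "\<dots> = \<beta> / \<epsilon> * (\<bar>fst (z - z')\<bar> + \<bar>snd (z - z')\<bar>)"
      using \<epsilon> by (simp add: field_simps abs_divide flip: diff_divide_distrib)
    also have "\<dots> \<le> \<beta> / \<epsilon> * (norm (z - z') + norm (z - z'))"
      using norm_Pair_ge[where a="fst (z - z')" and b="snd (z - z')"] \<epsilon> \<beta>
      unfolding prod.collapse by (intro mult_left_mono add_mono) simp_all
    finally show "norm (W ((1 / \<epsilon>) *\<^sub>R z) - W ((1 / \<epsilon>) *\<^sub>R z')) \<le> (2 * \<beta> / \<epsilon>) * norm (z - z')"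
      by (simp add: algebra_simps)
  qed
  have crossings: "negligible {t. h t \<in> \<int> \<and> (\<exists>D. D \<noteq> 0 \<and> (h has_real_derivative D) (at t))}" for h
    using countable_imp_null_set_lborel[OF countable_transversal_crossings, of h]
    unfolding negligible_iff_null_sets by (rule null_sets_completionI)
  have N: "negligible N"
    unfolding N_def
    by (intro negligible_Un ac01_prod_differentiable_ae uac crossings) simp
  have cw: "continuous_on UNIV w"
    unfolding w_def by (intro continuous_on_compose2[OF ac01_continuous_on[OF uac]] continuous_intros) auto
  have [measurable]: "w \<in> borel_measurable borel" using cw by (rule borel_measurable_continuous_onI)
  have G_meas [measurable]: "G \<in> borel_measurable borel" unfolding G_def by measurable
  have "g \<in> borel_measurable borel" unfolding g_def by measurable
  then have g_meas: "g \<in> borel_measurable lebesgue" by (intro measurable_completion) simp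
  have g_nonneg: "0 \<le> g t" for t
    unfolding g_def using chess_ge_1[OF \<beta>, of "(1 / \<epsilon>) *\<^sub>R w t"] \<epsilon> by simp
  have D: "(u has_vector_derivative vector_derivative u (at t)) (at t)" "w t = u t"
    "G t = vector_derivative u (at t)" if t: "t \<in> {0..1} - N" for t
  proof -
    from t have t01: "0 < t" "t < 1" by (auto simp: N_def le_less)
    from t t01 have "u differentiable (at t)" by (auto simp: N_def)
    then show D: "(u has_vector_derivative vector_derivative u (at t)) (at t)"
      by (simp add: vector_derivative_works)
    show "w t = u t" using t01 by (simp add: w_def)
    have "(w has_vector_derivative vector_derivative u (at t)) (at t)"
      by (rule has_vector_derivative_transform_within_open[OF D, of "{0<..<1}"])
         (use t01 in \<open>auto simp: w_def\<close>)
    then have "((\<lambda>h. norm (w (t + h) - w t - h *\<^sub>R vector_derivative u (at t)) / norm h) \<longlongrightarrow> 0) (at 0)"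
      unfolding has_vector_derivative_def has_derivative_at by (rule conjunct2)
    moreover have "filterlim (\<lambda>n. 1 / real (Suc n)) (at 0) sequentially"
      using LIMSEQ_Suc[OF lim_1_over_n] by (auto simp: filterlim_at intro!: always_eventually)
    ultimately have "(\<lambda>n. norm (w (t + 1 / real (Suc n)) - w t - (1 / real (Suc n)) *\<^sub>R vector_derivative u (at t))
        / norm (1 / real (Suc n))) \<longlonglongrightarrow> 0"
      by (rule filterlim_compose)
    moreover have "norm (w (t + 1 / real (Suc n)) - w t - (1 / real (Suc n)) *\<^sub>R vector_derivative u (at t))
        / norm (1 / real (Suc n)) =
        norm (real (Suc n) *\<^sub>R (w (t + 1 / real (Suc n)) - w t) - vector_derivative u (at t))" for n
    proof -
      have "real (Suc n) *\<^sub>R (w (t + 1 / real (Suc n)) - w t) - vector_derivative u (at t) =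
         real (Suc n) *\<^sub>R (w (t + 1 / real (Suc n)) - w t - (1 / real (Suc n)) *\<^sub>R vector_derivative u (at t))"
        by (simp only: scaleR_diff_right scaleR_scaleR) simp
      then show ?thesis by (simp only: norm_scaleR) simp
    qed
    ultimately have "(\<lambda>n. norm (real (Suc n) *\<^sub>R (w (t + 1 / real (Suc n)) - w t) - vector_derivative u (at t))) \<longlonglongrightarrow> 0"
      by (simp only:)
    then have "(\<lambda>n. real (Suc n) *\<^sub>R (w (t + 1 / real (Suc n)) - w t) - vector_derivative u (at t)) \<longlonglongrightarrow> 0"
      by (rule tendsto_norm_zero_cancel)
    then have "(\<lambda>n. real (Suc n) *\<^sub>R (w (t + 1 / real (Suc n)) - w t)) \<longlonglongrightarrow> vector_derivative u (at t)"
      by (rule LIM_zero_cancel)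
    then show "G t = vector_derivative u (at t)" unfolding G_def by (rule limI)
  qed
  have "ennreal \<bar>f 1 - f 0\<bar> \<le> (\<integral>\<^sup>+ t. ennreal (g t) * indicator {0..1} t \<partial>lebesgue)"
  proof (rule ac01_increment_le_nn_integral[OF fac N g_meas g_nonneg])
    fix t e :: real assume t: "t \<in> {0..1} - N" and "e > 0"
    define P where "P = (1 / \<epsilon>) *\<^sub>R vector_derivative u (at t)"
    have v: "(v has_vector_derivative P) (at t)"
      unfolding v_def P_def by (rule bounded_linear.has_vector_derivative[OF bounded_linear_scaleR_right D(1)[OF t]])
    have "((\<lambda>t. fst (v t)) has_real_derivative fst P) (at t)" "((\<lambda>t. snd (v t)) has_real_derivative snd P) (at t)"
      using has_derivative_fst[OF v[unfolded has_vector_derivative_def]]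
        has_derivative_snd[OF v[unfolded has_vector_derivative_def]]
      by (simp_all add: has_field_derivative_def mult.commute[of _ "fst P"] mult.commute[of _ "snd P"])
    then have "fst (v t) \<in> \<int> \<Longrightarrow> fst P = 0" "snd (v t) \<in> \<int> \<Longrightarrow> snd P = 0"
      using t unfolding N_def by blast+
    from calibration_along_curve[OF W \<beta> v this \<open>e > 0\<close>]
    obtain \<delta> where \<delta>: "\<delta> > 0" "\<And>s. \<bar>s - t\<bar> < \<delta> \<Longrightarrow>
        \<bar>W (v s) - W (v t)\<bar> \<le> (chess \<beta> (v t) * norm P + e) * \<bar>s - t\<bar>" by blast
    have "g t = chess \<beta> (v t) * norm P"
      using \<epsilon> by (simp add: g_def P_def D(2,3)[OF t] v_def)
    with \<delta> show "\<exists>\<delta>>0. \<forall>s\<in>{0..1}. \<bar>s - t\<bar> < \<delta> \<longrightarrow> \<bar>f s - f t\<bar> \<le> (g t + e) * \<bar>s - t\<bar>"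
      by (auto simp: f_def)
  qed
  then have "ennreal \<epsilon> * ennreal \<bar>f 1 - f 0\<bar> \<le> ennreal \<epsilon> * (\<integral>\<^sup>+ t. ennreal (g t) * indicator {0..1} t \<partial>lebesgue)"
    by (rule mult_left_mono) simp
  also have "\<dots> = (\<integral>\<^sup>+ t. ennreal \<epsilon> * (ennreal (g t) * indicator {0..1} t) \<partial>lebesgue)"
    using g_meas
    by (intro nn_integral_cmult[symmetric] borel_measurable_times_ennreal measurable_compose[OF _ measurable_ennreal]
        borel_measurable_indicator) auto
  also have "\<dots> = wlength \<epsilon> \<beta> u"
    unfolding wlength_def
  proof (rule nn_integral_cong_AE)
    have "AE t in lebesgue. t \<notin> N" using N by (intro AE_not_in) (simp add: negligible_iff_null_sets)
    then show "AE t in lebesgue. ennreal \<epsilon> * (ennreal (g t) * indicator {0..1} t) =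
        ennreal (chess \<beta> ((1 / \<epsilon>) *\<^sub>R u t) * norm (vector_derivative u (at t))) * indicator {0..1} t"
    proof eventually_elim
      case (elim t)
      show ?case
      proof (cases "t \<in> {0..1}")
        case True
        with elim have "t \<in> {0..1} - N" by simp
        then have "\<epsilon> * g t = chess \<beta> ((1 / \<epsilon>) *\<^sub>R u t) * norm (vector_derivative u (at t))"
          using \<epsilon> by (simp add: g_def D)
        then show ?thesis using True \<epsilon> g_nonneg[of t] by (simp flip: ennreal_mult)
      qed simp
    qed
  qed
  finally have "ennreal (\<epsilon> * \<bar>f 1 - f 0\<bar>) \<le> wlength \<epsilon> \<beta> u" using \<epsilon> by (simp add: ennreal_mult)
  moreover have "\<epsilon> * (f 1 - f 0) \<le> \<epsilon> * \<bar>f 1 - f 0\<bar>" using \<epsilon> by (intro mult_left_mono) auto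
  ultimately show ?thesis unfolding f_def v_def by (meson ennreal_leI order.trans)
qed

section \<open>Lipschitz building blocks in the plane\<close>

definition plane_lipschitz :: "real \<Rightarrow> (real \<Rightarrow> real \<Rightarrow> real) \<Rightarrow> bool" where
  "plane_lipschitz c f \<longleftrightarrow> (\<forall>x y x' y'. \<bar>f x' y' - f x y\<bar> \<le> c * norm (x' - x, y' - y))"

lemma plane_lipschitz_mono: "plane_lipschitz c f \<Longrightarrow> c \<le> d \<Longrightarrow> plane_lipschitz d f"
  unfolding plane_lipschitz_def by (meson mult_right_mono norm_ge_zero order.trans)

lemma plane_lipschitz_min_max:
  assumes "plane_lipschitz c f" "plane_lipschitz c g"
  shows "plane_lipschitz c (\<lambda>x y. min (f x y) (g x y))" "plane_lipschitz c (\<lambda>x y. max (f x y) (g x y))"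
proof -
  have "\<bar>min a b - min a' b'\<bar> \<le> m" "\<bar>max a b - max a' b'\<bar> \<le> m"
    if "\<bar>a - a'\<bar> \<le> m" "\<bar>b - b'\<bar> \<le> m" for a b a' b' m :: real
    using that by linarith+
  then show "plane_lipschitz c (\<lambda>x y. min (f x y) (g x y))" "plane_lipschitz c (\<lambda>x y. max (f x y) (g x y))"
    using assms unfolding plane_lipschitz_def by blast+
qed

lemma plane_lipschitz_linear:
  assumes "a\<^sup>2 + b\<^sup>2 \<le> c\<^sup>2" "0 \<le> c"
  shows "plane_lipschitz c (\<lambda>x y. d + a * x + b * y)"
  unfolding plane_lipschitz_def
proof (intro allI)
  fix x y x' y' :: real
  have "\<bar>(a, b) \<bullet> (x' - x, y' - y)\<bar> \<le> norm (a, b) * norm (x' - x, y' - y)"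
    by (rule Cauchy_Schwarz_ineq2)
  also have "\<dots> \<le> c * norm (x' - x, y' - y)"
    using assms by (intro mult_right_mono) (auto simp: norm_Pair intro!: real_le_lsqrt)
  finally show "\<bar>d + a * x' + b * y' - (d + a * x + b * y)\<bar> \<le> c * norm (x' - x, y' - y)"
    by (simp add: algebra_simps)
qed

lemma plane_lipschitz_reflect:
  assumes "plane_lipschitz c f"
  shows "plane_lipschitz c (\<lambda>x y. d - f (1 - x) (1 - y))"
  unfolding plane_lipschitz_def
proof (intro allI)
  fix x y x' y' :: real
  have "\<bar>f (1 - x) (1 - y) - f (1 - x') (1 - y')\<bar> \<le> c * norm ((1 - x) - (1 - x'), (1 - y) - (1 - y'))"
    using assms unfolding plane_lipschitz_def by blast
  also have "((1 - x) - (1 - x'), (1 - y) - (1 - y')) = (x' - x, y' - y)" by simp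
  finally show "\<bar>d - f (1 - x') (1 - y') - (d - f (1 - x) (1 - y))\<bar> \<le> c * norm (x' - x, y' - y)" by simp
qed

lemma plane_lipschitz_norm_shift: "plane_lipschitz 1 (\<lambda>x y. norm (d + x, y))"
  unfolding plane_lipschitz_def
proof (intro allI)
  fix x y x' y' :: real
  have "\<bar>norm (d + x', y') - norm (d + x, y)\<bar> \<le> norm ((d + x', y') - (d + x, y))"
    by (rule norm_triangle_ineq3)
  then show "\<bar>norm (d + x', y') - norm (d + x, y)\<bar> \<le> 1 * norm (x' - x, y' - y)" by simp
qed

text \<open>In coordinates rotated by 45 degrees: the distance to the ray of points (-t, t) with t
  >= 0. Below the diagonal this is the distance to the origin; above it, where x + y >= 0, it is (x
  + y) / sqrt 2. Its slope along the edge x = 0 is thus 1/sqrt 2 instead of 1, which keeps the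
  gradients in the adjacent cell of weight \<beta> small.\<close>

definition wedge :: "real \<Rightarrow> real \<Rightarrow> real" where
  "wedge x y = norm (sqrt 2 / 2 * (x + y), max 0 (sqrt 2 / 2 * (x - y)))"

lemma plane_lipschitz_wedge: "plane_lipschitz 1 wedge"
  unfolding plane_lipschitz_def
proof (intro allI)
  fix x y x' y' :: real
  let ?k = "sqrt 2 / 2"
  have k2: "?k\<^sup>2 = 1 / 2" by (simp add: power_divide)
  let ?m = "\<lambda>x y. max 0 (?k * (x - y))"
  have "\<bar>wedge x' y' - wedge x y\<bar> \<le> norm ((?k * (x' + y'), ?m x' y') - (?k * (x + y), ?m x y))"
    unfolding wedge_def by (rule norm_triangle_ineq3)
  also have "\<dots> = sqrt ((?k * (x' + y') - ?k * (x + y))\<^sup>2 + (?m x' y' - ?m x y)\<^sup>2)"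
    by (simp add: norm_Pair)
  also have "\<dots> \<le> sqrt ((x' - x)\<^sup>2 + (y' - y)\<^sup>2)"
  proof (rule real_sqrt_le_mono)
    have "\<bar>?m x' y' - ?m x y\<bar> \<le> \<bar>?k * (x' - y') - ?k * (x - y)\<bar>" by linarith
    then have "(?m x' y' - ?m x y)\<^sup>2 \<le> (?k * (x' - y') - ?k * (x - y))\<^sup>2" by (simp add: abs_le_square_iff)
    moreover have "(?k * (x' + y') - ?k * (x + y))\<^sup>2 + (?k * (x' - y') - ?k * (x - y))\<^sup>2 = (x' - x)\<^sup>2 + (y' - y)\<^sup>2"
      unfolding right_diff_distrib[symmetric] power_mult_distrib k2 by (simp add: power2_eq_square field_simps)
    ultimately show "(?k * (x' + y') - ?k * (x + y))\<^sup>2 + (?m x' y' - ?m x y)\<^sup>2 \<le> (x' - x)\<^sup>2 + (y' - y)\<^sup>2"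
      by linarith
  qed
  finally show "\<bar>wedge x' y' - wedge x y\<bar> \<le> 1 * norm (x' - x, y' - y)" by (simp add: norm_Pair)
qed

lemma wedge_below_diagonal:
  assumes "y \<le> x"
  shows "wedge x y = sqrt (x\<^sup>2 + y\<^sup>2)"
proof -
  have "max 0 (sqrt 2 / 2 * (x - y)) = sqrt 2 / 2 * (x - y)" using assms by simp
  moreover have "(sqrt 2 / 2 * (x + y))\<^sup>2 + (sqrt 2 / 2 * (x - y))\<^sup>2 = x\<^sup>2 + y\<^sup>2"
    unfolding power_mult_distrib by (simp add: power_divide) (simp add: power2_eq_square field_simps)
  ultimately show ?thesis unfolding wedge_def norm_Pair real_norm_def power2_abs by simp
qed

lemma wedge_above_diagonal:
  assumes "x \<le> y" "0 \<le> x + y"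
  shows "wedge x y = sqrt 2 / 2 * (x + y)"
proof -
  have "max 0 (sqrt 2 / 2 * (x - y)) = 0" using assms by (simp add: mult_nonneg_nonpos)
  then show ?thesis using assms by (simp add: wedge_def)
qed

lemma sqrt2_bounds: "(707 / 500) \<le> sqrt 2" "sqrt 2 \<le> (70711 / 50000)"
  by (rule real_le_rsqrt real_le_lsqrt; simp add: power2_eq_square)+

text \<open>
  \<open>A\<close> is the calibration on the cell \<open>[0,1] \<times> [0,1]\<close> of weight 1 and \<open>B\<close> the one on the cell
  \<open>[1,2] \<times> [0,1]\<close> of weight \<open>\<beta>\<close>, in the coordinates \<open>(s, y) = (x - 1, y)\<close>. The assumption
  \<open>snell\<close> says \<open>3 p + q = Lambda3 \<beta>\<close>. The point reflection \<open>z \<mapsto> 1 - z\<close> exchanges \<open>\<phi>\<close> with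
  \<open>\<psi>\<close> and \<open>P\<close> with \<open>Q\<close>; this reduces the four matching conditions on the edges to two.
\<close>

locale cell_calibration =
  fixes \<beta> p q \<sigma> :: real
  assumes p: "(49 / 50) \<le> p" "p \<le> 1" and q: "(19 / 50) \<le> q" "q \<le> (9 / 20)" and pq: "p + q \<le> sqrt 2"
    and \<beta>: "0 < \<beta>" "3 / 2 \<le> \<beta>\<^sup>2" "3 * p + q - 1 \<le> 2 * \<beta>" and \<sigma>: "(1 / 5) \<le> \<sigma>" "\<sigma> \<le> (3 / 5)"
    and snell: "3 * p + q = 2 * sqrt (1 - \<sigma>\<^sup>2) + sqrt (\<beta>\<^sup>2 - \<sigma>\<^sup>2) + \<sigma>"
begin

text \<open>The cut is affine with unit gradient (4/5, 3/5) and value p at the corner (1, 0); it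
  allows p < 1. The Pythagorean triple keeps the arithmetic rational.\<close>

definition \<psi> :: "real \<Rightarrow> real \<Rightarrow> real" where
  "\<psi> x y = min (wedge x y) (p - (4 / 5) * (1 - x) + (3 / 5) * y)"

definition \<phi> :: "real \<Rightarrow> real \<Rightarrow> real" where
  "\<phi> x y = p + q - \<psi> (1 - x) (1 - y)"

text \<open>The affine middle term is its own image under the point reflection, with value (p + q) /
  2 at the centre. It caps \<open>\<psi>\<close> so that \<open>\<phi>\<close> prevails on the top
  edge, while \<open>\<psi>\<close> prevails on the bottom edge.\<close>

definition A :: "real \<Rightarrow> real \<Rightarrow> real" where
  "A x y = max (\<phi> x y) (min (\<psi> x y) (x + (p + q - 1) / 2))"

text \<open>An extension of edge data. The first argument of \<open>max\<close> continues the top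
  trace downwards with slope 1/sqrt 2; the next term continues the bottom trace upwards with slope
  3/5; the last two continue the traces \<open>sqrt (1 + y\<^sup>2)\<close> and (1 + p + q) / 2
  occurring in \<open>A\<close> on the left edge. \<open>Q\<close> does the same from the right
  edge.\<close>

definition P :: "real \<Rightarrow> real \<Rightarrow> real" where
  "P s y = max (p + q + min s (p - (4 / 5) * (1 - s)) - sqrt 2 / 2 * (1 - y))
     (min (max (2 * p - 1 + s) (p + (4 / 5) * s) + (3 / 5) * y) (min (norm (1 + s, y)) ((1 + p + q) / 2 + s)))"

definition Q :: "real \<Rightarrow> real \<Rightarrow> real" where
  "Q s y = 3 * p + q - P (1 - s) (1 - y)"

text \<open>Carries the geodesic through the cell: the first gradient has length \<beta> and
  vertical component \<sigma>, the quantity that Snell's law conserves across vertical edges. The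
  two terms of slope \<beta> are exchanged by the point reflection.\<close>

definition T :: "real \<Rightarrow> real \<Rightarrow> real" where
  "T s y = max (min (sqrt (1 - \<sigma>\<^sup>2) + sqrt (\<beta>\<^sup>2 - \<sigma>\<^sup>2) * s + \<sigma> * y) ((1 + p + q) / 2 + \<beta> * s))
     ((5 * p + q - 1) / 2 - \<beta> * (1 - s))"

text \<open>On the left edge \<open>T\<close> is below \<open>P\<close>; on the right edge
  \<open>Q\<close> is below \<open>T\<close> and above \<open>P\<close>; on the horizontal edges
  \<open>P\<close> and \<open>Q\<close> agree. Hence \<open>B\<close> has the trace of
  \<open>P\<close> on the left, of \<open>Q\<close> on the right, and their common trace above and
  below.\<close>

definition B :: "real \<Rightarrow> real \<Rightarrow> real" where
  "B s y = max (P s y) (min (Q s y) (T s y))"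

lemma \<beta>_bounds: "(6 / 5) \<le> \<beta>"
proof -
  have "((6 / 5)::real)\<^sup>2 \<le> \<beta>\<^sup>2" using \<beta>(2) by (simp add: power2_eq_square)
  then show ?thesis using \<beta>(1) by (metis less_imp_le power2_le_imp_le)
qed

lemma \<sigma>_sq: "(1 / 25) \<le> \<sigma>\<^sup>2" "\<sigma>\<^sup>2 \<le> (9 / 25)"
  using power_mono[of "(1 / 5)" \<sigma> 2] power_mono[of \<sigma> "(3 / 5)" 2] \<sigma> by (auto simp: power2_eq_square)

lemma A_lipschitz: "plane_lipschitz 1 A"
proof -
  have "plane_lipschitz 1 (\<lambda>x y. (p - (4 / 5)) + (4 / 5) * x + (3 / 5) * y)"
    by (rule plane_lipschitz_linear) (simp_all add: power2_eq_square)
  also have "(\<lambda>x y. (p - (4 / 5)) + (4 / 5) * x + (3 / 5) * y) = (\<lambda>x y. p - (4 / 5) * (1 - x) + (3 / 5) * y)"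
    by (intro ext) (simp add: field_simps)
  finally have "plane_lipschitz 1 (\<lambda>x y. p - (4 / 5) * (1 - x) + (3 / 5) * y)" .
  then have \<psi>: "plane_lipschitz 1 \<psi>"
    unfolding \<psi>_def by (intro plane_lipschitz_min_max plane_lipschitz_wedge)
  have \<phi>: "plane_lipschitz 1 \<phi>"
    unfolding \<phi>_def by (rule plane_lipschitz_reflect[OF \<psi>])
  have "plane_lipschitz 1 (\<lambda>x y. (p + q - 1) / 2 + 1 * x + 0 * y)"
    by (rule plane_lipschitz_linear) simp_all
  then have "plane_lipschitz 1 (\<lambda>x y. x + (p + q - 1) / 2)" by (simp add: algebra_simps)
  then show ?thesis unfolding A_def by (intro plane_lipschitz_min_max \<phi> \<psi>)
qed

lemma P_lipschitz: "plane_lipschitz \<beta> P"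
proof -
  \<comment> \<open>The bound 3/2 is attained by the gradient (1, 1/sqrt 2) of the piece that
    continues the top trace; the other affine pieces are flatter.\<close>
  have lin: "plane_lipschitz \<beta> (\<lambda>x y. d + a * x + b * y)" if "a\<^sup>2 + b\<^sup>2 \<le> 3 / 2" for a b d
    using that \<beta> by (intro plane_lipschitz_linear) auto
  have k2: "(sqrt 2 / 2)\<^sup>2 = (1 / 2 :: real)" by (simp add: power2_eq_square)
  have 1: "plane_lipschitz \<beta> (\<lambda>s y. min (p + q - sqrt 2 / 2 + 1 * s + sqrt 2 / 2 * y)
     (2 * p + q - (4 / 5) - sqrt 2 / 2 + (4 / 5) * s + sqrt 2 / 2 * y))"
    unfolding k2 by (intro plane_lipschitz_min_max lin) (simp_all only: k2, simp_all add: power2_eq_square)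
  have 2: "plane_lipschitz \<beta> (\<lambda>s y. max (2 * p - 1 + 1 * s + (3 / 5) * y) (p + (4 / 5) * s + (3 / 5) * y))"
    by (intro plane_lipschitz_min_max lin) (simp_all add: power2_eq_square)
  have 3: "plane_lipschitz \<beta> (\<lambda>s y. (1 + p + q) / 2 + 1 * s + 0 * y)"
    by (intro lin) simp
  have 4: "plane_lipschitz \<beta> (\<lambda>s y. norm (1 + s, y))"
    using \<beta>_bounds by (intro plane_lipschitz_mono[OF plane_lipschitz_norm_shift]) simp
  have eq: "P = (\<lambda>s y. max (min (p + q - sqrt 2 / 2 + 1 * s + sqrt 2 / 2 * y)
     (2 * p + q - (4 / 5) - sqrt 2 / 2 + (4 / 5) * s + sqrt 2 / 2 * y))
     (min (max (2 * p - 1 + 1 * s + (3 / 5) * y) (p + (4 / 5) * s + (3 / 5) * y))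
       (min (norm (1 + s, y)) ((1 + p + q) / 2 + 1 * s + 0 * y))))"
  proof (intro ext)
    fix s y
    have "p + q + min s (p - (4 / 5) * (1 - s)) - sqrt 2 / 2 * (1 - y) =
      min (p + q - sqrt 2 / 2 + 1 * s + sqrt 2 / 2 * y) (2 * p + q - (4 / 5) - sqrt 2 / 2 + (4 / 5) * s + sqrt 2 / 2 * y)"
      unfolding right_diff_distrib by (simp add: min_def)
    moreover have "max (2 * p - 1 + s) (p + (4 / 5) * s) + (3 / 5) * y =
       max (2 * p - 1 + 1 * s + (3 / 5) * y) (p + (4 / 5) * s + (3 / 5) * y)" by (simp add: max_def)
    ultimately show "P s y = max (min (p + q - sqrt 2 / 2 + 1 * s + sqrt 2 / 2 * y)
     (2 * p + q - (4 / 5) - sqrt 2 / 2 + (4 / 5) * s + sqrt 2 / 2 * y))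
     (min (max (2 * p - 1 + 1 * s + (3 / 5) * y) (p + (4 / 5) * s + (3 / 5) * y))
       (min (norm (1 + s, y)) ((1 + p + q) / 2 + 1 * s + 0 * y)))" unfolding P_def by simp
  qed
  show ?thesis unfolding eq by (intro plane_lipschitz_min_max 1 2 3 4)
qed

lemma B_lipschitz: "plane_lipschitz \<beta> B"
proof -
  have Q: "plane_lipschitz \<beta> Q" unfolding Q_def by (rule plane_lipschitz_reflect[OF P_lipschitz])
  have "plane_lipschitz \<beta> (\<lambda>s y. sqrt (1 - \<sigma>\<^sup>2) + sqrt (\<beta>\<^sup>2 - \<sigma>\<^sup>2) * s + \<sigma> * y)"
    using \<sigma>_sq \<beta> by (intro plane_lipschitz_linear) auto
  moreover have "plane_lipschitz \<beta> (\<lambda>s y. (1 + p + q) / 2 + \<beta> * s + 0 * y)"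
    using \<beta> by (intro plane_lipschitz_linear) auto
  then have "plane_lipschitz \<beta> (\<lambda>s y. (1 + p + q) / 2 + \<beta> * s)" by simp
  moreover have "plane_lipschitz \<beta> (\<lambda>s y. ((5 * p + q - 1) / 2 - \<beta>) + \<beta> * s + 0 * y)"
    using \<beta> by (intro plane_lipschitz_linear) auto
  then have "plane_lipschitz \<beta> (\<lambda>s y. (5 * p + q - 1) / 2 - \<beta> * (1 - s))" by (simp add: algebra_simps)
  ultimately have "plane_lipschitz \<beta> T" unfolding T_def by (intro plane_lipschitz_min_max)
  then show ?thesis unfolding B_def by (intro plane_lipschitz_min_max P_lipschitz Q)
qed

section \<open>Traces on the edges and their matching\<close>

lemma sqrt2_half_mult_bounds:
  assumes "0 \<le> w"
  shows "(707 / 1000) * w \<le> sqrt 2 / 2 * w" "sqrt 2 / 2 * w \<le> (70711 / 100000) * w"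
  using sqrt2_bounds assms by (intro mult_right_mono; simp)+

lemma \<psi>_0: assumes "0 \<le> y" "y \<le> 1" shows "\<psi> 0 y = sqrt 2 / 2 * y"
proof -
  have "sqrt 2 / 2 * y \<le> p - (4 / 5) * (1 - 0) + (3 / 5) * y" using sqrt2_half_mult_bounds(2)[OF assms(1)] assms p by argo
  moreover have "wedge 0 y = sqrt 2 / 2 * y" using assms by (subst wedge_above_diagonal) auto
  ultimately show ?thesis unfolding \<psi>_def by simp
qed

lemma \<psi>_1: assumes "0 \<le> y" "y \<le> 1" shows "\<psi> 1 y = min (sqrt (1 + y\<^sup>2)) (p + (3 / 5) * y)"
  using assms unfolding \<psi>_def by (subst wedge_below_diagonal) auto

lemma \<psi>_bottom: assumes "0 \<le> s" "s \<le> 1" shows "\<psi> s 0 = min s (p - (4 / 5) * (1 - s))"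
  using assms unfolding \<psi>_def by (subst wedge_below_diagonal) auto

lemma \<psi>_top: assumes "0 \<le> s" "s \<le> 1" shows "\<psi> s 1 = min (sqrt 2 / 2 * (s + 1)) (p - (4 / 5) * (1 - s) + (3 / 5))"
  using assms unfolding \<psi>_def by (subst wedge_above_diagonal) auto

lemma P_left: "P 0 y = max (p + q - sqrt 2 / 2 * (1 - y)) (min (p + (3 / 5) * y) (min (sqrt (1 + y\<^sup>2)) ((1 + p + q) / 2)))"
proof -
  have "min 0 (p - (4 / 5) * (1 - 0)) = 0" "max (2 * p - 1 + 0) (p + (4 / 5) * 0) = p" using p by auto
  then show ?thesis by (simp add: P_def norm_Pair)
qed

lemma A_right: assumes "0 \<le> y" "y \<le> 1" shows "A 1 y = P 0 y"
proof -
  have "\<phi> 1 y = p + q - sqrt 2 / 2 * (1 - y)" using assms by (simp add: \<phi>_def \<psi>_0)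
  moreover have "1 + (p + q - 1) / 2 = (1 + p + q) / 2" by (simp add: field_simps)
  ultimately show ?thesis using assms unfolding A_def P_left \<psi>_1[OF assms] by (simp only: min.assoc min.left_commute)
qed

text \<open>By Cauchy-Schwarz the affine piece lies below the distance to the corner (0, 0), with
  equality where (1, y) is parallel to (\<open>sqrt (1 - \<sigma>\<^sup>2)\<close>, \<sigma>). The
  remaining comparisons are numerical.\<close>

lemma T_left_le: assumes "0 \<le> y" "y \<le> 1" shows "T 0 y \<le> P 0 y"
proof -
  have s: "sqrt (1 - \<sigma>\<^sup>2) \<le> (49 / 50)"
    using \<sigma>_sq by (intro real_le_lsqrt) (auto simp: power2_eq_square)
  have "(sqrt (1 - \<sigma>\<^sup>2), \<sigma>) \<bullet> (1, y) \<le> norm (sqrt (1 - \<sigma>\<^sup>2), \<sigma>) * norm (1 :: real, y)"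
    by (rule norm_cauchy_schwarz)
  also have "norm (sqrt (1 - \<sigma>\<^sup>2), \<sigma>) = 1" using \<sigma>_sq by (simp add: norm_Pair)
  finally have cs: "sqrt (1 - \<sigma>\<^sup>2) + \<sigma> * y \<le> sqrt (1 + y\<^sup>2)" by (simp add: norm_Pair)
  have \<sigma>y: "\<sigma> * y \<le> (3 / 5) * y" using \<sigma> assms by (intro mult_right_mono) auto
  have "p \<le> sqrt (1 + y\<^sup>2)" by (rule order.trans[OF p(2)]) simp
  then have "p \<le> min (p + (3 / 5) * y) (min (sqrt (1 + y\<^sup>2)) ((1 + p + q) / 2))"
    using p q assms by auto
  moreover have "(5 * p + q - 1) / 2 - \<beta> \<le> p" using \<beta>(3) by (simp add: field_simps)
  ultimately have "(5 * p + q - 1) / 2 - \<beta> \<le> P 0 y" unfolding P_left by linarith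
  moreover have "min (sqrt (1 - \<sigma>\<^sup>2) + \<sigma> * y) ((1 + p + q) / 2) \<le> P 0 y"
    unfolding P_left using cs s \<sigma>y p by linarith
  ultimately show ?thesis by (simp add: T_def)
qed

lemma B_left: assumes "0 \<le> y" "y \<le> 1" shows "B 0 y = A 1 y"
  using T_left_le[OF assms] unfolding A_right[OF assms] B_def by auto

text \<open>Here \<open>\<phi>\<close> lies below \<open>\<psi>\<close>, so \<open>A\<close> is the
  median of \<open>\<phi>\<close>, \<open>\<psi>\<close> and the self-reflected middle term. A
  median is compatible with the point reflection, which sends height y on the left edge to height 1
  - y on the right edge.\<close>

lemma A_left: assumes "0 \<le> y" "y \<le> 1" shows "A 0 y = p + q - A 1 (1 - y)"
proof -
  have k: "sqrt 2 / 2 * y + sqrt 2 / 2 * (2 - y) = sqrt 2" by (simp add: field_simps)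
  have "sqrt 2 / 2 * (2 - y) = wedge (1 - y) 1" using assms by (subst wedge_above_diagonal) auto
  have "(sqrt 2 / 2 * (1 + (1 - y)))\<^sup>2 \<le> 1 + (1 - y)\<^sup>2"
    using zero_le_power2[of y] unfolding power_mult_distrib
    by (simp add: power_divide) (simp add: power2_eq_square field_simps)
  then have "sqrt 2 / 2 * (2 - y) \<le> sqrt (1 + (1 - y)\<^sup>2)" using assms by (intro real_le_rsqrt) simp
  then have "p + q \<le> sqrt 2 / 2 * y + min (sqrt (1 + (1 - y)\<^sup>2)) (p + (3 / 5) * (1 - y))"
    using k pq q sqrt2_half_mult_bounds[OF assms(1)] assms by argo
  then have "\<phi> 0 y \<le> \<psi> 0 y" using assms by (simp add: \<phi>_def \<psi>_0 \<psi>_1)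
  moreover have "\<phi> 1 (1 - y) = p + q - \<psi> 0 y" "\<phi> 0 y = p + q - \<psi> 1 (1 - y)" by (simp_all add: \<phi>_def)
  ultimately show ?thesis unfolding A_def by (auto simp: min_def max_def field_simps)
qed

text \<open>The point reflection of the left-edge estimate. By \<open>snell\<close> the affine piece
  of \<open>T\<close> is self-reflected; the reflected \<open>T\<close> has \<open>min\<close> and
  \<open>max\<close> in the other order and therefore lies below \<open>T\<close>.\<close>

lemma Q_right_le_T: assumes "0 \<le> y" "y \<le> 1" shows "Q 1 y \<le> T 1 y"
proof -
  have "T 0 (1 - y) \<le> P 0 (1 - y)" using assms by (intro T_left_le) auto
  moreover have "3 * p + q - T 0 (1 - y) \<le> T 1 y"
    using snell unfolding T_def by (auto simp: min_def max_def algebra_simps field_simps)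
  ultimately show ?thesis unfolding Q_def by simp
qed

text \<open>Reflected, this is \<open>P 1 y + P 0 (1 - y) \<le> 3 * p + q\<close>, a comparison of
  the arguments of two maxima. Only the pair of inner minima is delicate.\<close>

lemma P_right_le_Q: assumes "0 \<le> y" "y \<le> 1" shows "P 1 y \<le> Q 1 y"
proof -
  define w where "w = 1 - y"
  have w: "0 \<le> w" "w \<le> 1" "y + w = 1" using assms by (auto simp: w_def)
  have ky: "(707 / 1000) * y \<le> sqrt 2 / 2 * y" "sqrt 2 / 2 * y \<le> (70711 / 100000) * y" and
    kw: "(707 / 1000) * w \<le> sqrt 2 / 2 * w" "sqrt 2 / 2 * w \<le> (70711 / 100000) * w"
    using sqrt2_half_mult_bounds assms w by auto
  have P1: "P 1 y = max (2 * p + q - sqrt 2 / 2 * w) (min (2 * p + (3 / 5) * y) (min (sqrt (4 + y\<^sup>2)) ((3 + p + q) / 2)))"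
    using p by (simp add: P_def w_def norm_Pair min_def max_def field_simps)
  have P0: "P 0 w = max (p + q - sqrt 2 / 2 * y) (min (p + (3 / 5) * w) (min (sqrt (1 + w\<^sup>2)) ((1 + p + q) / 2)))"
    unfolding P_left w_def by simp
  have "min (2 * p + (3 / 5) * y) (min (sqrt (4 + y\<^sup>2)) ((3 + p + q) / 2)) +
      min (p + (3 / 5) * w) (min (sqrt (1 + w\<^sup>2)) ((1 + p + q) / 2)) \<le> 3 * p + q" (is "?S1 + ?S2 \<le> _")
  proof -
    \<comment> \<open>Near the corners the affine pieces suffice; 3/10 is exact for p = 49/50, q =
      19/50. In between the two norms have to be used.\<close>
    consider "y \<le> (3 / 10)" | "w \<le> (13 / 50)" | "(3 / 10) \<le> y" "y \<le> (3 / 4)" "w \<le> (7 / 10)" "(1 / 4) \<le> w" using w by linarith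
    then show ?thesis
    proof cases
      case 1
      have "?S1 \<le> 2 * p + (3 / 5) * y" "?S2 \<le> (1 + p + q) / 2" by argo+
      then show ?thesis using 1 p q by argo
    next
      case 2
      have "?S1 \<le> (3 + p + q) / 2" "?S2 \<le> p + (3 / 5) * w" by argo+
      then show ?thesis using 2 p q by argo
    next
      case 3
      have "sqrt (4 + y\<^sup>2) \<le> 2 + y\<^sup>2 / 4"
      proof (rule real_le_lsqrt)
        have "0 \<le> (y\<^sup>2 / 4)\<^sup>2" by simp
        then show "4 + y\<^sup>2 \<le> (2 + y\<^sup>2 / 4)\<^sup>2" by (simp add: power2_sum)
      qed simp
      moreover have "sqrt (1 + w\<^sup>2) \<le> 1 + w\<^sup>2 / 2"
      proof (rule real_le_lsqrt)
        have "0 \<le> (w\<^sup>2 / 2)\<^sup>2" by simp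
        then show "1 + w\<^sup>2 \<le> (1 + w\<^sup>2 / 2)\<^sup>2" by (simp add: power2_sum)
      qed simp
      \<comment> \<open>On these intervals a square lies below its secant through the end points,
        which makes the estimate linear.\<close>
      moreover have "0 \<le> (y - 3 / 10) * (3 / 4 - y)" "0 \<le> (w - 1 / 4) * (7 / 10 - w)"
        using 3 by (intro mult_nonneg_nonneg; simp)+
      moreover have "(y - 3 / 10) * (3 / 4 - y) = 21 / 20 * y - 9 / 40 - y\<^sup>2"
        "(w - 1 / 4) * (7 / 10 - w) = 19 / 20 * w - 7 / 40 - w\<^sup>2"
        by (simp_all add: power2_eq_square field_simps)
      moreover have "?S1 \<le> sqrt (4 + y\<^sup>2)" "?S2 \<le> sqrt (1 + w\<^sup>2)" by auto
      ultimately show ?thesis using 3 w p q by linarith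
    qed
  qed
  moreover have "?S1 \<le> 2 * p + (3 / 5) * y" "?S2 \<le> p + (3 / 5) * w" by auto
  moreover have "sqrt 2 / 2 * w + sqrt 2 / 2 * y = sqrt 2 / 2" using w(3) by (simp flip: distrib_left add: add.commute)
  ultimately have "P 1 y + P 0 w \<le> 3 * p + q"
    unfolding P1 P0 using ky kw p q w sqrt2_bounds assms by linarith
  then show ?thesis by (simp add: Q_def w_def)
qed

text \<open>The right edge borders the cell with corner (2, 0), where \<open>W\<close> is
  \<open>A\<close> shifted by 2 p. The shifts p - q and p + q on the bottom and top edges arise in
  the same way from the corners (1, -1) and (1, 1).\<close>

lemma B_right: assumes "0 \<le> y" "y \<le> 1" shows "B 1 y = A 0 y + 2 * p"
proof -
  have "B 1 y = Q 1 y" using P_right_le_Q[OF assms] Q_right_le_T[OF assms] by (auto simp: B_def)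
  then show ?thesis using A_left[OF assms] A_right[of "1 - y"] assms by (simp add: Q_def)
qed

lemma A_top: assumes "0 \<le> s" "s \<le> 1" shows "A s 1 = max (p + q - 1 + s) (q + (4 / 5) * s)"
proof -
  have "\<phi> s 1 = max (p + q - 1 + s) (q + (4 / 5) * s)"
    using assms by (simp add: \<phi>_def \<psi>_bottom min_def max_def field_simps)
  moreover have "min (\<psi> s 1) (s + (p + q - 1) / 2) \<le> max (p + q - 1 + s) (q + (4 / 5) * s)"
    using p q by argo
  ultimately show ?thesis by (simp add: A_def)
qed

lemma P_bottom: assumes "0 \<le> s" "s \<le> 1" shows "P s 0 = max (2 * p - 1 + s) (p + (4 / 5) * s)"
proof -
  have "min (max (2 * p - 1 + s) (p + (4 / 5) * s)) (min (1 + s) ((1 + p + q) / 2 + s)) = max (2 * p - 1 + s) (p + (4 / 5) * s)"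
    using p q assms by (simp add: min_def max_def field_simps)
  moreover have "p + q + min s (p - (4 / 5) * (1 - s)) - sqrt 2 / 2 \<le> max (2 * p - 1 + s) (p + (4 / 5) * s)"
    using p q sqrt2_bounds assms by (simp add: min_def max_def field_simps)
  ultimately show ?thesis using assms by (simp add: P_def)
qed

lemma P_top: assumes "0 \<le> s" "s \<le> 1" shows "P s 1 = p + q + min s (p - (4 / 5) * (1 - s))"
proof -
  have "(1 + p + q) / 2 + s \<le> p + q + min s (p - (4 / 5) * (1 - s))"
    using p q assms by (simp add: min_def field_simps)
  then show ?thesis unfolding P_def by simp
qed

lemma Q_bottom: assumes "0 \<le> s" "s \<le> 1" shows "Q s 0 = P s 0"
  using assms p by (simp add: Q_def P_top P_bottom min_def max_def field_simps)

lemma Q_top: assumes "0 \<le> s" "s \<le> 1" shows "Q s 1 = P s 1"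
  using Q_bottom[of "1 - s"] assms by (simp add: Q_def)

lemma B_bottom: assumes "0 \<le> s" "s \<le> 1" shows "B s 0 = A s 1 + p - q"
proof -
  have "B s 0 = P s 0" using Q_bottom[OF assms] by (simp add: B_def)
  then show ?thesis using assms by (simp add: A_top P_bottom max_def)
qed

lemma A_bottom: assumes "0 \<le> s" "s \<le> 1" shows "A s 0 = min s (p - (4 / 5) * (1 - s))"
proof -
  have "\<phi> s 0 = p + q - min (sqrt 2 / 2 * (2 - s)) (p - (4 / 5) * s + (3 / 5))"
    using assms by (simp add: \<phi>_def \<psi>_top)
  moreover have "sqrt 2 / 2 * (2 - s) = sqrt 2 - sqrt 2 / 2 * s" by (simp add: field_simps)
  ultimately have "\<phi> s 0 \<le> min s (p - (4 / 5) * (1 - s))"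
    using p q pq sqrt2_bounds sqrt2_half_mult_bounds[OF assms(1)] assms by argo
  moreover have "min s (p - (4 / 5) * (1 - s)) \<le> s + (p + q - 1) / 2" using p q by argo
  ultimately show ?thesis using assms by (simp add: A_def \<psi>_bottom)
qed

lemma B_top: assumes "0 \<le> s" "s \<le> 1" shows "B s 1 = A s 0 + p + q"
proof -
  have "B s 1 = P s 1" using Q_top[OF assms] by (simp add: B_def)
  then show ?thesis using assms by (simp add: A_bottom P_top)
qed

end

section \<open>Gluing the cells to a calibration\<close>

lemma near_unit_interval:
  fixes y :: real
  shows "\<exists>r. 0 < r \<and> (\<forall>y'. \<bar>y' - y\<bar> < r \<longrightarrow> (\<exists>j::int. of_int j \<le> y \<and> y \<le> of_int j + 1 \<and> of_int j \<le> y' \<and> y' \<le> of_int j + 1))"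
proof -
  \<comment> \<open>Around an integer the shared interval depends on the side of y'; away from the
    integers the radius keeps y' in the interval of y.\<close>
  define r where "r = (if y \<in> \<int> then 1 else min (y - of_int \<lfloor>y\<rfloor>) (of_int \<lfloor>y\<rfloor> + 1 - y))"
  have fl: "of_int \<lfloor>y\<rfloor> \<le> y" "y < of_int \<lfloor>y\<rfloor> + 1" by linarith+
  have "of_int \<lfloor>y\<rfloor> < y" if "y \<notin> \<int>" using that fl(1) by (metis Ints_of_int le_less)
  then have "0 < r" "r \<le> 1" using fl by (auto simp: r_def simp del: of_int_floor_le)
  moreover have "\<exists>j::int. of_int j \<le> y \<and> y \<le> of_int j + 1 \<and> of_int j \<le> y' \<and> y' \<le> of_int j + 1"
    if "\<bar>y' - y\<bar> < r" for y'
  proof (cases "y \<in> \<int>")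
    case True
    then have "r = 1" "of_int \<lfloor>y\<rfloor> = y" by (auto simp: r_def)
    then show ?thesis
      using that by (cases "y \<le> y'") (auto intro: exI[of _ "\<lfloor>y\<rfloor>"] exI[of _ "\<lfloor>y\<rfloor> - 1"])
  next
    case False
    then show ?thesis
      using that fl by (intro exI[of _ "\<lfloor>y\<rfloor>"]) (auto simp: r_def)
  qed
  ultimately show ?thesis by (intro exI[of _ r]) blast
qed

lemma chess_odd_cell:
  assumes "x \<notin> \<int>" "y \<notin> \<int>" "odd (\<lfloor>x\<rfloor> + \<lfloor>y\<rfloor>)"
  shows "chess \<beta> (x, y) = \<beta>"
proof -
  have fl: "of_int \<lfloor>t\<rfloor> < t \<and> t < of_int \<lfloor>t\<rfloor> + 1" if "t \<notin> \<int>" for t :: real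
  proof -
    have "of_int \<lfloor>t\<rfloor> \<noteq> t" using that by (metis Ints_of_int)
    then show ?thesis by linarith
  qed
  have div2: "\<lfloor>t / 2\<rfloor> = \<lfloor>t\<rfloor> div 2" for t :: real
    using floor_divide_real_eq_div[of 2 t] by simp
  have even: "of_int \<lfloor>t\<rfloor> - 2 * of_int \<lfloor>t / 2\<rfloor> = (0::real)" if "even \<lfloor>t\<rfloor>" for t :: real
    unfolding div2 using that by (metis cancel_comm_monoid_add_class.diff_cancel dvd_mult_div_cancel of_int_mult of_int_numeral)
  have odd: "of_int \<lfloor>t\<rfloor> - 2 * of_int \<lfloor>t / 2\<rfloor> = (1::real)" if "odd \<lfloor>t\<rfloor>" for t :: real
  proof -
    have "\<lfloor>t\<rfloor> = 2 * (\<lfloor>t\<rfloor> div 2) + 1" using that by simp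
    then have "real_of_int \<lfloor>t\<rfloor> = real_of_int (2 * (\<lfloor>t\<rfloor> div 2) + 1)" by (rule arg_cong)
    then show ?thesis unfolding div2 by simp
  qed
  define s where "s = x - 2 * of_int \<lfloor>x / 2\<rfloor>"
  define t where "t = y - 2 * of_int \<lfloor>y / 2\<rfloor>"
  have "(0 < s \<and> s < 1 \<and> 1 < t \<and> t < 2) \<or> (1 < s \<and> s < 2 \<and> 0 < t \<and> t < 1)"
  proof (cases "even \<lfloor>x\<rfloor>")
    case True
    then have "odd \<lfloor>y\<rfloor>" using assms(3) by simp
    from even[OF True] odd[OF this] fl[OF assms(1)] fl[OF assms(2)] show ?thesis
      unfolding s_def t_def by linarith
  next
    case False
    then have "even \<lfloor>y\<rfloor>" using assms(3) by simp
    from odd[OF False] even[OF this] fl[OF assms(1)] fl[OF assms(2)] show ?thesis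
      unfolding s_def t_def by linarith
  qed
  then show ?thesis by (simp add: chess_def Let_def s_def t_def)
qed

context cell_calibration
begin

text \<open>The summand \<open>i - 1\<close> appears because \<open>B\<close> lives on the cell with lower left corner \<open>(1, 0)\<close>.\<close>

definition V :: "int \<Rightarrow> int \<Rightarrow> real \<Rightarrow> real \<Rightarrow> real" where
  "V i j x y = (if even (i + j) then A (x - of_int i) (y - of_int j) + p * of_int i + q * of_int j
     else B (x - of_int i) (y - of_int j) + p * (of_int i - 1) + q * of_int j)"

definition W :: "real \<times> real \<Rightarrow> real" where
  "W z = V \<lfloor>fst z\<rfloor> \<lfloor>snd z\<rfloor> (fst z) (snd z)"

lemma V_right: assumes "of_int j \<le> y" "y \<le> of_int j + 1"
  shows "V (i + 1) j (of_int i + 1) y = V i j (of_int i + 1) y"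
  using B_left[of "y - of_int j"] B_right[of "y - of_int j"] assms
  by (auto simp: V_def algebra_simps)

lemma V_top: assumes "of_int i \<le> x" "x \<le> of_int i + 1"
  shows "V i (j + 1) x (of_int j + 1) = V i j x (of_int j + 1)"
  using B_bottom[of "x - of_int i"] B_top[of "x - of_int i"] assms
  by (auto simp: V_def algebra_simps)

text \<open>On the right or top edge of a closed cell the floor already selects the neighbouring
  cell; the matching relations bridge this.\<close>

lemma W_eq_V:
  assumes "of_int i \<le> x" "x \<le> of_int i + 1" "of_int j \<le> y" "y \<le> of_int j + 1"
  shows "W (x, y) = V i j x y"
proof -
  have floor: "\<lfloor>t\<rfloor> = k \<or> \<lfloor>t\<rfloor> = k + 1 \<and> t = of_int k + 1" if "of_int k \<le> t" "t \<le> of_int k + 1" for t :: real and k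
  proof (cases "t = of_int k + 1")
    case False
    then show ?thesis using that by (intro disjI1 floor_unique) auto
  qed simp
  have 1: "V \<lfloor>x\<rfloor> j x y = V i j x y"
    using floor[OF assms(1,2)] V_right[OF assms(3,4), of i] by auto
  have "V \<lfloor>x\<rfloor> \<lfloor>y\<rfloor> x y = V \<lfloor>x\<rfloor> j x y"
    using floor[OF assms(3,4)] V_top[of "\<lfloor>x\<rfloor>" x j] by auto
  with 1 show ?thesis by (simp add: W_def)
qed

lemma V_lipschitz:
  "\<bar>V i j x' y' - V i j x y\<bar> \<le> (if even (i + j) then 1 else \<beta>) * norm (x' - x, y' - y)"
  using A_lipschitz[unfolded plane_lipschitz_def, rule_format, of "x' - of_int i" "y' - of_int j" "x - of_int i" "y - of_int j"]
    B_lipschitz[unfolded plane_lipschitz_def, rule_format, of "x' - of_int i" "y' - of_int j" "x - of_int i" "y - of_int j"]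
  by (simp add: V_def)

lemma W_lipschitz_cell:
  assumes "of_int i \<le> x" "x \<le> of_int i + 1" "of_int j \<le> y" "y \<le> of_int j + 1"
    "of_int i \<le> x'" "x' \<le> of_int i + 1" "of_int j \<le> y'" "y' \<le> of_int j + 1"
  shows "\<bar>W (x', y') - W (x, y)\<bar> \<le> (if even (i + j) then 1 else \<beta>) * norm (x' - x, y' - y)"
  using V_lipschitz[of i j x' y' x y] W_eq_V[OF assms(1-4)] W_eq_V[OF assms(5-8)] by simp

lemma W_lipschitz_cell':
  assumes "of_int i \<le> x" "x \<le> of_int i + 1" "of_int j \<le> y" "y \<le> of_int j + 1"
    "of_int i \<le> x'" "x' \<le> of_int i + 1" "of_int j \<le> y'" "y' \<le> of_int j + 1"
  shows "\<bar>W (x', y') - W (x, y)\<bar> \<le> \<beta> * norm (x' - x, y' - y)"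
  by (rule order.trans[OF W_lipschitz_cell[OF assms]]) (use \<beta>_bounds in \<open>intro mult_right_mono; simp\<close>)

text \<open>Every vertical edge borders a cell of weight 1 on one of its sides, and there
  \<open>W\<close> is 1-Lipschitz up to the boundary.\<close>

lemma W_vertical:
  assumes "of_int j \<le> y" "y \<le> of_int j + 1" "of_int j \<le> y'" "y' \<le> of_int j + 1"
  shows "\<bar>W (of_int i, y') - W (of_int i, y)\<bar> \<le> \<bar>y' - y\<bar>"
proof (cases "even (i + j)")
  case True
  then show ?thesis using W_lipschitz_cell[of i "of_int i" j y "of_int i" y'] assms by (simp add: norm_Pair)
next
  case False
  then have "even (i - 1 + j)" by simp
  then show ?thesis using W_lipschitz_cell[of "i - 1" "of_int i" j y "of_int i" y'] assms by (simp add: norm_Pair)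
qed

lemma W_horizontal:
  assumes "of_int i \<le> x" "x \<le> of_int i + 1" "of_int i \<le> x'" "x' \<le> of_int i + 1"
  shows "\<bar>W (x', of_int j) - W (x, of_int j)\<bar> \<le> \<bar>x' - x\<bar>"
proof (cases "even (i + j)")
  case True
  then show ?thesis using W_lipschitz_cell[of i x j "of_int j" x' "of_int j"] assms by (simp add: norm_Pair)
next
  case False
  then have "even (i + (j - 1))" by simp
  then show ?thesis using W_lipschitz_cell[of i x "j - 1" "of_int j" x' "of_int j"] assms by (simp add: norm_Pair)
qed

lemma calibration_W: "calibration \<beta> W"
  unfolding calibration_def
proof (intro allI)
  fix x y :: real
  from near_unit_interval[of x] obtain r1 where "0 < r1 \<and> (\<forall>x'. \<bar>x' - x\<bar> < r1 \<longrightarrow>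
      (\<exists>i::int. of_int i \<le> x \<and> x \<le> of_int i + 1 \<and> of_int i \<le> x' \<and> x' \<le> of_int i + 1))" ..
  note r1 = conjunct1[OF this] conjunct2[OF this, THEN spec, THEN mp]
  from near_unit_interval[of y] obtain r2 where "0 < r2 \<and> (\<forall>y'. \<bar>y' - y\<bar> < r2 \<longrightarrow>
      (\<exists>j::int. of_int j \<le> y \<and> y \<le> of_int j + 1 \<and> of_int j \<le> y' \<and> y' \<le> of_int j + 1))" ..
  note r2 = conjunct1[OF this] conjunct2[OF this, THEN spec, THEN mp]
  have unit: "k = \<lfloor>t\<rfloor>" if "t \<notin> \<int>" "of_int k \<le> t" "t \<le> of_int k + 1" for t :: real and k
  proof -
    have "t \<noteq> of_int k + 1" using that(1) by (metis Ints_of_int of_int_1 of_int_add)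
    then show ?thesis using that by (intro floor_unique[symmetric]) auto
  qed
  have "calibrated_step \<beta> W x y x' y'"
    if near: "\<bar>x' - x\<bar> < r1" "\<bar>y' - y\<bar> < r2" for x' y'
  proof -
    obtain i :: int where i: "of_int i \<le> x" "x \<le> of_int i + 1" "of_int i \<le> x'" "x' \<le> of_int i + 1"
      using r1(2)[OF near(1)] by blast
    obtain j :: int where j: "of_int j \<le> y" "y \<le> of_int j + 1" "of_int j \<le> y'" "y' \<le> of_int j + 1"
      using r2(2)[OF near(2)] by blast
    have "\<bar>W (x', y') - W (x, y)\<bar> \<le> chess \<beta> (x, y) * norm (x' - x, y' - y)" if "x \<notin> \<int>" "y \<notin> \<int>"
    proof -
      have "i = \<lfloor>x\<rfloor>" "j = \<lfloor>y\<rfloor>" using unit that i j by auto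
      then have "(if even (i + j) then 1 else \<beta>) \<le> chess \<beta> (x, y)"
        using chess_odd_cell[OF that, of \<beta>] chess_ge_1[of \<beta> "(x, y)"] \<beta>_bounds by auto
      then show ?thesis
        using W_lipschitz_cell[OF i(1,2) j(1,2) i(3,4) j(3,4)]
        by (meson mult_right_mono norm_ge_zero order.trans)
    qed
    moreover have "\<bar>W (x', y') - W (x, y)\<bar> \<le> \<beta> * \<bar>x' - x\<bar> + \<bar>y' - y\<bar>" if "x \<in> \<int>"
    proof -
      from that obtain k :: int where k: "x = of_int k" by (rule Ints_cases)
      \<comment> \<open>The step is split at (x, y'): one leg crosses the cell, the other runs along
        the grid line.\<close>
      have "\<bar>W (x', y') - W (x, y')\<bar> \<le> \<beta> * norm (x' - x, y' - y')"
        by (rule W_lipschitz_cell'[OF i(1,2) j(3,4) i(3,4) j(3,4)])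
      moreover have "\<bar>W (x, y') - W (x, y)\<bar> \<le> \<bar>y' - y\<bar>" unfolding k by (rule W_vertical[OF j])
      ultimately show ?thesis by (simp add: norm_Pair)
    qed
    moreover have "\<bar>W (x', y') - W (x, y)\<bar> \<le> \<bar>x' - x\<bar> + \<beta> * \<bar>y' - y\<bar>" if "y \<in> \<int>"
    proof -
      from that obtain k :: int where k: "y = of_int k" by (rule Ints_cases)
      have "\<bar>W (x', y') - W (x', y)\<bar> \<le> \<beta> * norm (x' - x', y' - y)"
        by (rule W_lipschitz_cell'[OF i(3,4) j(1,2) i(3,4) j(3,4)])
      moreover have "\<bar>W (x', y) - W (x, y)\<bar> \<le> \<bar>x' - x\<bar>" unfolding k by (rule W_horizontal[OF i])
      ultimately show ?thesis by (simp add: norm_Pair)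
    qed
    ultimately show ?thesis unfolding calibrated_step_def by blast
  qed
  then show "\<exists>r>0. \<forall>x' y'. \<bar>x' - x\<bar> < r \<and> \<bar>y' - y\<bar> < r \<longrightarrow> calibrated_step \<beta> W x y x' y'"
    using r1(1) r2(1) by (intro exI[of _ "min r1 r2"]) simp
qed

text \<open>Once p i + q j is subtracted, only the bounded oscillation of \<open>A\<close> and
  \<open>B\<close> over a unit cell remains.\<close>

lemma W_ge_linear: "\<exists>C. \<forall>x y. p * x + q * y - C \<le> W (x, y)"
proof -
  have "p * x + q * y - (p + q + \<bar>A 0 0\<bar> + \<bar>B 0 0 - p\<bar> + 2 * (1 + \<beta>)) \<le> W (x, y)" for x y
  proof -
    define i j where "i = \<lfloor>x\<rfloor>" and "j = \<lfloor>y\<rfloor>"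
    define a b where "a = x - of_int i" and "b = y - of_int j"
    have ab: "0 \<le> a" "a \<le> 1" "0 \<le> b" "b \<le> 1" unfolding a_def b_def i_def j_def by linarith+
    have n: "norm (a - 0, b - 0) \<le> 2" using norm_Pair_le[of a b] ab by simp
    have "\<bar>A a b - A 0 0\<bar> \<le> 1 * norm (a - 0, b - 0)"
      using A_lipschitz unfolding plane_lipschitz_def by blast
    then have A: "\<bar>A a b - A 0 0\<bar> \<le> 2" using n by linarith
    have "\<bar>B a b - B 0 0\<bar> \<le> \<beta> * norm (a - 0, b - 0)"
      using B_lipschitz unfolding plane_lipschitz_def by blast
    also have "\<dots> \<le> \<beta> * 2" using n \<beta> by (intro mult_left_mono) auto
    finally have B: "\<bar>B a b - B 0 0\<bar> \<le> \<beta> * 2" .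
    have "p * a \<le> p * 1" "q * b \<le> q * 1" using ab p q by (intro mult_left_mono; simp)+
    moreover have "x = of_int i + a" "y = of_int j + b" by (simp_all add: a_def b_def)
    then have "p * x + q * y = p * of_int i + q * of_int j + p * a + q * b" by (simp add: algebra_simps)
    moreover have "W (x, y) = (if even (i + j) then A a b + p * of_int i + q * of_int j
     else B a b + p * (of_int i - 1) + q * of_int j)"
      by (simp add: W_def V_def i_def j_def a_def b_def)
    moreover have "p * (of_int i - 1) = p * of_int i - p" by (simp add: algebra_simps)
    ultimately show ?thesis using A B \<beta> by (auto split: if_splits)
  qed
  then show ?thesis by blast
qed

end

section \<open>Supporting slopes and their symmetries\<close>

definition supports :: "real \<Rightarrow> real \<Rightarrow> real \<Rightarrow> bool" where
  "supports \<beta> p q \<longleftrightarrow> (\<exists>W C. calibration \<beta> W \<and> (\<forall>x y. p * x + q * y - C \<le> W (x, y)))"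

lemma (in cell_calibration) supports_slope: "supports \<beta> p q"
  unfolding supports_def using calibration_W W_ge_linear by blast

text \<open>A larger weight relaxes every inequality of a calibration. This carries the slope found
  at \<open>beta_c0\<close> to all larger weights.\<close>

lemma supports_mono:
  assumes "supports \<beta> p q" "1 \<le> \<beta>" "\<beta> \<le> \<beta>'"
  shows "supports \<beta>' p q"
proof -
  have c: "chess \<beta> z \<le> chess \<beta>' z" for z using assms(2,3) by (simp add: chess_def Let_def)
  have le: "chess \<beta> (x, y) * norm z \<le> chess \<beta>' (x, y) * norm z" "\<beta> * \<bar>t\<bar> \<le> \<beta>' * \<bar>t\<bar>"
    for x y t :: real and z :: "real \<times> real"
    using c assms(3) by (intro mult_right_mono; simp)+
  have step: "calibrated_step \<beta>' W x y x' y'" if "calibrated_step \<beta> W x y x' y'" for W x y x' y'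
    using that le(1)[of x y "(x' - x, y' - y)"] le(2)[of "x' - x"] le(2)[of "y' - y"]
    unfolding calibrated_step_def by linarith
  have "calibration \<beta>' W" if W: "calibration \<beta> W" for W
    unfolding calibration_def
  proof (intro allI)
    fix x y
    obtain r where r: "r > 0"
      and *: "\<forall>x' y'. \<bar>x' - x\<bar> < r \<and> \<bar>y' - y\<bar> < r \<longrightarrow> calibrated_step \<beta> W x y x' y'"
      by (rule calibrationE[OF W])
    show "\<exists>r>0. \<forall>x' y'. \<bar>x' - x\<bar> < r \<and> \<bar>y' - y\<bar> < r \<longrightarrow> calibrated_step \<beta>' W x y x' y'"
      by (intro exI[of _ r] conjI[OF r] allI impI step *[THEN spec, THEN spec, THEN mp])
  qed
  with assms(1) show ?thesis unfolding supports_def by blast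
qed

lemma chess_swap: "chess \<beta> (y, x) = chess \<beta> (x, y)"
  by (auto simp: chess_def Let_def)

text \<open>The axis is x = 1/2: reflecting in x = 0 would exchange the two kinds of cells.\<close>

lemma chess_reflect: "chess \<beta> (1 - x, y) = chess \<beta> (x, y)"
proof (cases "x \<in> \<int>")
  case True
  then show ?thesis using chess_eq_1_on_lines[of x y] chess_eq_1_on_lines[of "1 - x" y] by simp
next
  case False
  define t where "t = x - 2 * of_int \<lfloor>x / 2\<rfloor>"
  have "t \<noteq> 0" "t \<noteq> 1"
    using False by (auto simp: t_def) (metis Ints_1 Ints_add Ints_mult Ints_numeral Ints_of_int diff_add_cancel)+
  moreover have "0 \<le> t" "t < 2" unfolding t_def by linarith+
  ultimately have t: "0 < t" "t < 2" "t \<noteq> 1" by auto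
  have x: "x = t + 2 * of_int \<lfloor>x / 2\<rfloor>" by (simp add: t_def)
  have "\<lfloor>(1 - x) / 2\<rfloor> = (if t < 1 then - \<lfloor>x / 2\<rfloor> else - \<lfloor>x / 2\<rfloor> - 1)"
    by (rule floor_unique; subst (1) x) (use t in \<open>auto simp: field_simps\<close>)
  then have "1 - x - 2 * of_int \<lfloor>(1 - x) / 2\<rfloor> = (if t < 1 then 1 - t else 3 - t)"
    using x by simp
  then show ?thesis using t by (auto simp: chess_def Let_def t_def[symmetric])
qed

lemma calibration_swap:
  assumes W: "calibration \<beta> W"
  shows "calibration \<beta> (\<lambda>z. W (snd z, fst z))"
  unfolding calibration_def
proof (intro allI)
  fix x y
  obtain r where r: "r > 0"
    and *: "\<forall>y' x'. \<bar>y' - y\<bar> < r \<and> \<bar>x' - x\<bar> < r \<longrightarrow> calibrated_step \<beta> W y x y' x'"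
    by (rule calibrationE[OF W])
  have n: "norm (a, b) = norm (b, a)" for a b :: real by (simp add: norm_Pair add.commute)
  have "calibrated_step \<beta> (\<lambda>z. W (snd z, fst z)) x y x' y'" if "calibrated_step \<beta> W y x y' x'" for x' y'
    using that unfolding calibrated_step_def chess_swap[of \<beta> y x] n[of "y' - y"] fst_conv snd_conv
    by (simp add: add.commute)
  with r * show "\<exists>r>0. \<forall>x' y'. \<bar>x' - x\<bar> < r \<and> \<bar>y' - y\<bar> < r \<longrightarrow>
      calibrated_step \<beta> (\<lambda>z. W (snd z, fst z)) x y x' y'"
    by (intro exI[of _ r]) simp
qed

lemma calibration_reflect:
  assumes W: "calibration \<beta> W"
  shows "calibration \<beta> (\<lambda>z. W (1 - fst z, snd z))"
  unfolding calibration_def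
proof (intro allI)
  fix x y
  obtain r where r: "r > 0"
    and *: "\<forall>x' y'. \<bar>x' - (1 - x)\<bar> < r \<and> \<bar>y' - y\<bar> < r \<longrightarrow> calibrated_step \<beta> W (1 - x) y x' y'"
    by (rule calibrationE[OF W])
  have int: "1 - x \<in> \<int> \<longleftrightarrow> x \<in> \<int>" by (metis Ints_1 Ints_diff diff_diff_eq2 add_diff_cancel_left')
  have step: "calibrated_step \<beta> (\<lambda>z. W (1 - fst z, snd z)) x y x' y'"
    if "calibrated_step \<beta> W (1 - x) y (1 - x') y'" for x' y'
  proof -
    have "norm ((1 - x') - (1 - x), y' - y) = norm (x' - x, y' - y)" "\<bar>(1 - x') - (1 - x)\<bar> = \<bar>x' - x\<bar>"
      by (simp_all add: norm_Pair power2_commute)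
    with that show ?thesis unfolding calibrated_step_def chess_reflect int fst_conv snd_conv by simp
  qed
  show "\<exists>r>0. \<forall>x' y'. \<bar>x' - x\<bar> < r \<and> \<bar>y' - y\<bar> < r \<longrightarrow>
      calibrated_step \<beta> (\<lambda>z. W (1 - fst z, snd z)) x y x' y'"
  proof (intro exI[of _ r] conjI[OF r] allI impI step *[THEN spec, THEN spec, THEN mp])
    fix x' y' assume "\<bar>x' - x\<bar> < r \<and> \<bar>y' - y\<bar> < r"
    then show "\<bar>(1 - x') - (1 - x)\<bar> < r \<and> \<bar>y' - y\<bar> < r" by linarith
  qed
qed

lemma supports_swap: "supports \<beta> p q \<Longrightarrow> supports \<beta> q p"
  unfolding supports_def
proof (elim exE conjE)
  fix W C assume W: "calibration \<beta> W" "\<forall>x y. p * x + q * y - C \<le> W (x, y)"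
  have "\<forall>x y. q * x + p * y - C \<le> W (snd (x, y), fst (x, y))"
    using W(2) by (simp add: add.commute)
  with calibration_swap[OF W(1)] show "\<exists>W C. calibration \<beta> W \<and> (\<forall>x y. q * x + p * y - C \<le> W (x, y))" by blast
qed

lemma supports_reflect: "supports \<beta> p q \<Longrightarrow> supports \<beta> (- p) q"
  unfolding supports_def
proof (elim exE conjE)
  fix W C assume W: "calibration \<beta> W" "\<forall>x y. p * x + q * y - C \<le> W (x, y)"
  have "- p * x + q * y - (C - p) \<le> W (1 - fst (x, y), snd (x, y))" for x y
    using W(2)[rule_format, of "1 - x" y] by (simp add: algebra_simps)
  with calibration_reflect[OF W(1)] show "\<exists>W C. calibration \<beta> W \<and> (\<forall>x y. - p * x + q * y - C \<le> W (x, y))" by blast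
qed

section \<open>Paths\<close>

text \<open>The parameter of a path is the cost accumulated so far; this makes concatenation additive.\<close>

definition travel :: "real \<Rightarrow> real \<times> real \<Rightarrow> real \<times> real \<Rightarrow> real \<Rightarrow> bool" where
  "travel \<beta> z w T \<longleftrightarrow> 0 \<le> T \<and> (\<exists>\<gamma> C N. \<gamma> 0 = z \<and> \<gamma> T = w \<and> countable N \<and>
     (\<forall>s t. norm (\<gamma> s - \<gamma> t) \<le> C * \<bar>s - t\<bar>) \<and>
     (\<forall>t. 0 < t \<and> t < T \<and> t \<notin> N \<longrightarrow>
        (\<exists>D. (\<gamma> has_vector_derivative D) (at t) \<and> chess \<beta> (\<gamma> t) * norm D \<le> 1)))"

lemma travelI:
  assumes "0 \<le> T" "\<gamma> 0 = z" "\<gamma> T = w" "countable N" "\<And>s t. norm (\<gamma> s - \<gamma> t) \<le> C * \<bar>s - t\<bar>"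
    "\<And>t. 0 < t \<Longrightarrow> t < T \<Longrightarrow> t \<notin> N \<Longrightarrow>
        \<exists>D. (\<gamma> has_vector_derivative D) (at t) \<and> chess \<beta> (\<gamma> t) * norm D \<le> 1"
  shows "travel \<beta> z w T"
  unfolding travel_def using assms by (intro conjI exI[of _ \<gamma>] exI[of _ C] exI[of _ N]) simp_all

lemma travelE:
  assumes "travel \<beta> z w T"
  obtains \<gamma> N C where "0 \<le> T" "\<gamma> 0 = z" "\<gamma> T = w" "countable N" "0 \<le> C"
    "\<forall>s t. norm (\<gamma> s - \<gamma> t) \<le> C * \<bar>s - t\<bar>"
    "\<forall>t. 0 < t \<longrightarrow> t < T \<longrightarrow> t \<notin> N \<longrightarrow>
        (\<exists>D. (\<gamma> has_vector_derivative D) (at t) \<and> chess \<beta> (\<gamma> t) * norm D \<le> 1)"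
proof -
  from assms obtain \<gamma> C N where *: "0 \<le> T" "\<gamma> 0 = z" "\<gamma> T = w" "countable N"
    "\<forall>s t. norm (\<gamma> s - \<gamma> t) \<le> C * \<bar>s - t\<bar>"
    "\<forall>t. 0 < t \<and> t < T \<and> t \<notin> N \<longrightarrow>
        (\<exists>D. (\<gamma> has_vector_derivative D) (at t) \<and> chess \<beta> (\<gamma> t) * norm D \<le> 1)"
    unfolding travel_def by (elim conjE exE)
  have "0 \<le> norm (\<gamma> 1 - \<gamma> 0)" by simp
  also have "\<dots> \<le> C * \<bar>1 - 0\<bar>" using *(5) by blast
  finally have "0 \<le> C" by simp
  show ?thesis
    by (rule that[of \<gamma> N C]) (use * \<open>0 \<le> C\<close> in simp_all)
qed

text \<open>Only an upper bound on the weighted speed is imposed, so standing still is allowed and a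
  cost can always be rounded up.\<close>

lemma travel_wait: "0 \<le> T \<Longrightarrow> travel \<beta> z z T"
proof (rule travelI[where \<gamma> = "\<lambda>_. z" and N = "{}" and C = 0])
  fix t
  show "\<exists>D. ((\<lambda>_. z) has_vector_derivative D) (at t) \<and> chess \<beta> z * norm D \<le> 1"
    using has_vector_derivative_const[of z] by (intro exI[of _ 0] conjI) simp_all
qed simp_all

lemma travel_trans:
  assumes "travel \<beta> x y S" "travel \<beta> y z T"
  shows "travel \<beta> x z (S + T)"
proof -
  obtain \<gamma> N C where obt: "0 \<le> S" "\<gamma> 0 = x" "\<gamma> S = y" "countable N" "0 \<le> C"
    "\<forall>s t. norm (\<gamma> s - \<gamma> t) \<le> C * \<bar>s - t\<bar>"
    "\<forall>t. 0 < t \<longrightarrow> t < S \<longrightarrow> t \<notin> N \<longrightarrow>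
        (\<exists>D. (\<gamma> has_vector_derivative D) (at t) \<and> chess \<beta> (\<gamma> t) * norm D \<le> 1)"
    using assms(1) by (rule travelE)
  note 1 = obt(1-5) obt(6)[rule_format] obt(7)[rule_format]
  obtain \<gamma>' N' C' where obt: "0 \<le> T" "\<gamma>' 0 = y" "\<gamma>' T = z" "countable N'" "0 \<le> C'"
    "\<forall>s t. norm (\<gamma>' s - \<gamma>' t) \<le> C' * \<bar>s - t\<bar>"
    "\<forall>t. 0 < t \<longrightarrow> t < T \<longrightarrow> t \<notin> N' \<longrightarrow>
        (\<exists>D. (\<gamma>' has_vector_derivative D) (at t) \<and> chess \<beta> (\<gamma>' t) * norm D \<le> 1)"
    using assms(2) by (rule travelE)
  note 2 = obt(1-5) obt(6)[rule_format] obt(7)[rule_format]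
  note obt1 = 1(6) and obt2 = 2(6)
  define \<delta> where "\<delta> t = (if t \<le> S then \<gamma> t else \<gamma>' (t - S))" for t
  have lip: "norm (\<delta> s - \<delta> t) \<le> (C + C') * \<bar>s - t\<bar>" if "s \<le> t" for s t
  proof -
    consider "t \<le> S" | "S < s" | "s \<le> S" "S < t" by linarith
    then show ?thesis
    proof cases
      case 1
      then have "norm (\<delta> s - \<delta> t) \<le> C * \<bar>s - t\<bar>" using that obt1[of s t] by (simp add: \<delta>_def)
      also have "\<dots> \<le> (C + C') * \<bar>s - t\<bar>" using 2(5) by (intro mult_right_mono) auto
      finally show ?thesis .
    next
      case 2
      then have "norm (\<delta> s - \<delta> t) \<le> C' * \<bar>s - t\<bar>"
        using that obt2[of "s - S" "t - S"] by (simp add: \<delta>_def)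
      also have "\<dots> \<le> (C + C') * \<bar>s - t\<bar>" using 1(5) by (intro mult_right_mono) auto
      finally show ?thesis .
    next
      case 3
      have "norm (\<delta> s - \<delta> t) = norm ((\<gamma> s - \<gamma> S) + (\<gamma>' 0 - \<gamma>' (t - S)))"
        using 3 1(3) 2(2) by (simp add: \<delta>_def)
      also have "\<dots> \<le> norm (\<gamma> s - \<gamma> S) + norm (\<gamma>' 0 - \<gamma>' (t - S))" by (rule norm_triangle_ineq)
      also have "\<dots> \<le> C * \<bar>s - S\<bar> + C' * \<bar>0 - (t - S)\<bar>" by (intro add_mono 1 2)
      also have "\<dots> \<le> C * \<bar>s - t\<bar> + C' * \<bar>s - t\<bar>"
        using 3 1(5) 2(5) by (intro add_mono mult_left_mono) auto
      finally show ?thesis by (simp add: algebra_simps)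
    qed
  qed
  show ?thesis
  proof (rule travelI[where \<gamma> = \<delta> and N = "N \<union> {S} \<union> (\<lambda>t. t + S) ` N'" and C = "C + C'"])
    show "0 \<le> S + T" "\<delta> 0 = x" using 1 2 by (simp_all add: \<delta>_def)
    show "\<delta> (S + T) = z" using 1 2 by (auto simp: \<delta>_def)
    show "countable (N \<union> {S} \<union> (\<lambda>t. t + S) ` N')" using 1 2 by simp
    show "norm (\<delta> s - \<delta> t) \<le> (C + C') * \<bar>s - t\<bar>" for s t
      using lip[of s t] lip[of t s] by (cases "s \<le> t") (auto simp: norm_minus_commute abs_minus_commute)
  next
    fix t assume t: "0 < t" "t < S + T" "t \<notin> N \<union> {S} \<union> (\<lambda>t. t + S) ` N'"
    show "\<exists>D. (\<delta> has_vector_derivative D) (at t) \<and> chess \<beta> (\<delta> t) * norm D \<le> 1"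
    proof (cases "t < S")
      case True
      then obtain D where D: "(\<gamma> has_vector_derivative D) (at t)" "chess \<beta> (\<gamma> t) * norm D \<le> 1"
        using 1(7)[of t] t by auto
      have "(\<delta> has_vector_derivative D) (at t)"
        by (rule has_vector_derivative_transform_within_open[OF D(1), of "{..<S}"]) (use True in \<open>auto simp: \<delta>_def\<close>)
      with D(2) True show ?thesis by (intro exI[of _ D]) (simp add: \<delta>_def)
    next
      case False
      with t have S: "S < t" by auto
      have "t - S \<notin> N'" using t(3) by (auto simp: image_iff)
      then obtain D where D: "(\<gamma>' has_vector_derivative D) (at (t - S))" "chess \<beta> (\<gamma>' (t - S)) * norm D \<le> 1"
        using 2(7)[of "t - S"] t S by auto
      have "((\<lambda>t. t - S) has_vector_derivative 1) (at t)"
        by (auto intro!: derivative_eq_intros)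
      from vector_diff_chain_at[OF this D(1)]
      have "((\<lambda>t. \<gamma>' (t - S)) has_vector_derivative D) (at t)" by (simp add: o_def)
      then have "(\<delta> has_vector_derivative D) (at t)"
        by (rule has_vector_derivative_transform_within_open[of _ _ _ "{S<..}"]) (use S in \<open>auto simp: \<delta>_def\<close>)
      with D(2) S show ?thesis by (intro exI[of _ D]) (simp add: \<delta>_def)
    qed
  qed
qed

lemma travel_mono: "travel \<beta> z w S \<Longrightarrow> S \<le> T \<Longrightarrow> travel \<beta> z w T"
  using travel_trans[OF _ travel_wait[of "T - S"]] by fastforce

lemma travel_segment:
  assumes c: "0 < c" and N: "countable N"
    and chess: "\<And>t. 0 < t \<Longrightarrow> t < 1 \<Longrightarrow> t \<notin> N \<Longrightarrow> chess \<beta> (z + t *\<^sub>R d) \<le> c"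
  shows "travel \<beta> z (z + d) (c * norm d)"
proof (cases "d = 0")
  case False
  define T where "T = c * norm d"
  have T: "0 < T" using False c by (simp add: T_def)
  define \<gamma> where "\<gamma> t = z + (t / T) *\<^sub>R d" for t
  show ?thesis unfolding T_def[symmetric]
  proof (rule travelI[where \<gamma> = \<gamma> and N = "(\<lambda>t. t * T) ` N" and C = "1 / c"])
    show "0 \<le> T" "\<gamma> 0 = z" "\<gamma> T = z + d" "countable ((\<lambda>t. t * T) ` N)" using T N by (simp_all add: \<gamma>_def)
    show "norm (\<gamma> s - \<gamma> t) \<le> 1 / c * \<bar>s - t\<bar>" for s t
    proof -
      have "\<gamma> s - \<gamma> t = ((s - t) / T) *\<^sub>R d" by (simp add: \<gamma>_def scaleR_left_diff_distrib diff_divide_distrib)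
      then show ?thesis using False c by (simp add: T_def abs_mult)
    qed
    fix t assume t: "0 < t" "t < T" "t \<notin> (\<lambda>t. t * T) ` N"
    have "t / T \<notin> N" using t(3) T by (metis image_eqI nonzero_eq_divide_eq less_irrefl)
    then have "chess \<beta> (\<gamma> t) \<le> c" using chess[of "t / T"] t T by (simp add: \<gamma>_def)
    then have "chess \<beta> (\<gamma> t) * norm ((1 / T) *\<^sub>R d) \<le> c * norm ((1 / T) *\<^sub>R d)" by (rule mult_right_mono) simp
    also have "\<dots> = 1" using False c by (simp add: T_def)
    finally have "chess \<beta> (\<gamma> t) * norm ((1 / T) *\<^sub>R d) \<le> 1" .
    moreover have "(\<gamma> has_vector_derivative (1 / T) *\<^sub>R d) (at t)"
      unfolding \<gamma>_def has_vector_derivative_def using T by (auto intro!: derivative_eq_intros)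
    ultimately show "\<exists>D. (\<gamma> has_vector_derivative D) (at t) \<and> chess \<beta> (\<gamma> t) * norm D \<le> 1" by blast
  qed
qed (simp add: travel_wait)

lemma travel_straight:
  assumes "1 \<le> \<beta>"
  shows "travel \<beta> z w (\<beta> * norm (w - z))"
  using travel_segment[of \<beta> "{}" \<beta> z "w - z"] assms chess_le by simp

lemma travel_horizontal:
  assumes "y \<in> \<int>"
  shows "travel \<beta> (x, y) (x', y) \<bar>x' - x\<bar>"
  using travel_segment[of 1 "{}" \<beta> "(x, y)" "(x' - x, 0)"] chess_eq_1_on_lines[of _ y] assms
  by (simp add: norm_Pair)

lemma chess_even_cell:
  assumes "even (\<lfloor>x\<rfloor> + \<lfloor>y\<rfloor>)"
  shows "chess \<beta> (x, y) = 1"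
proof -
  define s where "s = x - 2 * of_int \<lfloor>x / 2\<rfloor>"
  define t where "t = y - 2 * of_int \<lfloor>y / 2\<rfloor>"
  have parity: "\<lfloor>u - 2 * of_int k\<rfloor> = \<lfloor>u\<rfloor> - 2 * k" for u :: real and k
    by linarith
  have "even (\<lfloor>s\<rfloor> + \<lfloor>t\<rfloor>)" using assms unfolding s_def t_def parity by simp
  moreover have "\<lfloor>r\<rfloor> = 0" if "0 < r" "r < 1" for r :: real using that by linarith
  moreover have "\<lfloor>r\<rfloor> = 1" if "1 < r" "r < 2" for r :: real using that by linarith
  ultimately have "\<not> ((0 < s \<and> s < 1 \<and> 1 < t \<and> t < 2) \<or> (1 < s \<and> s < 2 \<and> 0 < t \<and> t < 1))" by auto
  then show ?thesis
    unfolding chess_def Let_def fst_conv snd_conv s_def[symmetric] t_def[symmetric] by (rule if_not_P)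
qed

lemma travel_diagonal: "0 \<le> s \<Longrightarrow> travel \<beta> (0, 0) (s, s) (sqrt 2 * s)"
  using travel_segment[of 1 "{}" \<beta> "(0, 0)" "(s, s)"] chess_even_cell[of "t * s" "t * s" \<beta> for t]
  by (simp add: norm_Pair real_sqrt_mult)

text \<open>Three straight pieces rising by a, b and a. The outer ones stay inside cells of weight
  1; the middle one is charged the factor \<beta> throughout.\<close>

lemma travel_knight:
  fixes i j :: int
  assumes \<beta>: "1 \<le> \<beta>" and even: "even (i + j)" and ab: "0 < a" "0 < b" "2 * a + b = 1"
  shows "travel \<beta> (of_int i, of_int j) (of_int i + 3, of_int j + 1) (2 * sqrt (1 + a\<^sup>2) + \<beta> * sqrt (1 + b\<^sup>2))"
proof -
  have white: "travel \<beta> (of_int k, of_int j + y) (of_int k + 1, of_int j + y + a) (sqrt (1 + a\<^sup>2))"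
    if "even (k + j)" "0 \<le> y" "y + a \<le> 1" for k :: int and y
  proof -
    have "chess \<beta> ((of_int k, of_int j + y) + t *\<^sub>R (1, a)) \<le> 1" if t: "0 < t" "t < 1" for t
    proof -
      have "t * a < 1 * a" using t ab by (intro mult_strict_right_mono) auto
      moreover have "0 < t * a" using t ab by simp
      ultimately have "\<lfloor>of_int j + y + t * a\<rfloor> = j" using \<open>0 \<le> y\<close> \<open>y + a \<le> 1\<close> by (intro floor_unique) auto
      moreover have "\<lfloor>of_int k + t\<rfloor> = k" using t by (intro floor_unique) auto
      ultimately show ?thesis using chess_even_cell[of "of_int k + t" "of_int j + y + t * a" \<beta>] \<open>even (k + j)\<close> by simp
    qed
    from travel_segment[of 1 "{}" \<beta> "(of_int k, of_int j + y)" "(1, a)", OF _ _ this]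
    show ?thesis by (simp add: norm_Pair)
  qed
  have 1: "travel \<beta> (of_int i, of_int j) (of_int i + 1, of_int j + a) (sqrt (1 + a\<^sup>2))"
    using white[of i 0] even ab by simp
  have 2: "travel \<beta> (of_int i + 1, of_int j + a) (of_int i + 2, of_int j + a + b) (\<beta> * sqrt (1 + b\<^sup>2))"
    using travel_straight[OF \<beta>, of "(of_int i + 1, of_int j + a)" "(of_int i + 2, of_int j + a + b)"]
    by (simp add: norm_Pair)
  have "of_int j + (a + b) + a = of_int j + (1 :: real)" using ab(3) by simp
  then have 3: "travel \<beta> (of_int i + 2, of_int j + a + b) (of_int i + 3, of_int j + 1) (sqrt (1 + a\<^sup>2))"
    using white[of "i + 2" "a + b"] even ab by (simp add: add.assoc)
  from travel_trans[OF travel_trans[OF 1 2] 3] show ?thesis by (simp add: algebra_simps)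
qed

lemma travel_knights:
  fixes l k :: nat
  assumes knight: "\<And>i j :: int. even (i + j) \<Longrightarrow> travel \<beta> (of_int i, of_int j) (of_int i + 3, of_int j + 1) \<Lambda>"
  shows "travel \<beta> (real l, real l) (real l + 3 * real k, real l + real k) (real k * \<Lambda>)"
proof (induction k)
  case 0
  show ?case by (simp add: travel_wait)
next
  case (Suc k)
  have "travel \<beta> (real l + 3 * real k, real l + real k) (real l + 3 * real k + 3, real l + real k + 1) \<Lambda>"
    using knight[of "int l + 3 * int k" "int l + int k"] by simp
  from travel_trans[OF Suc this] show ?case by (simp add: algebra_simps)
qed

lemma travel_isometry:
  assumes z: "travel \<beta> z w T" and L: "bounded_linear L" "\<And>v. norm (L v) = norm v"
    and chess: "\<And>v. chess \<beta> (c + L v) = chess \<beta> v"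
  shows "travel \<beta> (c + L z) (c + L w) T"
proof -
  obtain \<gamma> N C where obt: "0 \<le> T" "\<gamma> 0 = z" "\<gamma> T = w" "countable N" "0 \<le> C"
    "\<forall>s t. norm (\<gamma> s - \<gamma> t) \<le> C * \<bar>s - t\<bar>"
    "\<forall>t. 0 < t \<longrightarrow> t < T \<longrightarrow> t \<notin> N \<longrightarrow>
        (\<exists>D. (\<gamma> has_vector_derivative D) (at t) \<and> chess \<beta> (\<gamma> t) * norm D \<le> 1)"
    using z by (rule travelE)
  note 1 = obt(1-5) obt(6)[rule_format] obt(7)[rule_format]
  interpret L: bounded_linear L by (rule L)
  show ?thesis
  proof (rule travelI[where \<gamma> = "\<lambda>t. c + L (\<gamma> t)" and N = N and C = C])
    show "norm (c + L (\<gamma> s) - (c + L (\<gamma> t))) \<le> C * \<bar>s - t\<bar>" for s t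
      using 1(6)[of s t] L(2) by (simp flip: L.diff)
    fix t assume "0 < t" "t < T" "t \<notin> N"
    then obtain D where D: "(\<gamma> has_vector_derivative D) (at t)" "chess \<beta> (\<gamma> t) * norm D \<le> 1" using 1(7) by blast
    have "((\<lambda>t. c + L (\<gamma> t)) has_vector_derivative 0 + L D) (at t)"
      by (intro has_vector_derivative_add has_vector_derivative_const L.has_vector_derivative D(1))
    then show "\<exists>D. ((\<lambda>t. c + L (\<gamma> t)) has_vector_derivative D) (at t) \<and> chess \<beta> (c + L (\<gamma> t)) * norm D \<le> 1"
      using D(2) by (intro exI[of _ "L D"]) (simp add: chess L(2))
  qed (use 1 in simp_all)
qed

lemma bounded_linear_swap_reflect:
  "bounded_linear (\<lambda>v :: real \<times> real. (snd v, fst v))" "bounded_linear (\<lambda>v :: real \<times> real. (- fst v, snd v))"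
  by (intro bounded_linear_Pair bounded_linear_fst bounded_linear_snd bounded_linear_minus)+

lemma travel_swap: "travel \<beta> (x, y) (x', y') T \<Longrightarrow> travel \<beta> (y, x) (y', x') T"
  using travel_isometry[OF _ bounded_linear_swap_reflect(1), of \<beta> "(x, y)" "(x', y')" T 0]
  by (simp add: norm_Pair case_prod_unfold chess_swap norm_prod_def add.commute zero_prod_def)

lemma travel_reflect: "travel \<beta> (x, y) (x', y') T \<Longrightarrow> travel \<beta> (1 - x, y) (1 - x', y') T"
  using travel_isometry[OF _ bounded_linear_swap_reflect(2), of \<beta> "(x, y)" "(x', y')" T "(1, 0)"]
  by (simp add: norm_Pair chess_reflect norm_prod_def)

section \<open>Asymptotic cost in a given direction\<close>

definition reaches :: "real \<Rightarrow> real \<Rightarrow> real \<Rightarrow> real \<Rightarrow> bool" where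
  "reaches \<beta> x y v \<longleftrightarrow> (\<exists>C. \<forall>s\<ge>0. travel \<beta> (0, 0) (s * x, s * y) (s * v + C))"

lemma reaches_swap: "reaches \<beta> x y v \<Longrightarrow> reaches \<beta> y x v"
  unfolding reaches_def using travel_swap by blast

text \<open>The reflection in x = 1/2 displaces both ends by one unit. The two detours cost at most
  2 \<beta>, which the additive constant absorbs.\<close>

lemma reaches_reflect:
  assumes \<beta>: "1 \<le> \<beta>" and "reaches \<beta> x y v"
  shows "reaches \<beta> (- x) y v"
proof -
  from assms(2) obtain C where C: "\<And>s. s \<ge> 0 \<Longrightarrow> travel \<beta> (0, 0) (s * x, s * y) (s * v + C)"
    unfolding reaches_def by blast
  have "travel \<beta> (0, 0) (s * - x, s * y) (s * v + (C + 2 * \<beta>))" if "s \<ge> 0" for s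
  proof -
    have "travel \<beta> (0, 0) (1, 0) \<beta>" using travel_straight[OF \<beta>, of "(0, 0)" "(1, 0)"] by simp
    moreover have "travel \<beta> (1, 0) (1 - s * x, s * y) (s * v + C)" using travel_reflect[OF C[OF that]] by simp
    moreover have "travel \<beta> (1 - s * x, s * y) (s * - x, s * y) \<beta>"
      using travel_straight[OF \<beta>, of "(1 - s * x, s * y)" "(s * - x, s * y)"] by (simp add: norm_Pair)
    ultimately have "travel \<beta> (0, 0) (s * - x, s * y) (\<beta> + (s * v + C) + \<beta>)" by (meson travel_trans)
    then show ?thesis by (simp add: algebra_simps)
  qed
  then show ?thesis unfolding reaches_def by blast
qed

text \<open>Missing the target by a bounded distance costs a bounded amount, so numbers of moves may
  be rounded to integers.\<close>

lemma reaches_near: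
  assumes \<beta>: "1 \<le> \<beta>"
    and near: "\<And>s. 0 \<le> s \<Longrightarrow> \<exists>a b. travel \<beta> (0, 0) (a, b) (s * v + C) \<and> \<bar>s * x - a\<bar> \<le> K \<and> \<bar>s * y - b\<bar> \<le> K"
  shows "reaches \<beta> x y v"
proof -
  have "travel \<beta> (0, 0) (s * x, s * y) (s * v + (C + \<beta> * (2 * K)))" if s: "s \<ge> 0" for s
  proof -
    obtain a b where ab: "travel \<beta> (0, 0) (a, b) (s * v + C)" "\<bar>s * x - a\<bar> \<le> K" "\<bar>s * y - b\<bar> \<le> K"
      using near[OF s] by blast
    have "norm ((s * x, s * y) - (a, b)) \<le> 2 * K"
      using norm_Pair_le[of "s * x - a" "s * y - b"] ab by simp
    then have "\<beta> * norm ((s * x, s * y) - (a, b)) \<le> \<beta> * (2 * K)" using \<beta> by (intro mult_left_mono) auto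
    from travel_trans[OF ab(1) travel_mono[OF travel_straight[OF \<beta>] this]] show ?thesis by (simp add: algebra_simps)
  qed
  then show ?thesis unfolding reaches_def by blast
qed

lemma reaches_diagonal_horizontal:
  assumes \<beta>: "1 \<le> \<beta>" and xy: "0 \<le> y" "y \<le> x"
  shows "reaches \<beta> x y (x + (sqrt 2 - 1) * y)"
proof (rule reaches_near[OF \<beta>, where C = 0 and K = 1])
  fix s :: real assume s: "0 \<le> s"
  define n where "n = nat \<lfloor>s * y\<rfloor>"
  have sy: "0 \<le> s * y" "s * y \<le> s * x" using s xy by (auto intro: mult_left_mono)
  have n: "real n \<le> s * y" "s * y < real n + 1" using sy by (auto simp: n_def)
  have "travel \<beta> (0, 0) (s * x, real n) (sqrt 2 * real n + \<bar>s * x - real n\<bar>)"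
    using travel_trans[OF travel_diagonal[of "real n" \<beta>] travel_horizontal[of "real n" \<beta> "real n" "s * x"]] by simp
  moreover have "sqrt 2 * real n + \<bar>s * x - real n\<bar> \<le> s * (x + (sqrt 2 - 1) * y) + 0"
  proof -
    have "(sqrt 2 - 1) * real n \<le> (sqrt 2 - 1) * (s * y)" using n by (intro mult_left_mono) auto
    then show ?thesis using n sy by (simp add: algebra_simps)
  qed
  ultimately have "travel \<beta> (0, 0) (s * x, real n) (s * (x + (sqrt 2 - 1) * y) + 0)" by (rule travel_mono)
  then show "\<exists>a b. travel \<beta> (0, 0) (a, b) (s * (x + (sqrt 2 - 1) * y) + 0) \<and> \<bar>s * x - a\<bar> \<le> 1 \<and> \<bar>s * y - b\<bar> \<le> 1"
    using n by (intro exI[of _ "s * x"] exI[of _ "real n"]) auto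
qed

lemma reaches_knight_horizontal:
  assumes \<beta>: "1 \<le> \<beta>" and xy: "0 \<le> y" "3 * y \<le> x" and \<Lambda>: "3 \<le> \<Lambda>"
    and knight: "\<And>i j :: int. even (i + j) \<Longrightarrow> travel \<beta> (of_int i, of_int j) (of_int i + 3, of_int j + 1) \<Lambda>"
  shows "reaches \<beta> x y (x + (\<Lambda> - 3) * y)"
proof (rule reaches_near[OF \<beta>, where C = 0 and K = 1])
  fix s :: real assume s: "0 \<le> s"
  define n where "n = nat \<lfloor>s * y\<rfloor>"
  have sy: "0 \<le> s * y" "s * (3 * y) \<le> s * x" using s xy by (auto intro: mult_left_mono)
  have n: "real n \<le> s * y" "s * y < real n + 1" using sy by (auto simp: n_def)
  have "travel \<beta> (0, 0) (3 * real n, real n) (real n * \<Lambda>)"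
    using travel_knights[OF knight, of 0 n] by simp
  from travel_trans[OF this travel_horizontal[of "real n" \<beta> "3 * real n" "s * x"]]
  have "travel \<beta> (0, 0) (s * x, real n) (real n * \<Lambda> + \<bar>s * x - 3 * real n\<bar>)" by simp
  moreover have "real n * \<Lambda> + \<bar>s * x - 3 * real n\<bar> \<le> s * (x + (\<Lambda> - 3) * y) + 0"
  proof -
    have "(\<Lambda> - 3) * real n \<le> (\<Lambda> - 3) * (s * y)" using n \<Lambda> by (intro mult_left_mono) auto
    then show ?thesis using n sy by (simp add: algebra_simps)
  qed
  ultimately have "travel \<beta> (0, 0) (s * x, real n) (s * (x + (\<Lambda> - 3) * y) + 0)" by (rule travel_mono)
  then show "\<exists>a b. travel \<beta> (0, 0) (a, b) (s * (x + (\<Lambda> - 3) * y) + 0) \<and> \<bar>s * x - a\<bar> \<le> 1 \<and> \<bar>s * y - b\<bar> \<le> 1"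
    using n by (intro exI[of _ "s * x"] exI[of _ "real n"]) auto
qed

lemma reaches_diagonal_knight:
  assumes \<beta>: "1 \<le> \<beta>" and xy: "y \<le> x" "x \<le> 3 * y" and \<Lambda>: "0 \<le> \<Lambda>"
    and knight: "\<And>i j :: int. even (i + j) \<Longrightarrow> travel \<beta> (of_int i, of_int j) (of_int i + 3, of_int j + 1) \<Lambda>"
  shows "reaches \<beta> x y ((\<Lambda> - sqrt 2) / 2 * x + (3 * sqrt 2 - \<Lambda>) / 2 * y)"
proof (rule reaches_near[OF \<beta>, where C = 0 and K = 4])
  fix s :: real assume s: "0 \<le> s"
  \<comment> \<open>The scaled target is X (3, 1) + Y (1, 1), with both coefficients nonnegative in
    the cone y <= x <= 3 y. Rounding them down displaces the end by less than 3 + 1, whence K =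
    4.\<close>
  define X where "X = s * ((x - y) / 2)"
  define Y where "Y = s * ((3 * y - x) / 2)"
  have XY: "0 \<le> X" "0 \<le> Y" using s xy by (simp_all add: X_def Y_def)
  have sx: "s * x = 3 * X + Y" "s * y = X + Y" by (simp_all add: X_def Y_def field_simps)
  define k where "k = nat \<lfloor>X\<rfloor>"
  define l where "l = nat \<lfloor>Y\<rfloor>"
  have k: "real k \<le> X" "X < real k + 1" and l: "real l \<le> Y" "Y < real l + 1" using XY by (auto simp: k_def l_def)
  have "travel \<beta> (0, 0) (real l + 3 * real k, real l + real k) (sqrt 2 * real l + real k * \<Lambda>)"
    by (rule travel_trans[OF travel_diagonal travel_knights[OF knight]]) auto
  moreover have "sqrt 2 * real l + real k * \<Lambda> \<le> sqrt 2 * Y + X * \<Lambda>"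
    using k l \<Lambda> by (intro add_mono mult_left_mono mult_right_mono) auto
  moreover have "sqrt 2 * Y + X * \<Lambda> = s * ((\<Lambda> - sqrt 2) / 2 * x + (3 * sqrt 2 - \<Lambda>) / 2 * y) + 0"
    by (simp add: X_def Y_def field_simps)
  ultimately have "travel \<beta> (0, 0) (real l + 3 * real k, real l + real k)
      (s * ((\<Lambda> - sqrt 2) / 2 * x + (3 * sqrt 2 - \<Lambda>) / 2 * y) + 0)" by (simp only: travel_mono)
  then show "\<exists>a b. travel \<beta> (0, 0) (a, b) (s * ((\<Lambda> - sqrt 2) / 2 * x + (3 * sqrt 2 - \<Lambda>) / 2 * y) + 0) \<and>
      \<bar>s * x - a\<bar> \<le> 4 \<and> \<bar>s * y - b\<bar> \<le> 4"
    using k l unfolding sx by (intro exI conjI) (assumption, linarith+)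
qed

section \<open>From paths and calibrations to \<open>Phi\<close>\<close>

lemma lipschitz_imp_abs_cont01:
  assumes "\<And>s t. norm (u s - u t) \<le> C * \<bar>s - t\<bar>" "0 \<le> C"
  shows "abs_cont01 u"
  unfolding abs_cont01_def
proof (intro allI impI)
  fix e :: real assume "e > 0"
  show "\<exists>d>0. \<forall>(n::nat) (a::nat \<Rightarrow> real) (b::nat \<Rightarrow> real).
        (\<forall>i<n. 0 \<le> a i \<and> a i \<le> b i \<and> b i \<le> 1) \<and>
        (\<forall>i<n. \<forall>j<n. i \<noteq> j \<longrightarrow> b i \<le> a j \<or> b j \<le> a i) \<and>
        (\<Sum>i<n. b i - a i) < d
        \<longrightarrow> (\<Sum>i<n. norm (u (b i) - u (a i))) < e"
  proof (intro exI[of _ "e / (C + 1)"] conjI allI impI; (elim conjE)?)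
    show "e / (C + 1) > 0" using \<open>e > 0\<close> assms(2) by simp
    fix n :: nat and a b :: "nat \<Rightarrow> real"
    assume ab: "\<forall>i<n. 0 \<le> a i \<and> a i \<le> b i \<and> b i \<le> 1" "(\<Sum>i<n. b i - a i) < e / (C + 1)"
    have "(\<Sum>i<n. norm (u (b i) - u (a i))) \<le> (\<Sum>i<n. C * (b i - a i))"
    proof (rule sum_mono)
      fix i assume "i \<in> {..<n}"
      then show "norm (u (b i) - u (a i)) \<le> C * (b i - a i)" using assms(1)[of "b i" "a i"] ab(1) by simp
    qed
    also have "\<dots> = C * (\<Sum>i<n. b i - a i)" by (simp add: sum_distrib_left)
    also have "\<dots> \<le> C * (e / (C + 1))" using ab(2) assms(2) by (intro mult_left_mono) auto
    also have "\<dots> < e" using assms(2) \<open>e > 0\<close> by (simp add: field_simps)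
    finally show "(\<Sum>i<n. norm (u (b i) - u (a i))) < e" .
  qed
qed

text \<open>The weighted speed of the path is at most 1; rescaling its time to [0, 1] and its space
  by \<epsilon> makes the integrand at most \<epsilon> T almost everywhere.\<close>

lemma travel_imp_wlength_le:
  assumes \<epsilon>: "0 < \<epsilon>" and travel: "travel \<beta> (0, 0) ((1 / \<epsilon>) *\<^sub>R \<xi>) T"
  obtains u where "abs_cont01 u" "u 0 = 0" "u 1 = \<xi>" "wlength \<epsilon> \<beta> u \<le> ennreal (\<epsilon> * T)"
proof -
  obtain \<gamma> N C where obt: "0 \<le> T" "\<gamma> 0 = (0, 0)" "\<gamma> T = (1 / \<epsilon>) *\<^sub>R \<xi>" "countable N" "0 \<le> C"
    "\<forall>s t. norm (\<gamma> s - \<gamma> t) \<le> C * \<bar>s - t\<bar>"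
    "\<forall>t. 0 < t \<longrightarrow> t < T \<longrightarrow> t \<notin> N \<longrightarrow>
        (\<exists>D. (\<gamma> has_vector_derivative D) (at t) \<and> chess \<beta> (\<gamma> t) * norm D \<le> 1)"
    using travel by (rule travelE)
  note 1 = obt(1-5) obt(6)[rule_format] obt(7)[rule_format]
  define u where "u t = \<epsilon> *\<^sub>R \<gamma> (t * T)" for t
  have "abs_cont01 u"
  proof (rule lipschitz_imp_abs_cont01)
    show "norm (u s - u t) \<le> \<epsilon> * (C * T) * \<bar>s - t\<bar>" for s t
    proof -
      have "norm (u s - u t) = \<epsilon> * norm (\<gamma> (s * T) - \<gamma> (t * T))"
        using \<epsilon> by (simp add: u_def flip: scaleR_diff_right)
      also have "\<dots> \<le> \<epsilon> * (C * \<bar>s * T - t * T\<bar>)" using \<epsilon> 1(6) by (intro mult_left_mono) auto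
      also have "\<bar>s * T - t * T\<bar> = \<bar>s - t\<bar> * T" using 1(1) by (simp add: abs_mult flip: left_diff_distrib)
      finally show ?thesis by (simp add: algebra_simps)
    qed
    show "0 \<le> \<epsilon> * (C * T)" using \<epsilon> 1 by simp
  qed
  moreover have "u 0 = 0" "u 1 = \<xi>" using \<epsilon> 1 by (simp_all add: u_def zero_prod_def)
  moreover have "wlength \<epsilon> \<beta> u \<le> ennreal (\<epsilon> * T)"
  proof -
    define M where "M = {0, 1} \<union> (\<lambda>t. t / T) ` N"
    have "countable M" using 1(4) by (simp add: M_def)
    then have M: "M \<in> null_sets lebesgue"
      using countable_imp_null_set_lborel null_sets_completionI by blast
    have bound: "chess \<beta> ((1 / \<epsilon>) *\<^sub>R u t) * norm (vector_derivative u (at t)) \<le> \<epsilon> * T"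
      if t: "0 < t" "t < 1" "t \<notin> M" for t
    proof (cases "T = 0")
      case True
      then have "u = (\<lambda>_. \<epsilon> *\<^sub>R \<gamma> 0)" by (simp add: u_def fun_eq_iff)
      then show ?thesis using True by simp
    next
      case False
      with 1(1) have T: "0 < T" by simp
      have "t * T \<notin> N"
      proof
        assume "t * T \<in> N"
        then have "t * T / T \<in> M" unfolding M_def by blast
        with t(3) T show False by simp
      qed
      moreover have "0 < t * T" "t * T < T" using t T by auto
      ultimately obtain D where D: "(\<gamma> has_vector_derivative D) (at (t * T))" "chess \<beta> (\<gamma> (t * T)) * norm D \<le> 1"
        using 1(7) by blast
      have "((\<lambda>t. t * T) has_vector_derivative T) (at t)"
        by (auto intro!: derivative_eq_intros simp flip: has_real_derivative_iff_has_vector_derivative)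
      from vector_diff_chain_at[OF this D(1)]
      have "((\<lambda>t. \<gamma> (t * T)) has_vector_derivative T *\<^sub>R D) (at t)" by (simp add: o_def)
      then have "(u has_vector_derivative \<epsilon> *\<^sub>R T *\<^sub>R D) (at t)"
        unfolding u_def by (rule bounded_linear.has_vector_derivative[OF bounded_linear_scaleR_right])
      then have "vector_derivative u (at t) = \<epsilon> *\<^sub>R T *\<^sub>R D" by (rule vector_derivative_at)
      moreover have "(1 / \<epsilon>) *\<^sub>R u t = \<gamma> (t * T)" using \<epsilon> by (simp add: u_def)
      ultimately have "chess \<beta> ((1 / \<epsilon>) *\<^sub>R u t) * norm (vector_derivative u (at t)) =
          (\<epsilon> * T) * (chess \<beta> (\<gamma> (t * T)) * norm D)" using \<epsilon> T by simp
      also have "\<dots> \<le> (\<epsilon> * T) * 1" using D(2) \<epsilon> T by (intro mult_left_mono) auto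
      finally show ?thesis by simp
    qed
    have "wlength \<epsilon> \<beta> u \<le> (\<integral>\<^sup>+ t. ennreal (\<epsilon> * T) * indicator {0..1::real} t \<partial>lebesgue)"
      unfolding wlength_def
    proof (rule nn_integral_mono_AE)
      have "AE t in lebesgue. t \<notin> M" using M by (rule AE_not_in)
      then show "AE t in lebesgue. ennreal (chess \<beta> ((1 / \<epsilon>) *\<^sub>R u t) * norm (vector_derivative u (at t))) *
          indicator {0..1} t \<le> ennreal (\<epsilon> * T) * indicator {0..1} t"
      proof eventually_elim
        case (elim t)
        show ?case
        proof (cases "t \<in> {0..1}")
          case True
          with elim have "0 < t" "t < 1" by (auto simp: M_def le_less)
          then show ?thesis using bound[OF _ _ elim] by (intro mult_right_mono ennreal_leI) auto
        qed simp
      qed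
    qed
    also have "\<dots> = ennreal (\<epsilon> * T)" by (simp add: nn_integral_cmult_indicator)
    finally show ?thesis .
  qed
  ultimately show ?thesis using that by blast
qed

text \<open>A calibration bounds \<open>dist_eps\<close> below by v - O(\<epsilon>), a path bounds
  it above by v + O(\<epsilon>); this also yields the existence of the limit.\<close>

lemma Phi_eqI:
  assumes \<beta>: "1 \<le> \<beta>" and lower: "supports \<beta> p q" and upper: "reaches \<beta> x y (p * x + q * y)"
  shows "Phi \<beta> (x, y) = p * x + q * y"
proof -
  define v where "v = p * x + q * y"
  obtain W C where W: "calibration \<beta> W" "\<And>x y. p * x + q * y - C \<le> W (x, y)"
    using lower unfolding supports_def by blast
  obtain K where K: "\<And>s. s \<ge> 0 \<Longrightarrow> travel \<beta> (0, 0) (s * x, s * y) (s * v + K)"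
    using upper unfolding reaches_def v_def by blast
  have bounds: "v - \<epsilon> * (C + W (0, 0)) \<le> dist_eps \<epsilon> \<beta> (x, y) \<and> dist_eps \<epsilon> \<beta> (x, y) \<le> v + \<epsilon> * K" if \<epsilon>: "0 < \<epsilon>" for \<epsilon>
  proof -
    define I where "I = (INF u \<in> {u. abs_cont01 u \<and> u 0 = 0 \<and> u 1 = (x, y)}. wlength \<epsilon> \<beta> u)"
    have tr: "travel \<beta> (0, 0) ((1 / \<epsilon>) *\<^sub>R (x, y)) (1 / \<epsilon> * v + K)"
      using K[of "1 / \<epsilon>"] \<epsilon> by simp
    then have nonneg: "0 \<le> 1 / \<epsilon> * v + K" by (simp add: travel_def)
    have eq: "\<epsilon> * (1 / \<epsilon> * v + K) = v + \<epsilon> * K" using \<epsilon> by (simp add: algebra_simps)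
    obtain u where u: "abs_cont01 u" "u 0 = 0" "u 1 = (x, y)" "wlength \<epsilon> \<beta> u \<le> ennreal (v + \<epsilon> * K)"
      using travel_imp_wlength_le[OF \<epsilon> tr] unfolding eq by blast
    have up: "I \<le> ennreal (v + \<epsilon> * K)"
      unfolding I_def by (rule INF_lower2[of u]) (use u in auto)
    have "ennreal (v - \<epsilon> * (C + W (0, 0))) \<le> I"
      unfolding I_def
    proof (rule INF_greatest)
      fix u assume "u \<in> {u. abs_cont01 u \<and> u 0 = 0 \<and> u 1 = (x, y)}"
      then have u: "abs_cont01 u" "u 0 = (0, 0)" "u 1 = (x, y)" by (auto simp: zero_prod_def)
      have "v - \<epsilon> * (C + W (0, 0)) = \<epsilon> * (p * (x / \<epsilon>) + q * (y / \<epsilon>) - C - W (0, 0))"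
        using \<epsilon> by (simp add: v_def algebra_simps)
      also have "\<dots> \<le> \<epsilon> * (W (x / \<epsilon>, y / \<epsilon>) - W (0, 0))" using \<epsilon> W(2)[of "x / \<epsilon>" "y / \<epsilon>"] by (intro mult_left_mono diff_right_mono) auto
      finally have "ennreal (v - \<epsilon> * (C + W (0, 0))) \<le> ennreal (\<epsilon> * (W (x / \<epsilon>, y / \<epsilon>) - W (0, 0)))" by (rule ennreal_leI)
      also have "\<dots> \<le> wlength \<epsilon> \<beta> u"
        using wlength_ge_calibration[OF W(1) \<beta> \<epsilon> u(1)] u(2,3) by simp
      finally show "ennreal (v - \<epsilon> * (C + W (0, 0))) \<le> wlength \<epsilon> \<beta> u" .
    qed
    \<comment> \<open>\<open>enn2real\<close> sends infinity to 0, so finiteness is established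
      before the infimum is converted.\<close>
    moreover have "I < top" using up by (rule order.strict_trans1) simp
    then obtain r where r: "0 \<le> r" "I = ennreal r" by (cases I) auto
    moreover have "0 \<le> v + \<epsilon> * K" using nonneg \<epsilon> unfolding eq[symmetric] by (intro mult_nonneg_nonneg) auto
    moreover have "dist_eps \<epsilon> \<beta> (x, y) = enn2real I" by (simp add: dist_eps_def I_def)
    ultimately show ?thesis using up by (auto simp: ennreal_le_iff2)
  qed
  have "((\<lambda>\<epsilon>. dist_eps \<epsilon> \<beta> (x, y)) \<longlongrightarrow> v) (at_right 0)"
  proof (rule tendsto_sandwich)
    have "((\<lambda>\<epsilon>. v - \<epsilon> * (C + W (0, 0))) \<longlongrightarrow> v - 0 * (C + W (0, 0))) (at_right 0)" by (intro tendsto_intros)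
    then show "((\<lambda>\<epsilon>. v - \<epsilon> * (C + W (0, 0))) \<longlongrightarrow> v) (at_right 0)" by simp
    have "((\<lambda>\<epsilon>. v + \<epsilon> * K) \<longlongrightarrow> v + 0 * K) (at_right 0)" by (intro tendsto_intros)
    then show "((\<lambda>\<epsilon>. v + \<epsilon> * K) \<longlongrightarrow> v) (at_right 0)" by simp
    have pos: "\<forall>\<^sub>F \<epsilon> in at_right (0 :: real). 0 < \<epsilon>" by (simp add: eventually_at_right_less)
    show "\<forall>\<^sub>F \<epsilon> in at_right 0. v - \<epsilon> * (C + W (0, 0)) \<le> dist_eps \<epsilon> \<beta> (x, y)"
      using pos by eventually_elim (use bounds in blast)
    show "\<forall>\<^sub>F \<epsilon> in at_right 0. dist_eps \<epsilon> \<beta> (x, y) \<le> v + \<epsilon> * K"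
      using pos by eventually_elim (use bounds in blast)
  qed
  then show ?thesis unfolding Phi_def v_def by (intro tendsto_Lim) simp_all
qed

lemma Phi_eq_sorted:
  assumes \<beta>: "1 \<le> \<beta>" and lower: "supports \<beta> p q"
    and upper: "reaches \<beta> (max \<bar>x\<bar> \<bar>y\<bar>) (min \<bar>x\<bar> \<bar>y\<bar>) (p * max \<bar>x\<bar> \<bar>y\<bar> + q * min \<bar>x\<bar> \<bar>y\<bar>)"
  shows "Phi \<beta> (x, y) = p * max \<bar>x\<bar> \<bar>y\<bar> + q * min \<bar>x\<bar> \<bar>y\<bar>"
proof -
  have nonneg: "Phi \<beta> (x, y) = p * \<bar>x\<bar> + q * \<bar>y\<bar>"
    if p: "supports \<beta> p q" and r: "reaches \<beta> \<bar>x\<bar> \<bar>y\<bar> (p * \<bar>x\<bar> + q * \<bar>y\<bar>)" for p q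
  proof -
    have 1: "Phi \<beta> (x, y) = p * \<bar>x\<bar> + q * y" if p: "supports \<beta> p q" and r: "reaches \<beta> \<bar>x\<bar> y (p * \<bar>x\<bar> + q * y)" for p q
    proof (cases "0 \<le> x")
      case True
      then show ?thesis using Phi_eqI[OF \<beta> p, of x y] r by simp
    next
      case False
      then show ?thesis
        using Phi_eqI[OF \<beta> supports_reflect[OF p], of x y] reaches_reflect[OF \<beta> r] by simp
    qed
    show ?thesis
    proof (cases "0 \<le> y")
      case True
      then show ?thesis using 1[OF p] r by simp
    next
      case False
      have "supports \<beta> p (- q)" by (intro supports_swap[OF supports_reflect[OF supports_swap[OF p]]])
      moreover have "reaches \<beta> \<bar>x\<bar> (- \<bar>y\<bar>) (p * \<bar>x\<bar> + q * \<bar>y\<bar>)"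
        by (intro reaches_swap[OF reaches_reflect[OF \<beta> reaches_swap[OF r]]])
      ultimately show ?thesis using 1[of p "- q"] False by simp
    qed
  qed
  show ?thesis
  proof (cases "\<bar>y\<bar> \<le> \<bar>x\<bar>")
    case True
    then show ?thesis using nonneg[OF lower] upper by simp
  next
    case False
    then show ?thesis
      using nonneg[OF supports_swap[OF lower]] reaches_swap[OF upper] by (simp add: max_def min_def add.commute)
  qed
qed

section \<open>The geodesic of horizontal displacement 3\<close>

text \<open>Cauchy-Schwarz for a gradient of length r and vertical component s against the segment
  (1, t); equality holds when they are parallel. This is the pointwise form of the duality for
  \<open>Lambda3\<close>.\<close>

lemma sqrt_diff_mult_le:
  assumes "0 \<le> r" "s\<^sup>2 \<le> r\<^sup>2"
  shows "sqrt (r\<^sup>2 - s\<^sup>2) + s * t \<le> r * sqrt (1 + t\<^sup>2)"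
proof -
  have "(sqrt (r\<^sup>2 - s\<^sup>2), s) \<bullet> (1, t) \<le> norm (sqrt (r\<^sup>2 - s\<^sup>2), s) * norm (1 :: real, t)"
    by (rule norm_cauchy_schwarz)
  then show ?thesis using assms by (simp add: norm_Pair)
qed

text \<open>The total rise of a broken line through three unit columns of weights 1, \<beta>, 1 that
  obeys Snell's law with constant \<sigma>.\<close>

definition snell_sum :: "real \<Rightarrow> real \<Rightarrow> real" where
  "snell_sum \<beta> \<sigma> = 2 * \<sigma> / sqrt (1 - \<sigma>\<^sup>2) + \<sigma> / sqrt (\<beta>\<^sup>2 - \<sigma>\<^sup>2)"

lemma divide_sqrt_diff_mono:
  assumes "0 \<le> s" "s < t" "t < r"
  shows "s / sqrt (r\<^sup>2 - s\<^sup>2) < t / sqrt (r\<^sup>2 - t\<^sup>2)"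
proof -
  have "s\<^sup>2 < t\<^sup>2" "t\<^sup>2 < r\<^sup>2" using assms by (auto intro!: power_strict_mono)
  then show ?thesis using assms by (intro frac_less) auto
qed

lemma snell_ex1:
  assumes \<beta>: "1 < \<beta>"
  shows "\<exists>!\<sigma>. 0 < \<sigma> \<and> \<sigma> < 1 \<and> snell_sum \<beta> \<sigma> = 1"
proof -
  have mono: "snell_sum \<beta> s < snell_sum \<beta> t" if "0 \<le> s" "s < t" "t < 1" for s t
    using divide_sqrt_diff_mono[of s t 1] divide_sqrt_diff_mono[of s t \<beta>] that \<beta>
    by (simp add: snell_sum_def)
  have "continuous_on {0..3/5} (snell_sum \<beta>)"
  proof -
    have "1 - x\<^sup>2 \<noteq> 0 \<and> \<beta>\<^sup>2 - x\<^sup>2 \<noteq> 0" if "x \<in> {0..3/5}" for x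
    proof -
      have "x\<^sup>2 \<le> (3/5)\<^sup>2" using that by (intro power_mono) auto
      moreover have "(3/5)\<^sup>2 < (1::real)" by (simp add: power2_eq_square)
      moreover have "1\<^sup>2 < \<beta>\<^sup>2" using \<beta> by (intro power_strict_mono) auto
      ultimately show ?thesis by auto
    qed
    then show ?thesis unfolding snell_sum_def by (intro continuous_intros) auto
  qed
  moreover have "snell_sum \<beta> 0 \<le> 1" by (simp add: snell_sum_def)
  \<comment> \<open>At 3/5 the first root is rational and the first summand alone is 3/2.\<close>
  moreover have "1 \<le> snell_sum \<beta> (3/5)"
  proof -
    have "sqrt (1 - (3/5)\<^sup>2) = 4/5" by (rule real_sqrt_unique) (auto simp: power2_eq_square)
    then have "2 * (3/5) / sqrt (1 - (3/5)\<^sup>2) = (3/2 :: real)" by (simp only:) simp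
    moreover have "1\<^sup>2 < \<beta>\<^sup>2" using \<beta> by (intro power_strict_mono) auto
    then have "0 \<le> (3/5) / sqrt (\<beta>\<^sup>2 - (3/5)\<^sup>2)" by (simp add: power2_eq_square)
    ultimately show ?thesis unfolding snell_sum_def by linarith
  qed
  ultimately obtain \<sigma> where \<sigma>: "0 \<le> \<sigma>" "\<sigma> \<le> 3/5" "snell_sum \<beta> \<sigma> = 1"
    using IVT'[of "snell_sum \<beta>" 0 1 "3/5"] by auto
  moreover have "\<sigma> \<noteq> 0" using \<sigma>(3) by (auto simp: snell_sum_def)
  ultimately have "0 < \<sigma> \<and> \<sigma> < 1 \<and> snell_sum \<beta> \<sigma> = 1" by simp
  moreover have "\<tau> = \<sigma>" if "0 < \<tau> \<and> \<tau> < 1 \<and> snell_sum \<beta> \<tau> = 1" for \<tau>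
    using mono[of \<sigma> \<tau>] mono[of \<tau> \<sigma>] that \<open>0 < \<sigma> \<and> \<sigma> < 1 \<and> snell_sum \<beta> \<sigma> = 1\<close>
    by (cases \<sigma> \<tau> rule: linorder_cases) auto
  ultimately show ?thesis by (rule ex1I)
qed

lemma sigma3_props:
  assumes "1 < \<beta>"
  shows "0 < sigma3 \<beta>" "sigma3 \<beta> < 1" "snell_sum \<beta> (sigma3 \<beta>) = 1"
  using theI'[OF snell_ex1[OF assms]] by (simp_all add: sigma3_def snell_sum_def)

text \<open>At t = 2 the numbers of columns are \<open>pf 2 = 2\<close> and \<open>qf 2 = 1\<close>,
  so \<open>sigma_hat\<close> becomes \<open>sigma3\<close>. Hence \<open>beta_c0\<close> is
  determined by \<open>Lambda3 \<beta> = 2 + sqrt 2\<close>.\<close>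

lemma lnorm_2: "lnorm 2 \<beta> = Lambda3 \<beta> - 2 - sqrt 2"
proof -
  have [simp]: "qf 2 = 1" "pf 2 = 2" by (simp_all add: qf_def pf_def)
  have "sigma_hat 2 \<beta> = sigma3 \<beta>" by (simp add: sigma_hat_def sigma3_def)
  then show ?thesis by (simp add: lnorm_def Lambda3_def Let_def)
qed

text \<open>
  The geodesic rises by \<open>a\<close> in each of the two cells of weight 1 and by \<open>b\<close> in the cell between them.
  \<open>Lambda3\<close> is both the minimum of the path length over \<open>2 a + b = 1\<close> and, dually, the maximum over
  \<open>\<sigma>\<close> of the expression in \<open>Lambda3_eq\<close>; the two bounds below are the two halves of this duality.
\<close>

locale geodesic3 =
  fixes \<beta> :: real
  assumes \<beta>: "1 < \<beta>"
begin

abbreviation \<sigma> where "\<sigma> \<equiv> sigma3 \<beta>"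
definition a where "a = \<sigma> / sqrt (1 - \<sigma>\<^sup>2)"
definition b where "b = \<sigma> / sqrt (\<beta>\<^sup>2 - \<sigma>\<^sup>2)"

lemma \<sigma>_sq: "0 < \<sigma>\<^sup>2" "\<sigma>\<^sup>2 < 1" "1 < \<beta>\<^sup>2"
proof -
  show "0 < \<sigma>\<^sup>2" using sigma3_props[OF \<beta>] by simp
  have "\<sigma>\<^sup>2 < 1\<^sup>2" using sigma3_props[OF \<beta>] by (intro power_strict_mono) auto
  then show "\<sigma>\<^sup>2 < 1" by simp
  have "1\<^sup>2 < \<beta>\<^sup>2" using \<beta> by (intro power_strict_mono) auto
  then show "1 < \<beta>\<^sup>2" by simp
qed

lemma \<sigma>_lt: "\<sigma>\<^sup>2 < \<beta>\<^sup>2" "0 < \<beta>\<^sup>2 - \<sigma>\<^sup>2"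
  using \<sigma>_sq(2,3) by linarith+

lemma ab: "0 < a" "0 < b" "2 * a + b = 1"
  using sigma3_props[OF \<beta>] \<sigma>_sq \<sigma>_lt by (auto simp: a_def b_def snell_sum_def)

lemma sqrt_a: "sqrt (1 + a\<^sup>2) = 1 / sqrt (1 - \<sigma>\<^sup>2)"
  using \<sigma>_sq by (intro real_sqrt_unique) (auto simp: a_def power_divide field_simps)

lemma sqrt_b: "\<beta> * sqrt (1 + b\<^sup>2) = \<beta>\<^sup>2 / sqrt (\<beta>\<^sup>2 - \<sigma>\<^sup>2)"
proof -
  have "sqrt (1 + b\<^sup>2) = \<beta> / sqrt (\<beta>\<^sup>2 - \<sigma>\<^sup>2)"
    using \<sigma>_lt \<beta> by (intro real_sqrt_unique) (simp_all add: b_def power_divide add_divide_eq_iff)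
  then show ?thesis by (simp add: power2_eq_square)
qed

lemma Lambda3_eq_ab: "Lambda3 \<beta> = 2 * sqrt (1 + a\<^sup>2) + \<beta> * sqrt (1 + b\<^sup>2)"
  unfolding sqrt_a sqrt_b Lambda3_def by simp

lemma Lambda3_eq: "Lambda3 \<beta> = 2 * sqrt (1 - \<sigma>\<^sup>2) + sqrt (\<beta>\<^sup>2 - \<sigma>\<^sup>2) + \<sigma>"
proof -
  have "1 / sqrt (1 - \<sigma>\<^sup>2) = sqrt (1 - \<sigma>\<^sup>2) + \<sigma> * a"
    using \<sigma>_sq by (simp add: a_def field_simps flip: power2_eq_square)
  moreover have "\<beta>\<^sup>2 / sqrt (\<beta>\<^sup>2 - \<sigma>\<^sup>2) = sqrt (\<beta>\<^sup>2 - \<sigma>\<^sup>2) + \<sigma> * b"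
    using \<sigma>_lt by (simp add: b_def field_simps flip: power2_eq_square)
  moreover have "\<sigma> * (2 * a + b) = \<sigma>" using ab by simp
  ultimately show ?thesis unfolding Lambda3_def by (simp add: algebra_simps)
qed

text \<open>Since \<beta> > 1, b is at most a, and 2 a + b = 1 puts a into [1/3, 1/2]. The resulting
  range of \<sigma> is rounded outwards.\<close>

lemma \<sigma>_bounds: "(1 / 5) \<le> \<sigma>" "\<sigma> \<le> (3 / 5)"
proof -
  have "b \<le> a" unfolding a_def b_def
    using \<sigma>_sq \<sigma>_lt sigma3_props[OF \<beta>] by (intro divide_left_mono mult_pos_pos) simp_all
  then have "1/3 \<le> a" "a \<le> 1/2" using ab by auto
  then have "(1/3)\<^sup>2 \<le> a\<^sup>2" "a\<^sup>2 \<le> (1/2)\<^sup>2" using ab by (intro power_mono; simp)+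
  moreover have "a\<^sup>2 = \<sigma>\<^sup>2 / (1 - \<sigma>\<^sup>2)" using \<sigma>_sq by (simp add: a_def power_divide)
  ultimately have "(1/3)\<^sup>2 * (1 - \<sigma>\<^sup>2) \<le> \<sigma>\<^sup>2" "\<sigma>\<^sup>2 \<le> (1/2)\<^sup>2 * (1 - \<sigma>\<^sup>2)"
    using \<sigma>_sq by (simp_all add: pos_le_divide_eq pos_divide_le_eq)
  then have "((1 / 5))\<^sup>2 \<le> \<sigma>\<^sup>2" "\<sigma>\<^sup>2 \<le> ((3 / 5))\<^sup>2"
    by (simp_all add: power_divide field_simps)
  then show "(1 / 5) \<le> \<sigma>" "\<sigma> \<le> (3 / 5)"
    using sigma3_props[OF \<beta>] by (auto dest: power2_le_imp_le)
qed

lemma Lambda3_ge: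
  assumes "s\<^sup>2 \<le> 1"
  shows "2 * sqrt (1 - s\<^sup>2) + sqrt (\<beta>\<^sup>2 - s\<^sup>2) + s \<le> Lambda3 \<beta>"
proof -
  have "sqrt (1 - s\<^sup>2) + s * a \<le> sqrt (1 + a\<^sup>2)" using sqrt_diff_mult_le[of 1 s a] assms by simp
  moreover have "sqrt (\<beta>\<^sup>2 - s\<^sup>2) + s * b \<le> \<beta> * sqrt (1 + b\<^sup>2)"
    using \<beta> order.trans[OF assms less_imp_le[OF \<sigma>_sq(3)]] by (intro sqrt_diff_mult_le) simp_all
  moreover have "s * (2 * a + b) = s" using ab by simp
  ultimately show ?thesis unfolding Lambda3_eq_ab by (simp add: algebra_simps)
qed

lemma Lambda3_le:
  assumes "2 * c + d = 1"
  shows "Lambda3 \<beta> \<le> 2 * sqrt (1 + c\<^sup>2) + \<beta> * sqrt (1 + d\<^sup>2)"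
proof -
  have "sqrt (1 - \<sigma>\<^sup>2) + \<sigma> * c \<le> sqrt (1 + c\<^sup>2)" using sqrt_diff_mult_le[of 1 \<sigma> c] \<sigma>_sq by simp
  moreover have "sqrt (\<beta>\<^sup>2 - \<sigma>\<^sup>2) + \<sigma> * d \<le> \<beta> * sqrt (1 + d\<^sup>2)"
    using \<beta> \<sigma>_lt by (intro sqrt_diff_mult_le) simp_all
  moreover have "\<sigma> * (2 * c + d) = \<sigma>" using assms by simp
  ultimately show ?thesis unfolding Lambda3_eq by (simp add: algebra_simps)
qed

end

section \<open>Dependence of \<open>Lambda3\<close> on the weight; numerical bounds and the
  threshold\<close>

lemma Lambda3_strict_mono:
  assumes "1 < \<beta>" "\<beta> < \<beta>'"
  shows "Lambda3 \<beta> < Lambda3 \<beta>'"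
proof -
  interpret A: geodesic3 \<beta> by unfold_locales fact
  interpret B: geodesic3 \<beta>' using assms by unfold_locales simp
  have "\<beta>\<^sup>2 < \<beta>'\<^sup>2" using assms by (intro power_strict_mono) auto
  then have "Lambda3 \<beta> < 2 * sqrt (1 - (sigma3 \<beta>)\<^sup>2) + sqrt (\<beta>'\<^sup>2 - (sigma3 \<beta>)\<^sup>2) + sigma3 \<beta>"
    unfolding A.Lambda3_eq by simp
  \<comment> \<open>The maximiser for \<beta> is a competitor in the dual problem for
    \<beta>'.\<close>
  also have "\<dots> \<le> Lambda3 \<beta>'" using A.\<sigma>_sq by (intro B.Lambda3_ge) simp
  finally show ?thesis .
qed

lemma Lambda3_lipschitz:
  assumes "1 < \<beta>" "\<beta> \<le> \<beta>'" "\<beta>' \<le> 3/2"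
  shows "Lambda3 \<beta>' - Lambda3 \<beta> \<le> 2 * (\<beta>' - \<beta>)"
proof -
  interpret A: geodesic3 \<beta> by unfold_locales fact
  interpret B: geodesic3 \<beta>' using assms by unfold_locales simp
  \<comment> \<open>Conversely the maximiser for \<beta>' is tested at \<beta>. Only the middle root
    depends on the weight, and its difference quotient is at most 3 / (3/2) = 2.\<close>
  define s where "s = sigma3 \<beta>'"
  have "s\<^sup>2 \<le> ((3 / 5))\<^sup>2" using B.\<sigma>_bounds unfolding s_def by (intro power_mono) auto
  then have s: "s\<^sup>2 \<le> (9 / 25)" by (simp add: power2_eq_square)
  have le: "\<beta>\<^sup>2 \<le> \<beta>'\<^sup>2" using assms by (intro power_mono) auto
  have "((4 / 5) :: real)\<^sup>2 = (16 / 25)" by (simp add: power2_eq_square)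
  then have "((4 / 5))\<^sup>2 \<le> \<beta>\<^sup>2 - s\<^sup>2" using s A.\<sigma>_sq(3) by argo
  then have "(4 / 5) \<le> sqrt (\<beta>\<^sup>2 - s\<^sup>2)" by (rule real_le_rsqrt)
  moreover have "sqrt (\<beta>\<^sup>2 - s\<^sup>2) \<le> sqrt (\<beta>'\<^sup>2 - s\<^sup>2)" using le by (intro real_sqrt_le_mono) simp
  ultimately have sum: "3/2 \<le> sqrt (\<beta>'\<^sup>2 - s\<^sup>2) + sqrt (\<beta>\<^sup>2 - s\<^sup>2)" and
    diff: "0 \<le> sqrt (\<beta>'\<^sup>2 - s\<^sup>2) - sqrt (\<beta>\<^sup>2 - s\<^sup>2)" by linarith+
  have "(sqrt (\<beta>'\<^sup>2 - s\<^sup>2) - sqrt (\<beta>\<^sup>2 - s\<^sup>2)) * (3/2)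
      \<le> (sqrt (\<beta>'\<^sup>2 - s\<^sup>2) - sqrt (\<beta>\<^sup>2 - s\<^sup>2)) * (sqrt (\<beta>'\<^sup>2 - s\<^sup>2) + sqrt (\<beta>\<^sup>2 - s\<^sup>2))"
    using sum diff by (intro mult_left_mono)
  also have "\<dots> = (sqrt (\<beta>'\<^sup>2 - s\<^sup>2))\<^sup>2 - (sqrt (\<beta>\<^sup>2 - s\<^sup>2))\<^sup>2" by (simp add: power2_eq_square algebra_simps)
  also have "\<dots> = \<beta>'\<^sup>2 - \<beta>\<^sup>2" using s A.\<sigma>_sq le by simp
  also have "\<dots> = (\<beta>' - \<beta>) * (\<beta>' + \<beta>)" by (simp add: power2_eq_square algebra_simps)
  also have "\<dots> \<le> (\<beta>' - \<beta>) * 3" using assms by (intro mult_left_mono) auto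
  finally have "sqrt (\<beta>'\<^sup>2 - s\<^sup>2) - sqrt (\<beta>\<^sup>2 - s\<^sup>2) \<le> 2 * (\<beta>' - \<beta>)" by simp
  moreover have "2 * sqrt (1 - s\<^sup>2) + sqrt (\<beta>\<^sup>2 - s\<^sup>2) + s \<le> Lambda3 \<beta>"
    using s by (intro A.Lambda3_ge) simp
  ultimately show ?thesis unfolding B.Lambda3_eq s_def[symmetric] by simp
qed

lemma Lambda3_continuous_on: "continuous_on {11/10..7/5} Lambda3"
proof (rule lipschitz_on_continuous_on[where L = 2], rule lipschitz_onI)
  fix x y :: real assume "x \<in> {11/10..7/5}" "y \<in> {11/10..7/5}"
  then show "dist (Lambda3 x) (Lambda3 y) \<le> 2 * dist x y"
    using Lambda3_lipschitz[of x y] Lambda3_lipschitz[of y x] Lambda3_strict_mono[of x y] Lambda3_strict_mono[of y x]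
    by (cases x y rule: linorder_cases) (auto simp: dist_real_def)
qed simp

lemma beta_c0_props: "11/10 < beta_c0" "beta_c0 < 7/5" "Lambda3 beta_c0 = 2 + sqrt 2"
proof -
  interpret lo: geodesic3 "11/10" by unfold_locales simp
  interpret hi: geodesic3 "7/5" by unfold_locales simp
  \<comment> \<open>Upper bound by the straight segment, which rises by 1/3 in each cell.\<close>
  have "sqrt (1 + (1/3)\<^sup>2) \<le> (5271 / 5000)" by (rule real_le_lsqrt) (auto simp: power2_eq_square)
  then have lo: "Lambda3 (11/10) < 2 + sqrt 2" using lo.Lambda3_le[of "1/3" "1/3"] sqrt2_bounds by simp
  \<comment> \<open>Lower bound by the trial value 7/20 in the dual maximum.\<close>
  have "(93 / 100) \<le> sqrt (1 - (7 / 20)\<^sup>2)" "(27 / 20) \<le> sqrt ((7/5)\<^sup>2 - (7 / 20)\<^sup>2)"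
    by (rule real_le_rsqrt; simp add: power2_eq_square)+
  moreover have "2 * sqrt (1 - (7 / 20)\<^sup>2) + sqrt ((7/5)\<^sup>2 - (7 / 20)\<^sup>2) + (7 / 20) \<le> Lambda3 (7/5)"
    by (intro hi.Lambda3_ge) (simp add: power2_eq_square)
  ultimately have hi: "2 + sqrt 2 < Lambda3 (7/5)" using sqrt2_bounds by simp
  obtain \<beta> where \<beta>: "11/10 \<le> \<beta>" "\<beta> \<le> 7/5" "Lambda3 \<beta> = 2 + sqrt 2"
    using IVT'[of Lambda3 "11/10" "2 + sqrt 2" "7/5"] lo hi Lambda3_continuous_on by auto
  have "beta_c0 = \<beta>"
    unfolding beta_c0_def
  proof (rule the_equality)
    show "1 < \<beta> \<and> \<beta> < sqrt 2 \<and> lnorm 2 \<beta> = 0" using \<beta> sqrt2_bounds by (simp add: lnorm_2)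
    fix \<gamma> assume "1 < \<gamma> \<and> \<gamma> < sqrt 2 \<and> lnorm 2 \<gamma> = 0"
    then have "1 < \<gamma>" "Lambda3 \<gamma> = Lambda3 \<beta>" using \<beta> by (simp_all add: lnorm_2)
    then show "\<gamma> = \<beta>"
      using Lambda3_strict_mono[of \<gamma> \<beta>] Lambda3_strict_mono[of \<beta> \<gamma>] \<beta>
      by (cases \<gamma> \<beta> rule: linorder_cases) auto
  qed
  moreover have "\<beta> \<noteq> 11/10" "\<beta> \<noteq> 7/5" using \<beta>(3) lo hi by (metis less_irrefl)+
  ultimately show "11/10 < beta_c0" "beta_c0 < 7/5" "Lambda3 beta_c0 = 2 + sqrt 2"
    using \<beta> by auto
qed

lemma sqrt32_bounds: "(61 / 50) \<le> sqrt (3/2)" "sqrt (3/2) \<le> (49 / 40)"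
  by (rule real_le_rsqrt real_le_lsqrt; simp add: power2_eq_square)+

lemma Lambda3_sqrt32: "(169 / 50) \<le> Lambda3 (sqrt (3/2))" "Lambda3 (sqrt (3/2)) < 2 + sqrt 2"
proof -
  interpret geodesic3 "sqrt (3/2)" using sqrt32_bounds by unfold_locales simp
  have "(929 / 1000) \<le> sqrt (1 - (37 / 100)\<^sup>2)" "(29 / 25) \<le> sqrt ((sqrt (3/2))\<^sup>2 - (37 / 100)\<^sup>2)"
    by (rule real_le_rsqrt; simp add: power2_eq_square)+
  moreover have "2 * sqrt (1 - (37 / 100)\<^sup>2) + sqrt ((sqrt (3/2))\<^sup>2 - (37 / 100)\<^sup>2) + (37 / 100) \<le> Lambda3 (sqrt (3/2))"
    by (intro Lambda3_ge) (simp add: power2_eq_square)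
  ultimately show "(169 / 50) \<le> Lambda3 (sqrt (3/2))" by simp
  \<comment> \<open>A broken line with rises 9/25, 7/25, 9/25, whose sum is 1.\<close>
  have 1: "sqrt (1 + (9 / 25)\<^sup>2) \<le> (1063 / 1000)" "sqrt (1 + (7 / 25)\<^sup>2) \<le> (2077 / 2000)"
    by (rule real_le_lsqrt; simp add: power2_eq_square)+
  have "sqrt (3/2) * sqrt (1 + (7 / 25)\<^sup>2) \<le> (49 / 40) * (2077 / 2000)"
    using 1 sqrt32_bounds by (intro mult_mono) auto
  then have "2 * sqrt (1 + (9 / 25)\<^sup>2) + sqrt (3/2) * sqrt (1 + (7 / 25)\<^sup>2) < 2 + sqrt 2"
    using 1 sqrt2_bounds by simp
  moreover have "Lambda3 (sqrt (3/2)) \<le> 2 * sqrt (1 + (9 / 25)\<^sup>2) + sqrt (3/2) * sqrt (1 + (7 / 25)\<^sup>2)"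
    by (rule Lambda3_le) simp
  ultimately show "Lambda3 (sqrt (3/2)) < 2 + sqrt 2" by simp
qed

lemma sqrt32_le_beta_c0: "sqrt (3/2) \<le> beta_c0"
proof (rule ccontr)
  assume "\<not> sqrt (3/2) \<le> beta_c0"
  then have "Lambda3 beta_c0 < Lambda3 (sqrt (3/2))"
    using beta_c0_props by (intro Lambda3_strict_mono) auto
  then show False using Lambda3_sqrt32 beta_c0_props by simp
qed

text \<open>The source of the ranges in \<open>cell_calibration\<close>: 19/50 is 169/50 - 3, and
  49/50 and 9/20 are rounded bounds for the slope with p + q = sqrt 2.\<close>

lemma Lambda3_bounds:
  assumes "sqrt (3/2) \<le> \<beta>" "\<beta> \<le> beta_c0"
  shows "(169 / 50) \<le> Lambda3 \<beta>" "Lambda3 \<beta> \<le> 2 + sqrt 2"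
proof -
  have "1 < sqrt (3/2)" using sqrt32_bounds by simp
  moreover have mono: "Lambda3 u \<le> Lambda3 v" if "1 < u" "u \<le> v" for u v
    using Lambda3_strict_mono[OF that(1), of v] that(2) by (cases "u = v") simp_all
  ultimately have "Lambda3 (sqrt (3/2)) \<le> Lambda3 \<beta>" "Lambda3 \<beta> \<le> Lambda3 beta_c0"
    using assms by (intro mono; linarith)+
  then show "(169 / 50) \<le> Lambda3 \<beta>" "Lambda3 \<beta> \<le> 2 + sqrt 2"
    using Lambda3_sqrt32 beta_c0_props by linarith+
qed

lemma supports_Lambda3:
  assumes "sqrt (3/2) \<le> \<beta>" "\<beta> \<le> beta_c0"
    and pq: "3 * p + q = Lambda3 \<beta>" "p + q \<le> sqrt 2" "49/50 \<le> p" "p \<le> 1" "19/50 \<le> q" "q \<le> 9/20"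
  shows "supports \<beta> p q"
proof -
  have \<beta>_ge: "(61 / 50) \<le> \<beta>" using assms sqrt32_bounds by simp
  interpret geodesic3 \<beta> using \<beta>_ge by unfold_locales simp
  have "(sqrt (3/2))\<^sup>2 \<le> \<beta>\<^sup>2" using assms by (intro power_mono) auto
  then have "3/2 \<le> \<beta>\<^sup>2" by simp
  \<comment> \<open>The left side is at most 1 + sqrt 2 < 2.42, while 2 \<beta> is at least
    2.44.\<close>
  moreover have "3 * p + q - 1 \<le> 2 * \<beta>"
    using pq(1) \<beta>_ge Lambda3_bounds[OF assms(1,2)] sqrt2_bounds by simp
  ultimately interpret cell_calibration \<beta> p q "sigma3 \<beta>"
    using pq \<beta>_ge \<sigma>_bounds Lambda3_eq by unfold_locales simp_all
  show ?thesis by (rule supports_slope)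
qed

lemma travel_Lambda3:
  fixes i j :: int
  assumes "1 < \<beta>" "even (i + j)"
  shows "travel \<beta> (of_int i, of_int j) (of_int i + 3, of_int j + 1) (Lambda3 \<beta>)"
proof -
  interpret geodesic3 \<beta> by unfold_locales fact
  show ?thesis unfolding Lambda3_eq_ab using assms ab by (intro travel_knight) auto
qed

theorem theorem6p3:
  fixes \<beta> x y :: real
  assumes "\<beta> > 1"
  defines "M \<equiv> max \<bar>x\<bar> \<bar>y\<bar>" and "m \<equiv> min \<bar>x\<bar> \<bar>y\<bar>"
  shows "(\<beta> \<ge> beta_c0 \<longrightarrow> Phi \<beta> (x, y) = M + (sqrt 2 - 1) * m) \<and>
         (sqrt (3/2) \<le> \<beta> \<and> \<beta> \<le> beta_c0 \<longrightarrow>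
            (3 * m \<le> M \<longrightarrow> Phi \<beta> (x, y) = M + (Lambda3 \<beta> - 3) * m) \<and>
            (3 * m \<ge> M \<longrightarrow> Phi \<beta> (x, y) =
               (Lambda3 \<beta> - sqrt 2) / 2 * M + (3 * sqrt 2 - Lambda3 \<beta>) / 2 * m))"
proof (intro conjI impI; (elim conjE)?)
  have Mm: "0 \<le> m" "m \<le> M" by (auto simp: M_def m_def)
  have \<beta>: "1 \<le> \<beta>" using assms(1) by simp
  have Phi: "Phi \<beta> (x, y) = p * M + q * m" if "supports \<beta> p q" "reaches \<beta> M m (p * M + q * m)" for p q
    using Phi_eq_sorted[OF \<beta> that(1), of x y] that(2) by (simp add: M_def m_def)
  {
    assume "beta_c0 \<le> \<beta>"
    \<comment> \<open>At the threshold this slope satisfies 3 p + q = \<open>Lambda3 beta_c0\<close>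
      and p + q = sqrt 2 simultaneously.\<close>
    have c0: "supports beta_c0 1 (sqrt 2 - 1)"
      using sqrt32_le_beta_c0 sqrt2_bounds beta_c0_props(3) by (intro supports_Lambda3) simp_all
    have "supports \<beta> 1 (sqrt 2 - 1)"
      by (rule supports_mono[OF c0 _ \<open>beta_c0 \<le> \<beta>\<close>]) (use beta_c0_props(1) in simp)
    from Phi[OF this] reaches_diagonal_horizontal[OF \<beta> Mm]
    show "Phi \<beta> (x, y) = M + (sqrt 2 - 1) * m" by simp
  next
    assume range: "sqrt (3/2) \<le> \<beta>" "\<beta> \<le> beta_c0" and "3 * m \<le> M"
    note bounds = Lambda3_bounds[OF range]
    have "supports \<beta> 1 (Lambda3 \<beta> - 3)"
      using bounds sqrt2_bounds by (intro supports_Lambda3 range) simp_all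
    moreover have "reaches \<beta> M m (M + (Lambda3 \<beta> - 3) * m)"
      using bounds by (intro reaches_knight_horizontal[OF \<beta> Mm(1) \<open>3 * m \<le> M\<close>] travel_Lambda3 assms(1)) simp_all
    ultimately show "Phi \<beta> (x, y) = M + (Lambda3 \<beta> - 3) * m" using Phi by simp
  next
    assume range: "sqrt (3/2) \<le> \<beta>" "\<beta> \<le> beta_c0" and "M \<le> 3 * m"
    note bounds = Lambda3_bounds[OF range]
    have "supports \<beta> ((Lambda3 \<beta> - sqrt 2) / 2) ((3 * sqrt 2 - Lambda3 \<beta>) / 2)"
      using bounds sqrt2_bounds by (intro supports_Lambda3 range) (simp_all add: field_simps)
    moreover have "reaches \<beta> M m ((Lambda3 \<beta> - sqrt 2) / 2 * M + (3 * sqrt 2 - Lambda3 \<beta>) / 2 * m)"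
      using bounds by (intro reaches_diagonal_knight[OF \<beta> Mm(2) \<open>M \<le> 3 * m\<close>] travel_Lambda3 assms(1)) simp_all
    ultimately show "Phi \<beta> (x, y) = (Lambda3 \<beta> - sqrt 2) / 2 * M + (3 * sqrt 2 - Lambda3 \<beta>) / 2 * m"
      by (rule Phi)
  }
qed

end
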